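(* Let $k$ be a field, $A$ a special $k$-algebra and $X=Spec^2\, A$ its special prime spectrum with its structure sheaf $\mathcal O_X$. Then $\mathcal O_X$ is a sheaf of special $*$-algebras, and $A_M$ is naturally isomorphic to the ring of global sections $\Gamma(X,\mathcal O_X)$. In particular, if $A$ is a special $*$-algebra, then $A\cong\Gamma(X,\mathcal O_X)$.
   Context: All rings are commutative and unital. The algebraic signature $\mathcal D$ of $k$ is the set of all polynomials in finitely many variables over $k$ with no zero rational in $k$. For a $k$-algebra $A$, $M_A=\{D(\bar a): D\in\mathcal D,\ \bar a\text{ an appropriate tuple from }A\}$ (a multiplicative subset) and $A_M:=M_A^{-1}A$ is the canonical localisation of $A$. $A$ is a $*$-algebra if every element of $M_A$ is invertible in $A$. The homogeneous signature $\mathcal H$ of $k$ is the set of all non-zero homogeneous polynomials $P(\bar X,Y)$ over $k$ in finitely many variables $\bar X=(X_1,\ldots,X_n)$ and a distinguished variable $Y$ such that for all $\bar a\in k^n$ and $b\in k$, $P(\bar a,b)=0$ implies $b=0$. An ideal $I$ of $A$ is special if for all $P(\bar X,Y)\in\mathcal H$ and $\bar a,b$ from $A$ with $P(\bar a,b)\in I$, we have $b\in I$. $A$ is special if its ideal $(0)$ is special. $X=Spec^2\,A$ is the set of all special prime ideals of $A$, with the Zariski topology (basic open sets $D(h)=\{\mathfrak p\in X: h\notin\mathfrak p\}$, $h\in A$). For $U\subseteq X$ open, $\mathcal O_X(U)$ is the ring of all maps $s:U\to\coprod_{\mathfrak p\in U}A_{\mathfrak p}$, with $s(\mathfrak p)\in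 A_{\mathfrak p}$, such that for each $\mathfrak p\in U$ there exist $a,b\in A$ and an open $U'\subseteq U$ with $\mathfrak p\in U'$ such that for all $\mathfrak q\in U'$, $b\notin\mathfrak q$ and $s(\mathfrak q)=a/b$ in $A_{\mathfrak q}$. The natural morphism $A_M\to\Gamma(X,\mathcal O_X)$ sends $g/\alpha$ to $[\mathfrak p\mapsto g/\alpha\in A_{\mathfrak p}]$. *)

theory Defs
  imports "HOL-Algebra.Algebra" "HOL-Analysis.Abstract_Topology"
begin

section \<open>Evaluation of polynomials in several variables\<close>

text \<open>
  Polynomials are those of \<^theory>\<open>HOL-Algebra.Indexed_Polynomials\<close>: maps from monomials
  (multisets of variables) to coefficients. The coefficient ring is mapped into the ring of
  arguments by \<open>\<phi>\<close>, as in \<open>eval\<close> of \<^theory>\<open>HOL-Algebra.UnivPoly\<close>.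
\<close>

definition mpoly_eval ::
    "('k, 'l) ring_scheme \<Rightarrow> ('a, 'm) ring_scheme \<Rightarrow> ('k \<Rightarrow> 'a)
      \<Rightarrow> (nat multiset \<Rightarrow> 'k) \<Rightarrow> (nat \<Rightarrow> 'a) \<Rightarrow> 'a" where
  "mpoly_eval K R \<phi> P v =
     (\<Oplus>\<^bsub>R\<^esub> m \<in> {m. P m \<noteq> \<zero>\<^bsub>K\<^esub>}.
        \<phi> (P m) \<otimes>\<^bsub>R\<^esub> (\<Otimes>\<^bsub>R\<^esub> i \<in> set_mset m. v i [^]\<^bsub>R\<^esub> count m i))"

definition base_eval ::
    "('k, 'l) ring_scheme \<Rightarrow> (nat multiset \<Rightarrow> 'k) \<Rightarrow> (nat \<Rightarrow> 'k) \<Rightarrow> 'k" where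
  "base_eval K P v = mpoly_eval K K (\<lambda>c. c) P v"

definition alg_eval ::
    "('k, 'l) ring_scheme \<Rightarrow> ('k, 'a, 'm) module_scheme
      \<Rightarrow> (nat multiset \<Rightarrow> 'k) \<Rightarrow> (nat \<Rightarrow> 'a) \<Rightarrow> 'a" where
  "alg_eval K A P v = mpoly_eval K A (\<lambda>c. c \<odot>\<^bsub>A\<^esub> \<one>\<^bsub>A\<^esub>) P v"


section \<open>Algebraic signature and \<open>*\<close>-algebras\<close>

definition algebraic_signature ::
    "('k, 'l) ring_scheme \<Rightarrow> nat \<Rightarrow> (nat multiset \<Rightarrow> 'k) set" where
  "algebraic_signature K n =
     {D \<in> ring.indexed_pset K {1..n} (carrier K).
        \<forall>v \<in> {1..n} \<rightarrow> carrier K. base_eval K D v \<noteq> \<zero>\<^bsub>K\<^esub>}"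

definition M_set :: "('k, 'l) ring_scheme \<Rightarrow> ('k, 'a, 'm) module_scheme \<Rightarrow> 'a set" where
  "M_set K A =
     {alg_eval K A D v | n D v. D \<in> algebraic_signature K n \<and> v \<in> {1..n} \<rightarrow> carrier A}"

definition star_algebra :: "('k, 'l) ring_scheme \<Rightarrow> ('k, 'a, 'm) module_scheme \<Rightarrow> bool" where
  "star_algebra K A \<longleftrightarrow> algebra K A \<and> M_set K A \<subseteq> Units A"


section \<open>Homogeneous signature and special ideals\<close>

text \<open>Variable \<open>0\<close> plays the role of \<open>Y\<close>, and variables \<open>1, \<dots>, n\<close> that of \<open>X\<^sub>1, \<dots>, X\<^sub>n\<close>.\<close>

definition homogeneous_signature ::
    "('k, 'l) ring_scheme \<Rightarrow> nat \<Rightarrow> (nat multiset \<Rightarrow> 'k) set" where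
  "homogeneous_signature K n =
     {P \<in> ring.indexed_pset K {0..n} (carrier K).
        (\<exists>m. P m \<noteq> \<zero>\<^bsub>K\<^esub>) \<and>
        (\<exists>d. \<forall>m. P m \<noteq> \<zero>\<^bsub>K\<^esub> \<longrightarrow> size m = d) \<and>
        (\<forall>v \<in> {0..n} \<rightarrow> carrier K. base_eval K P v = \<zero>\<^bsub>K\<^esub> \<longrightarrow> v 0 = \<zero>\<^bsub>K\<^esub>)}"

definition special_ideal ::
    "('k, 'l) ring_scheme \<Rightarrow> ('k, 'a, 'm) module_scheme \<Rightarrow> 'a set \<Rightarrow> bool" where
  "special_ideal K A I \<longleftrightarrow> ideal I A \<and>
     (\<forall>n. \<forall>P \<in> homogeneous_signature K n. \<forall>v \<in> {0..n} \<rightarrow> carrier A.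
        alg_eval K A P v \<in> I \<longrightarrow> v 0 \<in> I)"

definition special_algebra :: "('k, 'l) ring_scheme \<Rightarrow> ('k, 'a, 'm) module_scheme \<Rightarrow> bool" where
  "special_algebra K A \<longleftrightarrow> algebra K A \<and> special_ideal K A {\<zero>\<^bsub>A\<^esub>}"


section \<open>Homomorphisms of algebras\<close>

definition alg_hom ::
    "('k, 'l) ring_scheme \<Rightarrow> ('k, 'a, 'm) module_scheme \<Rightarrow> ('k, 'b, 'n) module_scheme
      \<Rightarrow> ('a \<Rightarrow> 'b) set" where
  "alg_hom K A B =
     {h \<in> ring_hom A B. \<forall>c \<in> carrier K. \<forall>a \<in> carrier A. h (c \<odot>\<^bsub>A\<^esub> a) = c \<odot>\<^bsub>B\<^esub> h a}"

definition alg_iso ::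
    "('k, 'l) ring_scheme \<Rightarrow> ('k, 'a, 'm) module_scheme \<Rightarrow> ('k, 'b, 'n) module_scheme
      \<Rightarrow> ('a \<Rightarrow> 'b) set" where
  "alg_iso K A B = {h \<in> alg_hom K A B. bij_betw h (carrier A) (carrier B)}"


section \<open>Localisation\<close>

text \<open>
  \<open>S\<close> is meant to be a multiplicative subset. Fractions are equivalence classes of pairs, and the
  operations are unions over representatives of a class that does not depend on them.
\<close>

definition loc_rel :: "('a, 'm) ring_scheme \<Rightarrow> 'a set \<Rightarrow> (('a \<times> 'a) \<times> ('a \<times> 'a)) set" where
  "loc_rel A S =
     {((a, s), (b, t)) | a s b t. a \<in> carrier A \<and> s \<in> S \<and> b \<in> carrier A \<and> t \<in> S \<and>
        (\<exists>u \<in> S. u \<otimes>\<^bsub>A\<^esub> (a \<otimes>\<^bsub>A\<^esub> t) = u \<otimes>\<^bsub>A\<^esub> (b \<otimes>\<^bsub>A\<^esub> s))}"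

definition fraction :: "('a, 'm) ring_scheme \<Rightarrow> 'a set \<Rightarrow> 'a \<Rightarrow> 'a \<Rightarrow> ('a \<times> 'a) set" where
  "fraction A S a s = loc_rel A S `` {(a, s)}"

definition localisation ::
    "('k, 'a, 'm) module_scheme \<Rightarrow> 'a set \<Rightarrow> ('k, ('a \<times> 'a) set) module" where
  "localisation A S =
     \<lparr>carrier = (carrier A \<times> S) // loc_rel A S,
      monoid.mult = (\<lambda>x y. \<Union>(a, s) \<in> x. \<Union>(b, t) \<in> y. fraction A S (a \<otimes>\<^bsub>A\<^esub> b) (s \<otimes>\<^bsub>A\<^esub> t)),
      monoid.one = fraction A S \<one>\<^bsub>A\<^esub> \<one>\<^bsub>A\<^esub>,
      ring.zero = fraction A S \<zero>\<^bsub>A\<^esub> \<one>\<^bsub>A\<^esub>,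
      ring.add = (\<lambda>x y. \<Union>(a, s) \<in> x. \<Union>(b, t) \<in> y.
               fraction A S (a \<otimes>\<^bsub>A\<^esub> t \<oplus>\<^bsub>A\<^esub> b \<otimes>\<^bsub>A\<^esub> s) (s \<otimes>\<^bsub>A\<^esub> t)),
      module.smult = (\<lambda>c x. \<Union>(a, s) \<in> x. fraction A S (c \<odot>\<^bsub>A\<^esub> a) s)\<rparr>"

definition canonical_localisation ::
    "('k, 'l) ring_scheme \<Rightarrow> ('k, 'a, 'm) module_scheme \<Rightarrow> ('k, ('a \<times> 'a) set) module" where
  "canonical_localisation K A = localisation A (M_set K A)"

definition stalk ::
    "('k, 'a, 'm) module_scheme \<Rightarrow> 'a set \<Rightarrow> ('k, ('a \<times> 'a) set) module" where
  "stalk A p = localisation A (carrier A - p)"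

definition stalk_fraction ::
    "('k, 'a, 'm) module_scheme \<Rightarrow> 'a set \<Rightarrow> 'a \<Rightarrow> 'a \<Rightarrow> ('a \<times> 'a) set" where
  "stalk_fraction A p a b = fraction A (carrier A - p) a b"


section \<open>The special prime spectrum\<close>

definition Spec2 :: "('k, 'l) ring_scheme \<Rightarrow> ('k, 'a, 'm) module_scheme \<Rightarrow> 'a set set" where
  "Spec2 K A = {p. primeideal p A \<and> special_ideal K A p}"

definition basic_open ::
    "('k, 'l) ring_scheme \<Rightarrow> ('k, 'a, 'm) module_scheme \<Rightarrow> 'a \<Rightarrow> 'a set set" where
  "basic_open K A h = {p \<in> Spec2 K A. h \<notin> p}"

definition zariski ::
    "('k, 'l) ring_scheme \<Rightarrow> ('k, 'a, 'm) module_scheme \<Rightarrow> 'a set topology" where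
  "zariski K A = topology_generated_by (basic_open K A ` carrier A)"

lemma basic_open_Int:
  assumes "g \<in> carrier A" "h \<in> carrier A"
  shows "basic_open K A g \<inter> basic_open K A h = basic_open K A (g \<otimes>\<^bsub>A\<^esub> h)"
proof -
  have "g \<otimes>\<^bsub>A\<^esub> h \<in> p \<longleftrightarrow> g \<in> p \<or> h \<in> p" if "primeideal p A" for p
  proof
    show "g \<in> p \<or> h \<in> p" if "g \<otimes>\<^bsub>A\<^esub> h \<in> p"
      using primeideal.I_prime[OF \<open>primeideal p A\<close> assms that] .
    have "ideal p A" using that by (rule primeideal.axioms(1))
    then show "g \<otimes>\<^bsub>A\<^esub> h \<in> p" if "g \<in> p \<or> h \<in> p"
      using that assms ideal.I_l_closed ideal.I_r_closed by metis
  qed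
  then show ?thesis
    by (auto simp: basic_open_def Spec2_def)
qed

lemma topspace_zariski:
  assumes "cring A"
  shows "topspace (zariski K A) = Spec2 K A"
proof -
  interpret cring A by fact
  have "\<one>\<^bsub>A\<^esub> \<notin> p" if "primeideal p A" for p
    using ideal.one_imp_carrier[OF primeideal.axioms(1)[OF that]] primeideal.I_notcarr[OF that]
    by metis
  then have "basic_open K A \<one>\<^bsub>A\<^esub> = Spec2 K A"
    by (auto simp: basic_open_def Spec2_def)
  moreover have "basic_open K A h \<subseteq> Spec2 K A" for h
    by (auto simp: basic_open_def)
  ultimately show ?thesis
    unfolding zariski_def topology_generated_by_topspace by blast
qed

lemma openin_zariski_iff:
  assumes "cring A"
  shows "openin (zariski K A) U \<longleftrightarrow> (\<exists>H \<subseteq> carrier A. U = (\<Union>h \<in> H. basic_open K A h))"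
proof
  interpret cring A by fact
  assume "openin (zariski K A) U"
  then have "generate_topology_on (basic_open K A ` carrier A) U"
    by (simp add: zariski_def openin_topology_generated_by_iff)
  then show "\<exists>H \<subseteq> carrier A. U = (\<Union>h \<in> H. basic_open K A h)"
  proof induction
    case Empty
    then show ?case by blast
  next
    case (Int U V)
    then obtain G H where G: "G \<subseteq> carrier A" "U = (\<Union>g \<in> G. basic_open K A g)"
      and H: "H \<subseteq> carrier A" "V = (\<Union>h \<in> H. basic_open K A h)" by blast
    have "U \<inter> V = (\<Union>g \<in> G. \<Union>h \<in> H. basic_open K A g \<inter> basic_open K A h)"
      using G H by blast
    also have "\<dots> = (\<Union>g \<in> G. \<Union>h \<in> H. basic_open K A (g \<otimes>\<^bsub>A\<^esub> h))"
      using G(1) H(1) by (intro SUP_cong refl basic_open_Int) auto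
    also have "\<dots> = (\<Union>f \<in> (\<lambda>(g, h). g \<otimes>\<^bsub>A\<^esub> h) ` (G \<times> H). basic_open K A f)"
      by auto
    finally have "U \<inter> V = \<dots>" .
    moreover have "(\<lambda>(g, h). g \<otimes>\<^bsub>A\<^esub> h) ` (G \<times> H) \<subseteq> carrier A"
      using G(1) H(1) by auto
    ultimately show ?case by blast
  next
    case (UN \<U>)
    then obtain H where sub: "\<And>U. U \<in> \<U> \<Longrightarrow> H U \<subseteq> carrier A"
      and eq: "\<And>U. U \<in> \<U> \<Longrightarrow> U = (\<Union>h \<in> H U. basic_open K A h)"
      by metis
    have "\<Union>\<U> = (\<Union>U \<in> \<U>. \<Union>h \<in> H U. basic_open K A h)"
      using SUP_cong[OF refl eq, of \<U> "\<lambda>U. U"] by simp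
    then have "\<Union>\<U> = (\<Union>h \<in> (\<Union>U \<in> \<U>. H U). basic_open K A h)"
      by simp
    moreover have "(\<Union>U \<in> \<U>. H U) \<subseteq> carrier A"
      using sub by (rule UN_least)
    ultimately show ?case by blast
  next
    case (Basis U)
    then obtain h where "h \<in> carrier A" "U = basic_open K A h" by blast
    then show ?case by (intro exI[of _ "{h}"]) auto
  qed
next
  assume "\<exists>H \<subseteq> carrier A. U = (\<Union>h \<in> H. basic_open K A h)"
  then obtain H where "H \<subseteq> carrier A" "U = (\<Union>h \<in> H. basic_open K A h)" by blast
  then show "openin (zariski K A) U"
    by (simp, intro openin_Union) (auto simp: zariski_def intro!: topology_generated_by_Basis)
qed


section \<open>The structure sheaf\<close>

text \<open>
  A section over \<open>U\<close> is a dependent function on \<open>U\<close>, made extensional (\<open>undefined\<close> outside \<open>U\<close>) so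
  that equality of sections is equality on \<open>U\<close>. Restriction of sections is \<^const>\<open>restrict\<close>.
\<close>

definition structure_sheaf ::
    "('k, 'l) ring_scheme \<Rightarrow> ('k, 'a, 'm) module_scheme \<Rightarrow> 'a set set
      \<Rightarrow> ('k, 'a set \<Rightarrow> ('a \<times> 'a) set) module" where
  "structure_sheaf K A U =
     \<lparr>carrier =
        {s \<in> (\<Pi>\<^sub>E p \<in> U. carrier (stalk A p)).
           \<forall>p \<in> U. \<exists>a \<in> carrier A. \<exists>b \<in> carrier A. \<exists>U'.
             openin (zariski K A) U' \<and> U' \<subseteq> U \<and> p \<in> U' \<and>
             (\<forall>q \<in> U'. b \<notin> q \<and> s q = stalk_fraction A q a b)},
      monoid.mult = (\<lambda>s t. \<lambda>p \<in> U. s p \<otimes>\<^bsub>stalk A p\<^esub> t p),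
      monoid.one = (\<lambda>p \<in> U. \<one>\<^bsub>stalk A p\<^esub>),
      ring.zero = (\<lambda>p \<in> U. \<zero>\<^bsub>stalk A p\<^esub>),
      ring.add = (\<lambda>s t. \<lambda>p \<in> U. s p \<oplus>\<^bsub>stalk A p\<^esub> t p),
      module.smult = (\<lambda>c s. \<lambda>p \<in> U. c \<odot>\<^bsub>stalk A p\<^esub> s p)\<rparr>"

abbreviation global_sections ::
    "('k, 'l) ring_scheme \<Rightarrow> ('k, 'a, 'm) module_scheme
      \<Rightarrow> ('k, 'a set \<Rightarrow> ('a \<times> 'a) set) module" where
  "global_sections K A \<equiv> structure_sheaf K A (Spec2 K A)"


section \<open>Sheaves of algebras\<close>

text \<open>
  \<open>\<rho> U V\<close> is the restriction map from \<open>F U\<close> to \<open>F V\<close>, for \<open>V \<subseteq> U\<close>. The assumption \<open>glue\<close> combines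
  locality and gluing. It includes the empty cover, so that \<open>F {}\<close> is the zero algebra.
\<close>

locale sheaf_of_algebras =
  fixes K :: "('k, 'l) ring_scheme"
    and T :: "'x topology"
    and F :: "'x set \<Rightarrow> ('k, 's) module"
    and \<rho> :: "'x set \<Rightarrow> 'x set \<Rightarrow> 's \<Rightarrow> 's"
  assumes algebra_sections: "openin T U \<Longrightarrow> algebra K (F U)"
    and restr_hom:
      "openin T U \<Longrightarrow> openin T V \<Longrightarrow> V \<subseteq> U \<Longrightarrow> \<rho> U V \<in> alg_hom K (F U) (F V)"
    and restr_id:
      "openin T U \<Longrightarrow> s \<in> carrier (F U) \<Longrightarrow> \<rho> U U s = s"
    and restr_comp:
      "openin T U \<Longrightarrow> openin T V \<Longrightarrow> openin T W \<Longrightarrow> W \<subseteq> V \<Longrightarrow> V \<subseteq> U \<Longrightarrow> s \<in> carrier (F U)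
        \<Longrightarrow> \<rho> V W (\<rho> U V s) = \<rho> U W s"
    and glue:
      "(\<And>U. U \<in> \<U> \<Longrightarrow> openin T U) \<Longrightarrow> (\<And>U. U \<in> \<U> \<Longrightarrow> \<sigma> U \<in> carrier (F U))
        \<Longrightarrow> (\<And>U V. U \<in> \<U> \<Longrightarrow> V \<in> \<U> \<Longrightarrow> \<rho> U (U \<inter> V) (\<sigma> U) = \<rho> V (U \<inter> V) (\<sigma> V))
        \<Longrightarrow> \<exists>!t. t \<in> carrier (F (\<Union>\<U>)) \<and> (\<forall>U \<in> \<U>. \<rho> (\<Union>\<U>) U t = \<sigma> U)"

locale sheaf_of_special_star_algebras = sheaf_of_algebras +
  assumes special: "openin T U \<Longrightarrow> special_algebra K (F U)"
    and star: "openin T U \<Longrightarrow> star_algebra K (F U)"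

end

theory Submission
  imports Defs
begin

text \<open>
  An ideal \<open>J\<close> disjoint from \<open>M\<close> lies in a special prime: \<open>P(X, D(Z))\<close> is in the algebraic signature
  for \<open>P \<in> \<H>\<close> and \<open>D \<in> \<D>\<close>, which makes an ideal maximal with this property special. A special
  ideal \<open>I\<close> is the intersection of the special primes above it, because the ideals \<open>(I : x)\<close> are
  special by homogeneity: \<open>x\<^sup>d P(a) = P(x a)\<close>. The same scaling clears denominators, so localisations
  of a special algebra are special, and it shows that \<open>P(a, b)/c \<in> A\<^sub>p\<close> is a unit if \<open>b \<notin> p\<close>; hence stalks,
  and with them rings of sections, are special \<open>*\<close>-algebras.

  Since annihilators in a special algebra are special ideals, fractions that agree in all stalks are
  equal. For a global section \<open>s\<close>, the ideal of all \<open>f\<close> with \<open>f s \<in> A\<close> is in no special prime: if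
  \<open>s = a/b\<close> on \<open>D(h)\<close>, then \<open>h b s = h a\<close> everywhere. It therefore meets \<open>M\<close>, that is, \<open>s = a/\<alpha>\<close> with
  \<open>\<alpha> \<in> M\<close>.
\<close>

section \<open>Evaluation of polynomials\<close>

text \<open>The classical argument writes 1 as a combination of finitely many local denominators.
  That is out of reach here: a proper ideal lies in no special prime as soon as it meets
  \<open>M\<close>, so elements of \<open>M\<close> take over the role of 1. The two signatures fit
  together through homogenisation. A polynomial D without zeros becomes some P in
  \<open>\<H>\<close> with D(a) = P(a, 1); a special ideal containing D(a) then contains 1, so
  special primes miss \<open>M\<close>. In the other direction, a zero of P(X, D(Z)) would force
  D(Z) = 0, so this composite has no zeros. Consequently an ideal lies in no special prime exactly
  when it meets \<open>M\<close>. Two facts about special ideals shape the rest. They are radical,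
  since \<open>Y^2\<close> is in \<open>\<H>\<close>, and their colon ideals are special; so an
  equality of fractions on the basic open set of h becomes an identity in A after multiplication by
  h itself, not by an unknown power of h. And homogeneity moves a factor into the arguments only in
  positive degree, which is arranged by passing from P to Y P.\<close>

definition monom_eval :: "('a, 'm) ring_scheme \<Rightarrow> (nat \<Rightarrow> 'a) \<Rightarrow> nat multiset \<Rightarrow> 'a" where
  "monom_eval R v m = (\<Otimes>\<^bsub>R\<^esub> i \<in> set_mset m. v i [^]\<^bsub>R\<^esub> count m i)"

lemma (in cring) monom_eval_closed [intro]:
  assumes "set_mset m \<subseteq> I" "v \<in> I \<rightarrow> carrier R"
  shows "monom_eval R v m \<in> carrier R"
  unfolding monom_eval_def using assms by (intro finprod_closed) (auto simp: Pi_def)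

lemma (in cring) monom_eval_add_mset:
  assumes "set_mset m \<subseteq> I" "i \<in> I" "v \<in> I \<rightarrow> carrier R"
  shows "monom_eval R v (add_mset i m) = v i \<otimes> monom_eval R v m"
proof -
  have v: "v j \<in> carrier R" if "j \<in># m \<or> j = i" for j
    using assms that by (auto simp: Pi_def)
  \<comment> \<open>The factor at \<open>i\<close> is isolated whether or not \<open>i\<close>
    occurs, an absent variable having exponent 0. Applied to both monomials, this avoids asking
    whether the index set grows.\<close>
  have split: "monom_eval R v m' =
      v i [^] count m' i \<otimes> (\<Otimes>j \<in> set_mset m' - {i}. v j [^] count m' j)"
    if "set_mset m' \<subseteq> insert i (set_mset m)" for m'
  proof (cases "i \<in># m'")
    case True
    then have "monom_eval R v m' = (\<Otimes>j \<in> insert i (set_mset m' - {i}). v j [^] count m' j)"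
      by (simp add: monom_eval_def insert_absorb)
    also have "\<dots> = v i [^] count m' i \<otimes> (\<Otimes>j \<in> set_mset m' - {i}. v j [^] count m' j)"
      using that v by (intro finprod_insert) auto
    finally show ?thesis .
  next
    case False
    then have "count m' i = 0" "set_mset m' - {i} = set_mset m'"
      by (auto simp: not_in_iff)
    moreover have "monom_eval R v m' \<in> carrier R"
      using that v by (intro monom_eval_closed[of _ "set_mset m'"]) auto
    ultimately show ?thesis by (simp add: monom_eval_def)
  qed
  let ?p = "\<Otimes>j \<in> set_mset m - {i}. v j [^] count m j"
  have p: "?p \<in> carrier R" using v by (intro finprod_closed) auto
  have "(\<Otimes>j \<in> set_mset (add_mset i m) - {i}. v j [^] count (add_mset i m) j) = ?p"
    using v by (intro finprod_cong') auto
  then show ?thesis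
    using split[of "add_mset i m"] split[OF subset_insertI] v p by (simp add: m_ac)
qed

lemma (in cring) monom_eval_scale:
  assumes "set_mset m \<subseteq> I" "v \<in> I \<rightarrow> carrier R" "c \<in> carrier R"
  shows "monom_eval R (\<lambda>i. c \<otimes> v i) m = c [^] size m \<otimes> monom_eval R v m"
  using assms(1)
proof (induction m)
  case empty
  then show ?case by (simp add: monom_eval_def)
next
  case (add i m)
  have [simp]: "v i \<in> carrier R" "monom_eval R v m \<in> carrier R"
    using add.prems assms(2) by auto
  have *: "(\<lambda>i. c \<otimes> v i) \<in> I \<rightarrow> carrier R"
    using assms by auto
  have "monom_eval R (\<lambda>i. c \<otimes> v i) (add_mset i m)
      = c \<otimes> v i \<otimes> (c [^] size m \<otimes> monom_eval R v m)"
    using add * by (subst monom_eval_add_mset[of _ I]) auto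
  also have "\<dots> = c [^] size (add_mset i m) \<otimes> monom_eval R v (add_mset i m)"
    using add assms by (subst monom_eval_add_mset[of _ I]) (auto simp: m_ac)
  finally show ?case .
qed

context ring
begin

text \<open>Needed to give evaluation its meaning: \<open>finsum\<close> over an infinite index set
  is zero by convention.\<close>

lemma indexed_pset_finite_support:
  assumes "P \<in> indexed_pset I L"
  shows "finite {m. P m \<noteq> \<zero>}"
  using assms
proof induction
  case (indexed_const k)
  then show ?case
    by (rule_tac finite_subset[of _ "{{#}}"]) (auto simp: indexed_const_def)
next
  case (indexed_padd P Q)
  show ?case
    by (rule finite_subset[OF _ finite_UnI[OF indexed_padd.IH]]) (auto simp: indexed_padd_def)
next
  case (indexed_pmult P i)
  show ?case
    by (rule finite_subset[OF _ finite_imageI[OF indexed_pmult.IH, of "add_mset i"]])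
      (auto simp: indexed_pmult_def image_iff dest!: multi_member_split split: if_splits)
qed

lemma indexed_pset_support_vars:
  assumes "P \<in> indexed_pset I L" "P m \<noteq> \<zero>"
  shows "set_mset m \<subseteq> I"
  using assms
proof (induction arbitrary: m)
  case (indexed_const k)
  then show ?case
    by (auto simp: indexed_const_def split: if_splits)
next
  case (indexed_padd P Q)
  then have "P m \<noteq> \<zero> \<or> Q m \<noteq> \<zero>" by (auto simp: indexed_padd_def)
  then show ?case using indexed_padd.IH by blast
next
  case (indexed_pmult P i)
  then have "i \<in># m" "set_mset (m - {#i#}) \<subseteq> I"
    by (auto simp: indexed_pmult_def split: if_splits)
  moreover have "set_mset m = insert i (set_mset (m - {#i#}))"
    using \<open>i \<in># m\<close> by (metis insert_DiffM set_mset_add_mset_insert)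
  ultimately show ?case using indexed_pmult.hyps by simp
qed

end

context ring_hom_cring
begin

lemma mpoly_eval_eq_finsum:
  assumes "\<And>m. P m \<in> carrier R" "v \<in> I \<rightarrow> carrier S" "finite F"
    and "\<And>m. m \<in> F \<Longrightarrow> set_mset m \<subseteq> I" "\<And>m. P m \<noteq> \<zero> \<Longrightarrow> m \<in> F"
  shows "mpoly_eval R S h P v = (\<Oplus>\<^bsub>S\<^esub> m \<in> F. h (P m) \<otimes>\<^bsub>S\<^esub> monom_eval S v m)"
proof -
  have *: "monom_eval S v m \<in> carrier S" if "m \<in> F" for m
    using assms(2) assms(4)[OF that] by auto
  show ?thesis
    unfolding mpoly_eval_def monom_eval_def[symmetric]
    using assms * by (intro S.add.finprod_mono_neutral_cong_left) auto
qed

lemma indexed_pset_coeff: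
  "P \<in> R.indexed_pset I (carrier R) \<Longrightarrow> P m \<in> carrier R"
  using R.carrier_coeffE[OF R.indexed_pset_in_carrier] by blast

lemma mpoly_eval_support:
  assumes "P \<in> R.indexed_pset I (carrier R)" "v \<in> I \<rightarrow> carrier S"
  shows "mpoly_eval R S h P v =
    (\<Oplus>\<^bsub>S\<^esub> m \<in> {m. P m \<noteq> \<zero>}. h (P m) \<otimes>\<^bsub>S\<^esub> monom_eval S v m)"
  using assms
  by (intro mpoly_eval_eq_finsum[of _ _ I] R.indexed_pset_finite_support indexed_pset_coeff)
    (auto dest: R.indexed_pset_support_vars)

lemma mpoly_eval_closed [intro]:
  assumes "P \<in> R.indexed_pset I (carrier R)" "v \<in> I \<rightarrow> carrier S"
  shows "mpoly_eval R S h P v \<in> carrier S"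
proof -
  have "monom_eval S v m \<in> carrier S" if "P m \<noteq> \<zero>" for m
    using assms R.indexed_pset_support_vars[OF assms(1) that] by auto
  then show ?thesis
    using assms indexed_pset_coeff[OF assms(1)]
    by (subst mpoly_eval_support[OF assms]) (auto intro!: S.finsum_closed)
qed

lemma mpoly_eval_const:
  assumes "c \<in> carrier R"
  shows "mpoly_eval R S h (R.indexed_const c) v = h c"
  using assms
  by (subst mpoly_eval_eq_finsum[of _ _ "{}" "{{#}}"])
    (auto simp: R.indexed_const_def monom_eval_def split: if_splits)

lemma mpoly_eval_padd:
  assumes P: "P \<in> R.indexed_pset I (carrier R)" and Q: "Q \<in> R.indexed_pset I (carrier R)"
    and v: "v \<in> I \<rightarrow> carrier S"
  shows "mpoly_eval R S h (R.indexed_padd P Q) v = mpoly_eval R S h P v \<oplus>\<^bsub>S\<^esub> mpoly_eval R S h Q v"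
proof -
  let ?F = "{m. P m \<noteq> \<zero>} \<union> {m. Q m \<noteq> \<zero>}"
  note coeff = indexed_pset_coeff[OF P] indexed_pset_coeff[OF Q]
  have fin: "finite ?F" using P Q R.indexed_pset_finite_support by blast
  have vars: "set_mset m \<subseteq> I" if "m \<in> ?F" for m
    using that R.indexed_pset_support_vars[OF P] R.indexed_pset_support_vars[OF Q] by blast
  have mon: "monom_eval S v m \<in> carrier S" if "m \<in> ?F" for m
    using v vars[OF that] by auto
  have eq: "mpoly_eval R S h T v = (\<Oplus>\<^bsub>S\<^esub> m \<in> ?F. h (T m) \<otimes>\<^bsub>S\<^esub> monom_eval S v m)"
    if "\<And>m. T m \<in> carrier R" "\<And>m. T m \<noteq> \<zero> \<Longrightarrow> m \<in> ?F" for T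
    using that v fin vars by (intro mpoly_eval_eq_finsum[of _ _ I]) auto
  have "mpoly_eval R S h (R.indexed_padd P Q) v =
      (\<Oplus>\<^bsub>S\<^esub> m \<in> ?F. h (R.indexed_padd P Q m) \<otimes>\<^bsub>S\<^esub> monom_eval S v m)"
    using coeff by (intro eq) (auto simp: R.indexed_padd_def)
  also have "\<dots> =
      (\<Oplus>\<^bsub>S\<^esub> m \<in> ?F. h (P m) \<otimes>\<^bsub>S\<^esub> monom_eval S v m \<oplus>\<^bsub>S\<^esub> h (Q m) \<otimes>\<^bsub>S\<^esub> monom_eval S v m)"
    using coeff mon by (intro S.finsum_cong') (auto simp: R.indexed_padd_def S.l_distr)
  also have "\<dots> = mpoly_eval R S h P v \<oplus>\<^bsub>S\<^esub> mpoly_eval R S h Q v"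
    using coeff mon by (simp add: eq[of P] eq[of Q] S.finsum_addf Pi_def)
  finally show ?thesis .
qed

lemma mpoly_eval_pmult:
  assumes P: "P \<in> R.indexed_pset I (carrier R)" and i: "i \<in> I" and v: "v \<in> I \<rightarrow> carrier S"
  shows "mpoly_eval R S h (R.indexed_pmult P i) v = mpoly_eval R S h P v \<otimes>\<^bsub>S\<^esub> v i"
proof -
  let ?F = "{m. P m \<noteq> \<zero>}"
  note coeff = indexed_pset_coeff[OF P]
  have coeff': "R.indexed_pmult P i m \<in> carrier R" for m
    using coeff by (simp add: R.indexed_pmult_def)
  have fin: "finite ?F" using P R.indexed_pset_finite_support by blast
  have vars: "set_mset m \<subseteq> I" if "m \<in> ?F" for m
    using that R.indexed_pset_support_vars[OF P] by blast
  have mon: "monom_eval S v m \<in> carrier S" if "m \<in> ?F" for m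
    using v vars[OF that] by auto
  have vi: "v i \<in> carrier S" using i v by auto
  have add: "monom_eval S v (add_mset i m) = monom_eval S v m \<otimes>\<^bsub>S\<^esub> v i" if "m \<in> ?F" for m
    using S.monom_eval_add_mset[OF vars[OF that] i v] mon[OF that] vi by (simp add: S.m_comm)
  have "mpoly_eval R S h (R.indexed_pmult P i) v =
      (\<Oplus>\<^bsub>S\<^esub> m \<in> add_mset i ` ?F. h (R.indexed_pmult P i m) \<otimes>\<^bsub>S\<^esub> monom_eval S v m)"
  proof (intro mpoly_eval_eq_finsum[of _ _ I] coeff' v finite_imageI fin)
    show "set_mset m \<subseteq> I" if "m \<in> add_mset i ` ?F" for m
    proof -
      from that obtain m' where "m = add_mset i m'" "m' \<in> ?F" by blast
      then show ?thesis using vars[of m'] i by simp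
    qed
    show "m \<in> add_mset i ` ?F" if "R.indexed_pmult P i m \<noteq> \<zero>" for m
      using that by (auto simp: R.indexed_pmult_def image_iff split: if_splits
          intro!: bexI[of _ "m - {#i#}"])
  qed
  also have "\<dots> = (\<Oplus>\<^bsub>S\<^esub> m \<in> ?F. h (P m) \<otimes>\<^bsub>S\<^esub> monom_eval S v m \<otimes>\<^bsub>S\<^esub> v i)"
    using coeff mon vi add
    by (subst S.add.finprod_reindex)
      (auto simp: R.indexed_pmult_def S.m_assoc inj_on_def intro!: S.finsum_cong')
  also have "\<dots> = mpoly_eval R S h P v \<otimes>\<^bsub>S\<^esub> v i"
    using coeff mon vi fin by (subst mpoly_eval_support[OF P v], subst S.finsum_ldistr) auto
  finally show ?thesis .
qed

text \<open>Valuations are total functions on \<open>nat\<close>. That values outside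
  \<open>I\<close> do not matter is what permits overriding a coordinate or extending a tuple by new
  variables.\<close>

lemma mpoly_eval_cong:
  assumes P: "P \<in> R.indexed_pset I (carrier R)" and v: "v \<in> I \<rightarrow> carrier S"
    and eq: "\<And>i. i \<in> I \<Longrightarrow> v i = w i"
  shows "mpoly_eval R S h P v = mpoly_eval R S h P w"
proof -
  have w: "w \<in> I \<rightarrow> carrier S" using v eq by (auto simp: Pi_def)
  show ?thesis
    using P v w eq
    by induction (simp_all add: mpoly_eval_const mpoly_eval_padd[of _ I] mpoly_eval_pmult[of _ I])
qed

text \<open>Each monomial that occurs has degree \<open>d\<close> and contributes the same factor
  \<open>c^d\<close>. No inverse of \<open>c\<close> is involved, so \<open>c\<close> may be a zero
  divisor.\<close>

lemma mpoly_eval_scale_homogeneous: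
  assumes P: "P \<in> R.indexed_pset I (carrier R)" and hom: "\<And>m. P m \<noteq> \<zero> \<Longrightarrow> size m = d"
    and v: "v \<in> I \<rightarrow> carrier S" and c: "c \<in> carrier S"
  shows "mpoly_eval R S h P (\<lambda>i. c \<otimes>\<^bsub>S\<^esub> v i) = c [^]\<^bsub>S\<^esub> d \<otimes>\<^bsub>S\<^esub> mpoly_eval R S h P v"
proof -
  let ?F = "{m. P m \<noteq> \<zero>}"
  note coeff = indexed_pset_coeff[OF P]
  have fin: "finite ?F" using P R.indexed_pset_finite_support by blast
  have vars: "set_mset m \<subseteq> I" if "m \<in> ?F" for m
    using that R.indexed_pset_support_vars[OF P] by blast
  have mon: "monom_eval S v m \<in> carrier S" if "m \<in> ?F" for m
    using v vars[OF that] by auto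
  have cv: "(\<lambda>i. c \<otimes>\<^bsub>S\<^esub> v i) \<in> I \<rightarrow> carrier S" using c v by auto
  have "mpoly_eval R S h P (\<lambda>i. c \<otimes>\<^bsub>S\<^esub> v i)
      = (\<Oplus>\<^bsub>S\<^esub> m \<in> ?F. c [^]\<^bsub>S\<^esub> d \<otimes>\<^bsub>S\<^esub> (h (P m) \<otimes>\<^bsub>S\<^esub> monom_eval S v m))"
    using coeff mon c S.monom_eval_scale[OF vars v c] hom
    by (subst mpoly_eval_support[OF P cv]) (auto intro!: S.finsum_cong' simp: S.m_ac)
  also have "\<dots> = c [^]\<^bsub>S\<^esub> d \<otimes>\<^bsub>S\<^esub> mpoly_eval R S h P v"
    using coeff mon c fin by (subst mpoly_eval_support[OF P v], subst S.finsum_rdistr) auto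
  finally show ?thesis .
qed

end

section \<open>Polynomial functions and the set \<open>M\<close>\<close>

text \<open>Evaluation over the base ring is evaluation along the identity, just as
  \<open>alg_eval\<close> is evaluation along c \<mapsto> c 1; both inherit the lemmas of
  \<open>ring_hom_cring\<close>.\<close>

lemma (in cring) identity_hom: "ring_hom_cring R R (\<lambda>c. c)"
  by (intro ring_hom_cring.intro ring_hom_cring_axioms.intro is_cring ring_hom_memI) auto

context cring
begin

lemmas base_eval_closed = ring_hom_cring.mpoly_eval_closed[OF identity_hom, folded base_eval_def]
lemmas base_eval_const = ring_hom_cring.mpoly_eval_const[OF identity_hom, folded base_eval_def]
lemmas base_eval_padd = ring_hom_cring.mpoly_eval_padd[OF identity_hom, folded base_eval_def]
lemmas base_eval_pmult = ring_hom_cring.mpoly_eval_pmult[OF identity_hom, folded base_eval_def]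
lemmas base_eval_cong = ring_hom_cring.mpoly_eval_cong[OF identity_hom, folded base_eval_def]

end

lemma (in algebra) scalar_hom: "ring_hom_cring R M (\<lambda>c. c \<odot>\<^bsub>M\<^esub> \<one>\<^bsub>M\<^esub>)"
proof (intro ring_hom_cring.intro ring_hom_cring_axioms.intro R_cring M_cring ring_hom_memI)
  interpret M: cring M by (rule M_cring)
  fix x y assume xy: "x \<in> carrier R" "y \<in> carrier R"
  show "(x \<otimes> y) \<odot>\<^bsub>M\<^esub> \<one>\<^bsub>M\<^esub> = x \<odot>\<^bsub>M\<^esub> \<one>\<^bsub>M\<^esub> \<otimes>\<^bsub>M\<^esub> (y \<odot>\<^bsub>M\<^esub> \<one>\<^bsub>M\<^esub>)"
    using xy by (simp add: smult_assoc1 smult_assoc2)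
qed (auto simp: smult_l_distr)

context algebra
begin

lemmas alg_eval_closed = ring_hom_cring.mpoly_eval_closed[OF scalar_hom, folded alg_eval_def]
lemmas alg_eval_const = ring_hom_cring.mpoly_eval_const[OF scalar_hom, folded alg_eval_def]
lemmas alg_eval_padd = ring_hom_cring.mpoly_eval_padd[OF scalar_hom, folded alg_eval_def]
lemmas alg_eval_pmult = ring_hom_cring.mpoly_eval_pmult[OF scalar_hom, folded alg_eval_def]
lemmas alg_eval_cong = ring_hom_cring.mpoly_eval_cong[OF scalar_hom, folded alg_eval_def]
lemmas alg_eval_scale_homogeneous =
  ring_hom_cring.mpoly_eval_scale_homogeneous[OF scalar_hom, folded alg_eval_def]

end

text \<open>Serves two maps: the canonical map into a localisation, for clearing denominators, and
  the evaluation of a section at a point, for reducing questions about sections to stalks.\<close>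

lemma alg_eval_hom:
  assumes "algebra K A" "algebra K B" and h: "h \<in> alg_hom K A B"
    and P: "P \<in> ring.indexed_pset K I (carrier K)" and v: "v \<in> I \<rightarrow> carrier A"
  shows "h (alg_eval K A P v) = alg_eval K B P (\<lambda>i. h (v i))"
proof -
  interpret A: algebra K A by fact
  interpret B: algebra K B by fact
  have h_ring: "h \<in> ring_hom A B"
    and h_smult: "\<And>c a. c \<in> carrier K \<Longrightarrow> a \<in> carrier A \<Longrightarrow> h (c \<odot>\<^bsub>A\<^esub> a) = c \<odot>\<^bsub>B\<^esub> h a"
    using h by (auto simp: alg_hom_def)
  have hv: "(\<lambda>i. h (v i)) \<in> I \<rightarrow> carrier B"
    using v h_ring by (auto simp: Pi_def ring_hom_closed)
  show ?thesis
    using P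
  proof induction
    case (indexed_const c)
    then show ?case
      using h_smult[OF indexed_const, of "\<one>\<^bsub>A\<^esub>"] ring_hom_one[OF h_ring]
      by (simp add: A.alg_eval_const B.alg_eval_const)
  next
    case (indexed_padd P Q)
    then show ?case
      using ring_hom_add[OF h_ring A.alg_eval_closed A.alg_eval_closed, of P I v Q I v] v hv
      by (simp add: A.alg_eval_padd[of _ I] B.alg_eval_padd[of _ I])
  next
    case (indexed_pmult P i)
    then show ?case
      using ring_hom_mult[OF h_ring A.alg_eval_closed, of P I v "v i"] v hv funcset_mem[OF v]
      by (simp add: A.alg_eval_pmult[of _ I] B.alg_eval_pmult[of _ I])
  qed
qed

locale field_algebra = K: field K + algebra K A
  for K :: "('k, 'l) ring_scheme" and A :: "('k, 'a, 'm) module_scheme" (structure)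
begin

abbreviation polys :: "nat set \<Rightarrow> (nat multiset \<Rightarrow> 'k) set" where
  "polys I \<equiv> K.indexed_pset I (carrier K)"

text \<open>A polynomial is only used through its values on \<open>K\<close> and on \<open>A\<close>, so composites of
  polynomials are handled as pairs of functions, without ever multiplying polynomials.\<close>

definition poly_fun :: "nat set \<Rightarrow> ((nat \<Rightarrow> 'k) \<Rightarrow> 'k) \<Rightarrow> ((nat \<Rightarrow> 'a) \<Rightarrow> 'a) \<Rightarrow> bool" where
  "poly_fun I f g \<longleftrightarrow> (\<exists>P \<in> polys I.
     (\<forall>v \<in> I \<rightarrow> carrier K. base_eval K P v = f v) \<and>
     (\<forall>v \<in> I \<rightarrow> carrier A. alg_eval K A P v = g v))"

lemma poly_fun_eval: "P \<in> polys I \<Longrightarrow> poly_fun I (base_eval K P) (alg_eval K A P)"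
  unfolding poly_fun_def by blast

lemma poly_fun_closed:
  assumes "poly_fun I f g"
  shows "v \<in> I \<rightarrow> carrier K \<Longrightarrow> f v \<in> carrier K" "w \<in> I \<rightarrow> carrier A \<Longrightarrow> g w \<in> carrier A"
proof -
  from assms obtain P where "P \<in> polys I"
    "\<And>v. v \<in> I \<rightarrow> carrier K \<Longrightarrow> base_eval K P v = f v"
    "\<And>v. v \<in> I \<rightarrow> carrier A \<Longrightarrow> alg_eval K A P v = g v"
    unfolding poly_fun_def by blast
  then show "v \<in> I \<rightarrow> carrier K \<Longrightarrow> f v \<in> carrier K" "w \<in> I \<rightarrow> carrier A \<Longrightarrow> g w \<in> carrier A"
    using K.base_eval_closed[of P I v] alg_eval_closed[of P I w] by simp_all
qed

lemma poly_fun_add: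
  assumes "poly_fun I f g" "poly_fun I f' g'"
  shows "poly_fun I (\<lambda>v. f v \<oplus>\<^bsub>K\<^esub> f' v) (\<lambda>v. g v \<oplus> g' v)"
proof -
  from assms obtain P Q where PQ: "P \<in> polys I" "Q \<in> polys I"
    "\<And>v. v \<in> I \<rightarrow> carrier K \<Longrightarrow> base_eval K P v = f v"
    "\<And>v. v \<in> I \<rightarrow> carrier A \<Longrightarrow> alg_eval K A P v = g v"
    "\<And>v. v \<in> I \<rightarrow> carrier K \<Longrightarrow> base_eval K Q v = f' v"
    "\<And>v. v \<in> I \<rightarrow> carrier A \<Longrightarrow> alg_eval K A Q v = g' v"
    unfolding poly_fun_def by blast
  show ?thesis
    unfolding poly_fun_def using PQ
    by (intro bexI[of _ "K.indexed_padd P Q"])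
      (auto simp: K.base_eval_padd[of _ I] alg_eval_padd[of _ I] intro: K.indexed_padd)
qed

lemma poly_fun_mult_var:
  assumes "poly_fun I f g" "i \<in> I"
  shows "poly_fun I (\<lambda>v. f v \<otimes>\<^bsub>K\<^esub> v i) (\<lambda>v. g v \<otimes> v i)"
proof -
  from assms obtain P where P: "P \<in> polys I"
    "\<And>v. v \<in> I \<rightarrow> carrier K \<Longrightarrow> base_eval K P v = f v"
    "\<And>v. v \<in> I \<rightarrow> carrier A \<Longrightarrow> alg_eval K A P v = g v"
    unfolding poly_fun_def by blast
  show ?thesis
    unfolding poly_fun_def using P assms(2)
    by (intro bexI[of _ "K.indexed_pmult P i"])
      (auto simp: K.base_eval_pmult[of _ I] alg_eval_pmult[of _ I] intro: K.indexed_pmult)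
qed

lemma poly_fun_const:
  "c \<in> carrier K \<Longrightarrow> poly_fun I (\<lambda>v. c) (\<lambda>v. c \<odot> \<one>)"
  unfolding poly_fun_def
  by (intro bexI[of _ "K.indexed_const c"])
    (auto simp: K.base_eval_const alg_eval_const intro: K.indexed_const)

lemma poly_fun_cong:
  assumes "poly_fun I f g"
    and "\<And>v. v \<in> I \<rightarrow> carrier K \<Longrightarrow> f v = f' v" "\<And>v. v \<in> I \<rightarrow> carrier A \<Longrightarrow> g v = g' v"
  shows "poly_fun I f' g'"
proof -
  from assms(1) obtain P where "P \<in> polys I"
    "\<And>v. v \<in> I \<rightarrow> carrier K \<Longrightarrow> base_eval K P v = f v"
    "\<And>v. v \<in> I \<rightarrow> carrier A \<Longrightarrow> alg_eval K A P v = g v"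
    unfolding poly_fun_def by blast
  with assms(2,3) show ?thesis
    unfolding poly_fun_def by (intro bexI[of _ P]) auto
qed

text \<open>Induction on an underlying polynomial, carried over to the pair of functions. The case
  \<open>cong\<close> is there because the polynomial fixes the pair only on valuations with values
  in the carriers.\<close>

lemma poly_fun_induct [consumes 1, case_names const add mult_var cong]:
  assumes "poly_fun I f g"
    and const: "\<And>c. c \<in> carrier K \<Longrightarrow> Q (\<lambda>v. c) (\<lambda>v. c \<odot> \<one>)"
    and add: "\<And>f g f' g'. poly_fun I f g \<Longrightarrow> Q f g \<Longrightarrow> poly_fun I f' g' \<Longrightarrow> Q f' g' \<Longrightarrow>
      Q (\<lambda>v. f v \<oplus>\<^bsub>K\<^esub> f' v) (\<lambda>v. g v \<oplus> g' v)"
    and mult_var: "\<And>f g i. poly_fun I f g \<Longrightarrow> Q f g \<Longrightarrow> i \<in> I \<Longrightarrow>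
      Q (\<lambda>v. f v \<otimes>\<^bsub>K\<^esub> v i) (\<lambda>v. g v \<otimes> v i)"
    and cong: "\<And>f g f' g'. Q f g \<Longrightarrow> (\<And>v. v \<in> I \<rightarrow> carrier K \<Longrightarrow> f v = f' v) \<Longrightarrow>
      (\<And>v. v \<in> I \<rightarrow> carrier A \<Longrightarrow> g v = g' v) \<Longrightarrow> Q f' g'"
  shows "Q f g"
proof -
  have *: "Q (base_eval K P) (alg_eval K A P)" if "P \<in> polys I" for P
    using that
  proof induction
    case (indexed_const c)
    then show ?case
      by (intro cong[OF const]) (auto simp: K.base_eval_const alg_eval_const)
  next
    case (indexed_padd P P')
    show ?case
      by (rule cong[OF add[OF poly_fun_eval indexed_padd.IH(1) poly_fun_eval indexed_padd.IH(2)]])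
        (use indexed_padd.hyps in \<open>auto simp: K.base_eval_padd[of _ I] alg_eval_padd[of _ I]\<close>)
  next
    case (indexed_pmult P i)
    show ?case
      by (rule cong[OF mult_var[OF poly_fun_eval indexed_pmult.IH indexed_pmult.hyps(2)]])
        (use indexed_pmult.hyps in \<open>auto simp: K.base_eval_pmult[of _ I] alg_eval_pmult[of _ I]\<close>)
  qed
  from assms(1) obtain P where P: "P \<in> polys I"
    "\<And>v. v \<in> I \<rightarrow> carrier K \<Longrightarrow> base_eval K P v = f v"
    "\<And>v. v \<in> I \<rightarrow> carrier A \<Longrightarrow> alg_eval K A P v = g v"
    unfolding poly_fun_def by blast
  show ?thesis by (rule cong[OF *[OF P(1)] P(2,3)])
qed

lemma poly_fun_var:
  assumes "i \<in> I"
  shows "poly_fun I (\<lambda>v. v i) (\<lambda>v. v i)"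
  by (rule poly_fun_cong[OF poly_fun_mult_var[OF poly_fun_const[OF K.one_closed] assms]])
    (use assms in \<open>auto simp: Pi_def\<close>)

text \<open>The base case of \<open>poly_fun_mult\<close>: the constant is fixed and the induction
  runs over the other factor.\<close>

lemma poly_fun_smult:
  assumes "poly_fun I f g" and c: "c \<in> carrier K"
  shows "poly_fun I (\<lambda>v. c \<otimes>\<^bsub>K\<^esub> f v) (\<lambda>v. (c \<odot> \<one>) \<otimes> g v)"
  using assms(1)
proof (induction rule: poly_fun_induct)
  case (const d)
  then show ?case
    by (intro poly_fun_cong[OF poly_fun_const[of "c \<otimes>\<^bsub>K\<^esub> d"]])
      (auto simp: c smult_assoc1 smult_assoc2)
next
  case (add f g f' g')
  show ?case
    by (rule poly_fun_cong[OF poly_fun_add[OF add.IH]])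
      (use c add.hyps in \<open>auto simp: poly_fun_closed K.r_distr r_distr\<close>)
next
  case (mult_var f g i)
  show ?case
    by (rule poly_fun_cong[OF poly_fun_mult_var[OF mult_var.IH mult_var.hyps(2)]])
      (use c mult_var.hyps in \<open>auto simp: poly_fun_closed K.m_assoc m_assoc Pi_def\<close>)
next
  case (cong f g f' g')
  show ?case
    by (rule poly_fun_cong[OF cong.IH]) (use cong.hyps in auto)
qed

text \<open>The generators of \<open>polys I\<close> multiply by one variable at a time, so a
  product is built by induction on the first factor while the second stays fixed.\<close>

lemma poly_fun_mult:
  assumes "poly_fun I f g" and f': "poly_fun I f' g'"
  shows "poly_fun I (\<lambda>v. f v \<otimes>\<^bsub>K\<^esub> f' v) (\<lambda>v. g v \<otimes> g' v)"
  using assms(1)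
proof (induction rule: poly_fun_induct)
  case (const c)
  then show ?case using f' by (rule_tac poly_fun_smult)
next
  case (add f g h k)
  show ?case
    by (rule poly_fun_cong[OF poly_fun_add[OF add.IH]])
      (use f' add.hyps in \<open>auto simp: poly_fun_closed K.l_distr l_distr\<close>)
next
  case (mult_var f g i)
  show ?case
    by (rule poly_fun_cong[OF poly_fun_mult_var[OF mult_var.IH mult_var.hyps(2)]])
      (use f' mult_var.hyps in \<open>auto simp: poly_fun_closed K.m_ac m_ac Pi_def\<close>)
next
  case (cong f g h k)
  show ?case
    by (rule poly_fun_cong[OF cong.IH]) (use cong.hyps in auto)
qed

lemma poly_fun_subst:
  assumes "poly_fun I f g" and FG: "\<And>i. i \<in> I \<Longrightarrow> poly_fun J (F i) (G i)"
  shows "poly_fun J (\<lambda>v. f (\<lambda>i. F i v)) (\<lambda>v. g (\<lambda>i. G i v))"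
  using assms(1)
proof (induction rule: poly_fun_induct)
  case (const c)
  then show ?case by (rule poly_fun_const)
next
  case (add f g f' g')
  then show ?case by (rule_tac poly_fun_add)
next
  case (mult_var f g i)
  then show ?case by (intro poly_fun_mult FG)
next
  case (cong f g f' g')
  have "f (\<lambda>i. F i v) = f' (\<lambda>i. F i v)" if "v \<in> J \<rightarrow> carrier K" for v
    using poly_fun_closed(1)[OF FG that] by (intro cong.hyps(1) Pi_I)
  moreover have "g (\<lambda>i. G i v) = g' (\<lambda>i. G i v)" if "v \<in> J \<rightarrow> carrier A" for v
    using poly_fun_closed(2)[OF FG that] by (intro cong.hyps(2) Pi_I)
  ultimately show ?case
    using cong.IH by (rule_tac poly_fun_cong)
qed

lemma poly_fun_arg_cong:
  assumes "poly_fun I f g" "v \<in> I \<rightarrow> carrier A" "\<And>i. i \<in> I \<Longrightarrow> v i = w i"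
  shows "g v = g w"
proof -
  have "w \<in> I \<rightarrow> carrier A" using assms(2,3) by (metis Pi_cong)
  moreover from assms(1) obtain P where "P \<in> polys I"
    "\<And>v. v \<in> I \<rightarrow> carrier A \<Longrightarrow> alg_eval K A P v = g v"
    unfolding poly_fun_def by blast
  ultimately show ?thesis
    using alg_eval_cong[of P I v w] assms(2,3) by simp
qed

section \<open>Closure properties of the set \<open>M\<close>\<close>

lemma M_setI:
  assumes "poly_fun {1..n} f g" "\<And>v. v \<in> {1..n} \<rightarrow> carrier K \<Longrightarrow> f v \<noteq> \<zero>\<^bsub>K\<^esub>"
    "v \<in> {1..n} \<rightarrow> carrier A"
  shows "g v \<in> M_set K A"
proof -
  from assms obtain P where P: "P \<in> polys {1..n}"
    "\<And>v. v \<in> {1..n} \<rightarrow> carrier K \<Longrightarrow> base_eval K P v = f v"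
    "\<And>v. v \<in> {1..n} \<rightarrow> carrier A \<Longrightarrow> alg_eval K A P v = g v"
    unfolding poly_fun_def by blast
  then have "P \<in> algebraic_signature K n"
    using assms(2) by (simp add: algebraic_signature_def)
  then have "alg_eval K A P v \<in> M_set K A"
    using assms(3) unfolding M_set_def by blast
  then show ?thesis by (simp only: P(3)[OF assms(3)])
qed

lemma M_setE:
  assumes "x \<in> M_set K A"
  obtains n f g v where "poly_fun {1..n} f g"
    "\<And>v. v \<in> {1..n} \<rightarrow> carrier K \<Longrightarrow> f v \<noteq> \<zero>\<^bsub>K\<^esub>"
    "v \<in> {1..n} \<rightarrow> carrier A" "x = g v"
proof -
  from assms obtain n D v where "x = alg_eval K A D v" "D \<in> algebraic_signature K n"
    "v \<in> {1..n} \<rightarrow> carrier A"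
    unfolding M_set_def by blast
  then show ?thesis
    using that[of n "base_eval K D" "alg_eval K A D" v]
    by (auto simp: algebraic_signature_def poly_fun_eval)
qed

lemma M_set_closed:
  assumes "x \<in> M_set K A"
  shows "x \<in> carrier A"
proof -
  from assms obtain n f g v where "poly_fun {1..n} f g" "v \<in> {1..n} \<rightarrow> carrier A" "x = g v"
    by (rule M_setE) (rule that)
  then show ?thesis by (simp add: poly_fun_closed(2)[of "{1..n}" f])
qed

lemma one_in_M_set: "\<one> \<in> M_set K A"
proof -
  \<comment> \<open>With \<open>n = 0\<close> there are no variables, so every valuation is
    admissible, even \<open>undefined\<close>.\<close>
  have "(\<lambda>v. \<one>\<^bsub>K\<^esub> \<odot> \<one>) undefined \<in> M_set K A"
    by (rule M_setI[OF poly_fun_const, of "\<one>\<^bsub>K\<^esub>" 0]) auto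
  then show ?thesis by simp
qed

text \<open>If \<open>v 0\<close> is the value of a polynomial D without zeros in K, substituting
  D(Z) for variable \<open>0\<close> leaves a polynomial without zeros: at every point of K the new
  argument is non-zero, and then so is \<open>f\<close>. The condition on \<open>f\<close> is that
  of the homogeneous signature, stated without homogeneity so that it also serves for
  products.\<close>

lemma M_set_subst:
  assumes f: "poly_fun {0..n} f g" and f0: "\<And>v. v \<in> {0..n} \<rightarrow> carrier K \<Longrightarrow> v 0 \<noteq> \<zero>\<^bsub>K\<^esub> \<Longrightarrow> f v \<noteq> \<zero>\<^bsub>K\<^esub>"
    and v: "v \<in> {0..n} \<rightarrow> carrier A" and v0: "v 0 \<in> M_set K A"
  shows "g v \<in> M_set K A"
proof -
  from v0 obtain m h k w where h: "poly_fun {1..m} h k"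
    and h0: "\<And>v. v \<in> {1..m} \<rightarrow> carrier K \<Longrightarrow> h v \<noteq> \<zero>\<^bsub>K\<^esub>"
    and w: "w \<in> {1..m} \<rightarrow> carrier A" and v0_eq: "v 0 = k w"
    by (rule M_setE) (rule that)
  \<comment> \<open>Variables \<open>1..n\<close> keep their meaning, and
    \<open>n + 1..n + m\<close> are fresh ones for the arguments of the polynomial behind
    \<open>v 0\<close>. \<open>F\<close> and \<open>G\<close> are this substitution over K and over
    A, and \<open>u\<close> joins the two argument tuples.\<close>
  let ?J = "{1..n + m}"
  define F where "F i = (if i = 0 then (\<lambda>u. h (\<lambda>j. u (n + j))) else (\<lambda>u. u i))" for i
  define G where "G i = (if i = 0 then (\<lambda>u. k (\<lambda>j. u (n + j))) else (\<lambda>u. u i))" for i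
  have "poly_fun ?J (\<lambda>u. h (\<lambda>j. u (n + j))) (\<lambda>u. k (\<lambda>j. u (n + j)))"
    by (rule poly_fun_subst[OF h poly_fun_var]) auto
  then have FG: "poly_fun ?J (F i) (G i)" if "i \<in> {0..n}" for i
    using that by (auto simp: F_def G_def intro: poly_fun_var)
  define u where "u i = (if i \<le> n then v i else w (i - n))" for i
  have "g (\<lambda>i. G i u) \<in> M_set K A"
  proof (rule M_setI[OF poly_fun_subst[OF f FG]])
    fix t assume t: "t \<in> ?J \<rightarrow> carrier K"
    then have "(\<lambda>i. F i t) \<in> {0..n} \<rightarrow> carrier K"
      using poly_fun_closed(1)[OF FG] by blast
    moreover have "F 0 t \<noteq> \<zero>\<^bsub>K\<^esub>"
      using t by (auto simp: F_def intro!: h0)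
    ultimately show "f (\<lambda>i. F i t) \<noteq> \<zero>\<^bsub>K\<^esub>" by (rule f0)
  next
    have "w (i - n) \<in> carrier A" if "n < i" "i \<le> n + m" for i
      using that by (intro funcset_mem[OF w]) auto
    then show "u \<in> ?J \<rightarrow> carrier A" using v by (auto simp: u_def Pi_def)
  qed
  moreover have "k (\<lambda>j. u (n + j)) = k w"
    by (rule poly_fun_arg_cong[OF h]) (use w in \<open>auto simp: u_def\<close>)
  moreover have "g (\<lambda>i. G i u) = g v"
    using calculation(2) v0_eq v
    by (intro poly_fun_arg_cong[OF f, symmetric]) (auto simp: G_def u_def)
  ultimately show ?thesis by simp
qed

text \<open>The factor \<open>x\<close> enters as the value of variable \<open>0\<close> in D(X) Y,
  where \<open>y\<close> is the value of D. K has no zero divisors, so this product can vanish only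
  where \<open>Y\<close> does, and \<open>M_set_subst\<close> keeps the variables of the two factors
  apart.\<close>

lemma M_set_mult:
  assumes "x \<in> M_set K A" "y \<in> M_set K A"
  shows "x \<otimes> y \<in> M_set K A"
proof -
  from assms(2) obtain n f g v where f: "poly_fun {1..n} f g"
    "\<And>v. v \<in> {1..n} \<rightarrow> carrier K \<Longrightarrow> f v \<noteq> \<zero>\<^bsub>K\<^esub>"
    "v \<in> {1..n} \<rightarrow> carrier A" "y = g v"
    by (rule M_setE) (rule that)
  have f': "poly_fun {0..n} f g"
    using poly_fun_subst[OF f(1) poly_fun_var, of "\<lambda>i. i" "{0..n}"] by auto
  have "(\<lambda>v. g v \<otimes> v 0) (v(0 := x)) \<in> M_set K A"
  proof (rule M_set_subst[OF poly_fun_mult_var[OF f']])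
    show "f t \<otimes>\<^bsub>K\<^esub> t 0 \<noteq> \<zero>\<^bsub>K\<^esub>" if "t \<in> {0..n} \<rightarrow> carrier K" "t 0 \<noteq> \<zero>\<^bsub>K\<^esub>" for t
      using that f(2)[of t] poly_fun_closed(1)[OF f', of t] K.integral[of "f t" "t 0"]
      by (auto simp: Pi_def)
  qed (use assms f(3) M_set_closed[OF assms(1)] in \<open>auto simp: Pi_def\<close>)
  moreover have "g (v(0 := x)) = g v"
    using f(3) by (intro poly_fun_arg_cong[OF f(1), symmetric]) auto
  ultimately show ?thesis
    using f(4) M_set_closed[OF assms(1)] M_set_closed[OF assms(2)] by (simp add: m_comm)
qed

end

section \<open>Special ideals and special primes\<close>

lemma (in ring) indexed_const_support:
  "indexed_const c m \<noteq> \<zero> \<Longrightarrow> size m = 0"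
  by (simp add: indexed_const_def split: if_splits)

context field_algebra
begin

lemma size_indexed_pmult:
  assumes "\<And>m. Q m \<noteq> \<zero>\<^bsub>K\<^esub> \<Longrightarrow> size m = d" "K.indexed_pmult Q i m \<noteq> \<zero>\<^bsub>K\<^esub>"
  shows "size m = Suc d"
proof -
  have "i \<in># m" "size (m - {#i#}) = d"
    using assms by (auto simp: K.indexed_pmult_def split: if_splits)
  then show ?thesis by (metis insert_DiffM size_add_mset)
qed

lemma homogenise_const:
  assumes "c \<in> carrier K"
  shows "\<exists>Q \<in> polys (insert 0 I). (\<forall>m. Q m \<noteq> \<zero>\<^bsub>K\<^esub> \<longrightarrow> size m = d) \<and>
    (\<forall>v \<in> insert 0 I \<rightarrow> carrier K. base_eval K Q v = v 0 [^]\<^bsub>K\<^esub> d \<otimes>\<^bsub>K\<^esub> c) \<and>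
    (\<forall>v \<in> insert 0 I \<rightarrow> carrier A. alg_eval K A Q v = v 0 [^] d \<otimes> (c \<odot> \<one>))"
proof (induction d)
  case 0
  show ?case
    using assms
    by (intro bexI[of _ "K.indexed_const c"])
      (auto simp: K.base_eval_const alg_eval_const intro: K.indexed_const
        dest: K.indexed_const_support)
next
  case (Suc d)
  then obtain Q where Q: "Q \<in> polys (insert 0 I)" "\<And>m. Q m \<noteq> \<zero>\<^bsub>K\<^esub> \<Longrightarrow> size m = d"
    "\<And>v. v \<in> insert 0 I \<rightarrow> carrier K \<Longrightarrow> base_eval K Q v = v 0 [^]\<^bsub>K\<^esub> d \<otimes>\<^bsub>K\<^esub> c"
    "\<And>v. v \<in> insert 0 I \<rightarrow> carrier A \<Longrightarrow> alg_eval K A Q v = v 0 [^] d \<otimes> (c \<odot> \<one>)"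
    by blast
  show ?case
  proof (intro bexI[of _ "K.indexed_pmult Q 0"] conjI allI ballI impI)
    show "size m = Suc d" if "K.indexed_pmult Q 0 m \<noteq> \<zero>\<^bsub>K\<^esub>" for m
      using size_indexed_pmult[OF Q(2) that] .
    show "base_eval K (K.indexed_pmult Q 0) v = v 0 [^]\<^bsub>K\<^esub> Suc d \<otimes>\<^bsub>K\<^esub> c"
      if v: "v \<in> insert 0 I \<rightarrow> carrier K" for v
    proof -
      have "v 0 \<in> carrier K" using v by auto
      then show ?thesis
        using assms Q(3)[OF v] K.base_eval_pmult[OF Q(1) _ v] by (simp add: K.m_ac)
    qed
    show "alg_eval K A (K.indexed_pmult Q 0) v = v 0 [^] Suc d \<otimes> (c \<odot> \<one>)"
      if v: "v \<in> insert 0 I \<rightarrow> carrier A" for v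
    proof -
      have "v 0 \<in> carrier A" using v by auto
      then show ?thesis
        using assms Q(4)[OF v] alg_eval_pmult[OF Q(1) _ v] by (simp add: m_ac)
    qed
  qed (use Q(1) in \<open>auto intro: K.indexed_pmult\<close>)
qed

text \<open>\<open>Q\<close> is \<open>Y\<^sup>d P(X/Y)\<close>, stated without division.\<close>

definition homogenises ::
    "nat set \<Rightarrow> nat \<Rightarrow> (nat multiset \<Rightarrow> 'k) \<Rightarrow> (nat multiset \<Rightarrow> 'k) \<Rightarrow> bool" where
  "homogenises I d P Q \<longleftrightarrow>
    Q \<in> polys (insert 0 I) \<and> (\<forall>m. Q m \<noteq> \<zero>\<^bsub>K\<^esub> \<longrightarrow> size m = d) \<and>
    (\<forall>v \<in> I \<rightarrow> carrier K. \<forall>b \<in> carrier K.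
      base_eval K Q ((\<lambda>i. b \<otimes>\<^bsub>K\<^esub> v i)(0 := b)) = b [^]\<^bsub>K\<^esub> d \<otimes>\<^bsub>K\<^esub> base_eval K P v) \<and>
    (\<forall>v \<in> I \<rightarrow> carrier A. alg_eval K A Q (v(0 := \<one>)) = alg_eval K A P v)"

lemma homogenisesI:
  assumes "Q \<in> polys (insert 0 I)" "\<And>m. Q m \<noteq> \<zero>\<^bsub>K\<^esub> \<Longrightarrow> size m = d"
    "\<And>v b. v \<in> I \<rightarrow> carrier K \<Longrightarrow> b \<in> carrier K \<Longrightarrow>
      base_eval K Q ((\<lambda>i. b \<otimes>\<^bsub>K\<^esub> v i)(0 := b)) = b [^]\<^bsub>K\<^esub> d \<otimes>\<^bsub>K\<^esub> base_eval K P v"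
    "\<And>v. v \<in> I \<rightarrow> carrier A \<Longrightarrow> alg_eval K A Q (v(0 := \<one>)) = alg_eval K A P v"
  shows "homogenises I d P Q"
  unfolding homogenises_def by (intro conjI allI ballI impI assms)

lemma homogenisesD:
  assumes "homogenises I d P Q"
  shows "Q \<in> polys (insert 0 I)" "Q m \<noteq> \<zero>\<^bsub>K\<^esub> \<Longrightarrow> size m = d"
    "v \<in> I \<rightarrow> carrier K \<Longrightarrow> b \<in> carrier K \<Longrightarrow>
      base_eval K Q ((\<lambda>i. b \<otimes>\<^bsub>K\<^esub> v i)(0 := b)) = b [^]\<^bsub>K\<^esub> d \<otimes>\<^bsub>K\<^esub> base_eval K P v"
    "w \<in> I \<rightarrow> carrier A \<Longrightarrow> alg_eval K A Q (w(0 := \<one>)) = alg_eval K A P w"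
  using assms unfolding homogenises_def by simp_all

text \<open>The degree is free above a bound because two summands must be homogenised to the same
  degree. The assumption on \<open>0\<close> makes \<open>Y\<close> a new variable.\<close>

lemma homogenise:
  assumes "P \<in> polys I" "0 \<notin> I"
  shows "\<exists>d0. \<forall>d \<ge> d0. \<exists>Q. homogenises I d P Q"
  using assms(1)
proof induction
  case (indexed_const c)
  have "\<exists>Q. homogenises I d (K.indexed_const c) Q" for d
  proof -
    obtain Q where Q: "Q \<in> polys (insert 0 I)" "\<And>m. Q m \<noteq> \<zero>\<^bsub>K\<^esub> \<Longrightarrow> size m = d"
      "\<And>v. v \<in> insert 0 I \<rightarrow> carrier K \<Longrightarrow> base_eval K Q v = v 0 [^]\<^bsub>K\<^esub> d \<otimes>\<^bsub>K\<^esub> c"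
      "\<And>v. v \<in> insert 0 I \<rightarrow> carrier A \<Longrightarrow> alg_eval K A Q v = v 0 [^] d \<otimes> (c \<odot> \<one>)"
      using homogenise_const[OF indexed_const, of I d] by (elim bexE conjE) (rule that, auto)
    show ?thesis
    proof (intro exI[of _ Q] homogenisesI Q(1) Q(2))
      show "base_eval K Q ((\<lambda>i. b \<otimes>\<^bsub>K\<^esub> v i)(0 := b))
          = b [^]\<^bsub>K\<^esub> d \<otimes>\<^bsub>K\<^esub> base_eval K (K.indexed_const c) v"
        if v: "v \<in> I \<rightarrow> carrier K" and b: "b \<in> carrier K" for v b
      proof -
        have "(\<lambda>i. b \<otimes>\<^bsub>K\<^esub> v i)(0 := b) \<in> insert 0 I \<rightarrow> carrier K" using v b by (auto simp: Pi_iff)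
        from Q(3)[OF this] show ?thesis by (simp add: K.base_eval_const[OF indexed_const])
      qed
      show "alg_eval K A Q (v(0 := \<one>)) = alg_eval K A (K.indexed_const c) v"
        if v: "v \<in> I \<rightarrow> carrier A" for v
      proof -
        have "v(0 := \<one>) \<in> insert 0 I \<rightarrow> carrier A" using v by (auto simp: Pi_iff)
        from Q(4)[OF this] show ?thesis by (simp add: alg_eval_const[OF indexed_const] indexed_const)
      qed
    qed
  qed
  then show ?case by blast
next
  case (indexed_padd P P')
  then obtain d0 d0' where d0: "\<And>d. d \<ge> d0 \<Longrightarrow> \<exists>Q. homogenises I d P Q"
    "\<And>d. d \<ge> d0' \<Longrightarrow> \<exists>Q. homogenises I d P' Q"
    by blast
  have "\<exists>Q. homogenises I d (K.indexed_padd P P') Q" if d: "d \<ge> max d0 d0'" for d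
  proof -
    obtain Q Q' where QQ: "homogenises I d P Q" "homogenises I d P' Q'"
      using d0(1)[of d] d0(2)[of d] d by auto
    note Q = homogenisesD[OF QQ(1)] and Q' = homogenisesD[OF QQ(2)]
    show ?thesis
    proof (intro exI[of _ "K.indexed_padd Q Q'"] homogenisesI)
      show "size m = d" if "K.indexed_padd Q Q' m \<noteq> \<zero>\<^bsub>K\<^esub>" for m
        using that Q(2)[of m] Q'(2)[of m]
        by (cases "Q m = \<zero>\<^bsub>K\<^esub>"; cases "Q' m = \<zero>\<^bsub>K\<^esub>") (auto simp: K.indexed_padd_def)
      show "base_eval K (K.indexed_padd Q Q') ((\<lambda>i. b \<otimes>\<^bsub>K\<^esub> v i)(0 := b))
          = b [^]\<^bsub>K\<^esub> d \<otimes>\<^bsub>K\<^esub> base_eval K (K.indexed_padd P P') v"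
        if v: "v \<in> I \<rightarrow> carrier K" and b: "b \<in> carrier K" for v b
      proof -
        have "(\<lambda>i. b \<otimes>\<^bsub>K\<^esub> v i)(0 := b) \<in> insert 0 I \<rightarrow> carrier K" using v b by (auto simp: Pi_iff)
        then show ?thesis
          using v b K.base_eval_closed[OF indexed_padd.hyps(1) v]
            K.base_eval_closed[OF indexed_padd.hyps(2) v] Q(3)[OF v b] Q'(3)[OF v b]
          by (simp add: K.base_eval_padd[OF indexed_padd.hyps v] K.base_eval_padd[OF Q(1) Q'(1)]
              K.r_distr)
      qed
      show "alg_eval K A (K.indexed_padd Q Q') (v(0 := \<one>)) = alg_eval K A (K.indexed_padd P P') v"
        if v: "v \<in> I \<rightarrow> carrier A" for v
      proof -
        have "v(0 := \<one>) \<in> insert 0 I \<rightarrow> carrier A" using v by (auto simp: Pi_iff)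
        then show ?thesis
          by (simp add: alg_eval_padd[OF indexed_padd.hyps v] alg_eval_padd[OF Q(1) Q'(1)]
              Q(4)[OF v] Q'(4)[OF v])
      qed
    qed (use Q(1) Q'(1) in \<open>auto intro: K.indexed_padd\<close>)
  qed
  then show ?case by blast
next
  case (indexed_pmult P j)
  then obtain d0 where d0: "\<And>d. d \<ge> d0 \<Longrightarrow> \<exists>Q. homogenises I d P Q"
    by blast
  \<comment> \<open>The valuation at \<open>j\<close> is therefore the scaled value
    \<open>b v_j\<close> and not the overridden one. It supplies the factor by which
    \<open>b^d\<close> exceeds \<open>b^d'\<close>.\<close>
  have j: "j \<noteq> 0" using indexed_pmult.hyps(2) assms(2) by metis
  have "\<exists>Q. homogenises I d (K.indexed_pmult P j) Q" if d: "d \<ge> Suc d0" for d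
  proof -
    from d obtain d' where d': "d = Suc d'" "d' \<ge> d0" using Suc_le_D by auto
    obtain Q where "homogenises I d' P Q"
      using d0[OF d'(2)] by blast
    note Q = homogenisesD[OF this]
    have j': "j \<in> insert 0 I" using indexed_pmult.hyps by simp
    show ?thesis
    proof (intro exI[of _ "K.indexed_pmult Q j"] homogenisesI)
      show "size m = d" if "K.indexed_pmult Q j m \<noteq> \<zero>\<^bsub>K\<^esub>" for m
        using size_indexed_pmult[OF Q(2) that] d'(1) by simp
      show "base_eval K (K.indexed_pmult Q j) ((\<lambda>i. b \<otimes>\<^bsub>K\<^esub> v i)(0 := b))
          = b [^]\<^bsub>K\<^esub> d \<otimes>\<^bsub>K\<^esub> base_eval K (K.indexed_pmult P j) v"
        if v: "v \<in> I \<rightarrow> carrier K" and b: "b \<in> carrier K" for v b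
      proof -
        have "(\<lambda>i. b \<otimes>\<^bsub>K\<^esub> v i)(0 := b) \<in> insert 0 I \<rightarrow> carrier K" using v b by (auto simp: Pi_iff)
        moreover have "v j \<in> carrier K" using v indexed_pmult.hyps by auto
        ultimately show ?thesis
          using b K.base_eval_closed[OF indexed_pmult.hyps(1) v] j d'(1) Q(3)[OF v b]
          by (simp add: K.base_eval_pmult[OF indexed_pmult.hyps v] K.base_eval_pmult[OF Q(1) j']
              K.m_ac)
      qed
      show "alg_eval K A (K.indexed_pmult Q j) (v(0 := \<one>)) = alg_eval K A (K.indexed_pmult P j) v"
        if v: "v \<in> I \<rightarrow> carrier A" for v
      proof -
        have "v(0 := \<one>) \<in> insert 0 I \<rightarrow> carrier A" using v by (auto simp: Pi_iff)
        then show ?thesis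
          using j by (simp add: alg_eval_pmult[OF indexed_pmult.hyps v] alg_eval_pmult[OF Q(1) j']
              Q(4)[OF v])
      qed
    qed (use Q(1) j' in \<open>auto intro: K.indexed_pmult\<close>)
  qed
  then show ?case by blast
qed

text \<open>The bridge from specialness to \<open>M\<close>: a statement about values of D turns
  into one about values of \<open>P\<close> with \<open>Y = 1\<close>, to which the defining
  property of special ideals applies.\<close>

lemma homogenise_signature:
  assumes "D \<in> algebraic_signature K n"
  obtains P where "P \<in> homogeneous_signature K n"
    "\<And>v. v \<in> {1..n} \<rightarrow> carrier A \<Longrightarrow> alg_eval K A P (v(0 := \<one>)) = alg_eval K A D v"
proof -
  have D: "D \<in> polys {1..n}" "\<And>v. v \<in> {1..n} \<rightarrow> carrier K \<Longrightarrow> base_eval K D v \<noteq> \<zero>\<^bsub>K\<^esub>"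
    using assms by (auto simp: algebraic_signature_def)
  have ins: "insert 0 {1..n} = {0..n}" by auto
  obtain d P where "homogenises {1..n} d D P"
    using homogenise[OF D(1)] by auto
  note P = homogenisesD[OF this, unfolded ins]
  have zero: "v 0 = \<zero>\<^bsub>K\<^esub>" if v: "v \<in> {0..n} \<rightarrow> carrier K" and Pv: "base_eval K P v = \<zero>\<^bsub>K\<^esub>" for v
  proof (rule ccontr)
    assume "v 0 \<noteq> \<zero>\<^bsub>K\<^esub>"
    moreover have v0: "v 0 \<in> carrier K" using v by auto
    ultimately have unit: "v 0 \<in> Units K" by (simp add: K.field_Units)
    \<comment> \<open>Division by the non-zero \<open>Y\<close> coordinate carries a zero of
      \<open>P\<close> to a zero \<open>w\<close> of \<open>D\<close>, which cannot exist.\<close>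
    define w where "w i = inv\<^bsub>K\<^esub> v 0 \<otimes>\<^bsub>K\<^esub> v i" for i
    have w: "w \<in> {1..n} \<rightarrow> carrier K"
      using v unit by (auto simp: w_def Pi_iff)
    have "v i = ((\<lambda>i. v 0 \<otimes>\<^bsub>K\<^esub> w i)(0 := v 0)) i" if "i \<in> {0..n}" for i
    proof -
      have "v i \<in> carrier K" using v that by auto
      then show ?thesis using unit v0 by (simp add: w_def K.m_assoc[symmetric])
    qed
    then have "base_eval K P v = base_eval K P ((\<lambda>i. v 0 \<otimes>\<^bsub>K\<^esub> w i)(0 := v 0))"
      by (rule K.base_eval_cong[OF P(1) v])
    then have "v 0 [^]\<^bsub>K\<^esub> d \<otimes>\<^bsub>K\<^esub> base_eval K D w = \<zero>\<^bsub>K\<^esub>"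
      using P(3)[OF w v0] Pv by simp
    moreover have "v 0 [^]\<^bsub>K\<^esub> d \<in> Units K"
      using unit by (rule K.Units_pow_closed)
    then have "v 0 [^]\<^bsub>K\<^esub> d \<noteq> \<zero>\<^bsub>K\<^esub>" by (simp add: K.field_Units)
    ultimately show False
      using K.integral[of "v 0 [^]\<^bsub>K\<^esub> d" "base_eval K D w"] D(2)[OF w] v0
        K.base_eval_closed[OF D(1) w] by auto
  qed
  have "\<exists>m. P m \<noteq> \<zero>\<^bsub>K\<^esub>"
  proof (rule ccontr)
    assume "\<not> ?thesis"
    then have "P = K.indexed_const \<zero>\<^bsub>K\<^esub>" by (auto simp: K.indexed_const_def)
    \<comment> \<open>The zero polynomial would vanish at the point with all coordinates 1, where
      \<open>Y\<close> is not zero.\<close>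
    then have "base_eval K P (\<lambda>_. \<one>\<^bsub>K\<^esub>) = \<zero>\<^bsub>K\<^esub>" by (simp add: K.base_eval_const)
    from zero[OF _ this] show False by simp
  qed
  then have "P \<in> homogeneous_signature K n"
    using P(1,2) zero unfolding homogeneous_signature_def by blast
  then show ?thesis using P(4) that by blast
qed

lemma homogeneous_signature_mult_var:
  assumes "P \<in> homogeneous_signature K n"
  shows "K.indexed_pmult P 0 \<in> homogeneous_signature K n"
proof -
  from assms obtain m d where P: "P \<in> polys {0..n}" "P m \<noteq> \<zero>\<^bsub>K\<^esub>"
    "\<And>m. P m \<noteq> \<zero>\<^bsub>K\<^esub> \<Longrightarrow> size m = d"
    "\<And>v. v \<in> {0..n} \<rightarrow> carrier K \<Longrightarrow> base_eval K P v = \<zero>\<^bsub>K\<^esub> \<Longrightarrow> v 0 = \<zero>\<^bsub>K\<^esub>"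
    unfolding homogeneous_signature_def by blast
  have "v 0 = \<zero>\<^bsub>K\<^esub>" if v: "v \<in> {0..n} \<rightarrow> carrier K"
    and eq: "base_eval K (K.indexed_pmult P 0) v = \<zero>\<^bsub>K\<^esub>" for v
  proof -
    have "base_eval K P v = \<zero>\<^bsub>K\<^esub> \<or> v 0 = \<zero>\<^bsub>K\<^esub>"
      using eq K.base_eval_pmult[OF P(1) _ v, of 0] K.base_eval_closed[OF P(1) v]
        funcset_mem[OF v, of 0] K.integral[of "base_eval K P v" "v 0"] by auto
    then show ?thesis using P(4)[OF v] by blast
  qed
  moreover have "K.indexed_pmult P 0 (add_mset 0 m) \<noteq> \<zero>\<^bsub>K\<^esub>"
    using P(2) by (simp add: K.indexed_pmult_def)
  moreover have "size m = Suc d" if "K.indexed_pmult P 0 m \<noteq> \<zero>\<^bsub>K\<^esub>" for m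
    using size_indexed_pmult[OF P(3) that] .
  moreover have "K.indexed_pmult P 0 \<in> polys {0..n}"
    using P(1) by (auto intro: K.indexed_pmult)
  ultimately show ?thesis
    unfolding homogeneous_signature_def by blast
qed

text \<open>A constant without zeros meets the condition vacuously. Multiplying it twice by
  \<open>Y\<close> produces the polynomial behind \<open>special_ideal_square\<close>.\<close>

lemma one_in_homogeneous_signature: "K.indexed_const \<one>\<^bsub>K\<^esub> \<in> homogeneous_signature K n"
proof -
  have "K.indexed_const \<one>\<^bsub>K\<^esub> {#} \<noteq> \<zero>\<^bsub>K\<^esub>" by (simp add: K.indexed_const_def)
  then show ?thesis
    using K.indexed_const_support[of "\<one>\<^bsub>K\<^esub>"] K.indexed_const[of "\<one>\<^bsub>K\<^esub>" "carrier K" "{0..n}"]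
    unfolding homogeneous_signature_def by (auto simp: K.base_eval_const)
qed

section \<open>Special ideals and the existence of special primes\<close>

lemma special_ideal_zero_closed:
  assumes "special_ideal K A I" "P \<in> homogeneous_signature K n" "v \<in> {0..n} \<rightarrow> carrier A"
    "alg_eval K A P v \<in> I"
  shows "v 0 \<in> I"
  using assms unfolding special_ideal_def by blast

text \<open>Multiplying by \<open>Y\<close> makes the degree positive.\<close>

lemma special_idealI:
  assumes I: "ideal I A"
    and closed: "\<And>n P d v. P \<in> homogeneous_signature K n \<Longrightarrow>
      (\<And>m. P m \<noteq> \<zero>\<^bsub>K\<^esub> \<Longrightarrow> size m = Suc d) \<Longrightarrow> v \<in> {0..n} \<rightarrow> carrier A \<Longrightarrow>
      alg_eval K A P v \<in> I \<Longrightarrow> v 0 \<in> I"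
  shows "special_ideal K A I"
  unfolding special_ideal_def
proof (intro conjI allI ballI impI I)
  fix n P v assume P: "P \<in> homogeneous_signature K n" and v: "v \<in> {0..n} \<rightarrow> carrier A"
    and PvI: "alg_eval K A P v \<in> I"
  from P obtain d where d: "P \<in> polys {0..n}" "\<And>m. P m \<noteq> \<zero>\<^bsub>K\<^esub> \<Longrightarrow> size m = d"
    unfolding homogeneous_signature_def by blast
  have "alg_eval K A (K.indexed_pmult P 0) v \<in> I"
    using alg_eval_pmult[OF d(1) _ v, of 0] ideal.I_r_closed[OF I PvI, of "v 0"]
      funcset_mem[OF v, of 0] by auto
  from closed[OF homogeneous_signature_mult_var[OF P] _ v this] show "v 0 \<in> I"
    using size_indexed_pmult[OF d(2)] by blast
qed

text \<open>From \<open>x P(v)\<close> in \<open>I\<close> one gets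
  \<open>x^(d+1) P(v) = P(x v)\<close> in \<open>I\<close>, and specialness of \<open>I\<close>
  yields \<open>x v_0\<close> in \<open>I\<close>. In degree 0 there would be no factor
  \<open>x\<close> to make use of the hypothesis.\<close>

lemma special_ideal_colon:
  assumes I: "special_ideal K A I" and x: "x \<in> carrier A"
  shows "special_ideal K A {z \<in> carrier A. x \<otimes> z \<in> I}"
proof (rule special_idealI)
  interpret I: ideal I A using I by (simp add: special_ideal_def)
  show "ideal {z \<in> carrier A. x \<otimes> z \<in> I} A"
  proof (rule idealI[OF ring_axioms])
    show "subgroup {z \<in> carrier A. x \<otimes> z \<in> I} (add_monoid A)"
      using x by (unfold_locales) (auto simp: r_distr r_minus a_inv_def[symmetric])
    fix a y assume a: "a \<in> {z \<in> carrier A. x \<otimes> z \<in> I}" and y: "y \<in> carrier A"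
    have "x \<otimes> a \<otimes> y \<in> I" using a y by (auto intro: I.I_r_closed)
    then show "y \<otimes> a \<in> {z \<in> carrier A. x \<otimes> z \<in> I}" "a \<otimes> y \<in> {z \<in> carrier A. x \<otimes> z \<in> I}"
      using a x y by (auto simp: m_ac)
  qed
  fix n P d v assume P: "P \<in> homogeneous_signature K n"
    and d: "\<And>m. P m \<noteq> \<zero>\<^bsub>K\<^esub> \<Longrightarrow> size m = Suc d" and v: "v \<in> {0..n} \<rightarrow> carrier A"
    and "alg_eval K A P v \<in> {z \<in> carrier A. x \<otimes> z \<in> I}"
  then have Pv: "alg_eval K A P v \<in> carrier A" "x \<otimes> alg_eval K A P v \<in> I" by auto
  have polys: "P \<in> polys {0..n}" using P by (simp add: homogeneous_signature_def)
  have "x [^] d \<otimes> (x \<otimes> alg_eval K A P v) \<in> I"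
    using x by (intro I.I_l_closed[OF Pv(2)]) auto
  then have "alg_eval K A P (\<lambda>i. x \<otimes> v i) \<in> I"
    using alg_eval_scale_homogeneous[OF polys d v x] x Pv(1) by (simp add: m_assoc)
  moreover have "(\<lambda>i. x \<otimes> v i) \<in> {0..n} \<rightarrow> carrier A" using v x by auto
  ultimately have "x \<otimes> v 0 \<in> I" using special_ideal_zero_closed[OF I P] by blast
  then show "v 0 \<in> {z \<in> carrier A. x \<otimes> z \<in> I}" using funcset_mem[OF v, of 0] by auto
qed

text \<open>\<open>?Q\<close> is \<open>Y^2\<close>, so special ideals are radical. The proof that
  an ideal maximal among the special ideals omitting \<open>h\<close> is prime depends on
  it.\<close>

lemma special_ideal_square:
  assumes I: "special_ideal K A I" and x: "x \<in> carrier A" and "x \<otimes> x \<in> I"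
  shows "x \<in> I"
proof -
  let ?Q = "K.indexed_pmult (K.indexed_pmult (K.indexed_const \<one>\<^bsub>K\<^esub>) 0) 0"
  have Q: "?Q \<in> homogeneous_signature K 0"
    by (intro homogeneous_signature_mult_var one_in_homogeneous_signature)
  have v: "(\<lambda>_. x) \<in> {0..0::nat} \<rightarrow> carrier A" using x by simp
  have pol: "K.indexed_const \<one>\<^bsub>K\<^esub> \<in> polys {0..0}"
    "K.indexed_pmult (K.indexed_const \<one>\<^bsub>K\<^esub>) 0 \<in> polys {0..0}"
    by (auto intro: K.indexed_const K.indexed_pmult)
  have "alg_eval K A ?Q (\<lambda>_. x) = x \<otimes> x"
    using x alg_eval_pmult[OF pol(1) _ v, of 0] alg_eval_pmult[OF pol(2) _ v, of 0]
    by (simp add: alg_eval_const)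
  then show ?thesis
    using special_ideal_zero_closed[OF I Q v] assms(3) by simp
qed

text \<open>Each instance of the condition starts from membership of a single element, so it already
  takes place in one member of the chain.\<close>

lemma special_ideal_chain_Union:
  assumes "\<C> \<noteq> {}" "subset.chain {I. special_ideal K A I} \<C>"
  shows "special_ideal K A (\<Union>\<C>)"
  unfolding special_ideal_def
proof (intro conjI allI ballI impI)
  have "subset.chain {I. ideal I A} \<C>"
    using assms(2) by (auto simp: pred_on.chain_def special_ideal_def)
  from chain_Union_is_ideal[OF this] show "ideal (\<Union>\<C>) A" using assms(1) by simp
  fix n P v assume P: "P \<in> homogeneous_signature K n" "v \<in> {0..n} \<rightarrow> carrier A"
    and "alg_eval K A P v \<in> \<Union>\<C>"
  then obtain I where I: "I \<in> \<C>" "alg_eval K A P v \<in> I" by blast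
  then have "special_ideal K A I" using assms(2) by (auto simp: pred_on.chain_def)
  from special_ideal_zero_closed[OF this P I(2)] show "v 0 \<in> \<Union>\<C>" using I(1) by blast
qed

lemma special_ideal_eq_carrier:
  "special_ideal K A I \<Longrightarrow> \<one> \<in> I \<Longrightarrow> I = carrier A"
  using ideal.one_imp_carrier by (auto simp: special_ideal_def)

text \<open>Zorn's lemma is applied to special ideals, so the maximal one is special by choice and
  only primality remains. The colon ideals are the larger special ideals against which maximality is
  tested.\<close>

theorem special_prime_avoiding:
  assumes I: "special_ideal K A I" and h: "h \<in> carrier A" "h \<notin> I"
  obtains p where "p \<in> Spec2 K A" "I \<subseteq> p" "h \<notin> p"
proof -
  let ?\<A> = "{J. special_ideal K A J \<and> I \<subseteq> J \<and> h \<notin> J}"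
  have "\<exists>p \<in> ?\<A>. \<forall>J \<in> ?\<A>. p \<subseteq> J \<longrightarrow> J = p"
  proof (rule subset_Zorn_nonempty)
    show "?\<A> \<noteq> {}" using I h by blast
    show "\<Union>\<C> \<in> ?\<A>" if \<C>: "\<C> \<noteq> {}" "subset.chain ?\<A> \<C>" for \<C>
    proof -
      have "subset.chain {J. special_ideal K A J} \<C>"
        using \<C>(2) by (auto simp: pred_on.chain_def)
      from special_ideal_chain_Union[OF \<C>(1) this] show ?thesis
        using \<C> by (auto simp: pred_on.chain_def)
    qed
  qed
  then obtain p where "p \<in> ?\<A>" and max': "\<And>J. J \<in> ?\<A> \<Longrightarrow> p \<subseteq> J \<Longrightarrow> J = p"
    by (elim bexE) auto
  then have p: "special_ideal K A p" "I \<subseteq> p" "h \<notin> p" by auto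
  have max: "J = p" if "special_ideal K A J" "p \<subseteq> J" "h \<notin> J" for J
    using max'[of J] that p(2) by simp
  interpret p: ideal p A using p(1) by (simp add: special_ideal_def)
  \<comment> \<open>If \<open>x h\<close> is not in \<open>p\<close>, then (p : x) is special,
    contains \<open>p\<close> and omits \<open>h\<close>; by maximality it is
    \<open>p\<close>.\<close>
  have colon: "y \<in> p" if "x \<in> carrier A" "y \<in> carrier A" "x \<otimes> y \<in> p" "x \<otimes> h \<notin> p" for x y
  proof -
    have "p \<subseteq> {z \<in> carrier A. x \<otimes> z \<in> p}"
      using p.I_l_closed[OF _ that(1)] p.a_subset by auto
    moreover have "h \<notin> {z \<in> carrier A. x \<otimes> z \<in> p}" using that by simp
    ultimately have "{z \<in> carrier A. x \<otimes> z \<in> p} = p"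
      by (rule max[OF special_ideal_colon[OF p(1) that(1)]])
    then show ?thesis using that by blast
  qed
  have "primeideal p A"
  proof (rule primeidealI[OF p.is_ideal is_cring])
    show "carrier A \<noteq> p" using h(1) p(3) by blast
    fix x y assume xy: "x \<in> carrier A" "y \<in> carrier A" "x \<otimes> y \<in> p"
    show "x \<in> p \<or> y \<in> p"
    proof (cases "x \<otimes> h \<in> p")
      case False
      then show ?thesis using colon xy by blast
    next
      case True
      \<comment> \<open>If \<open>x h\<close> is in \<open>p\<close>, the roles change:
        \<open>colon\<close> is used with \<open>h\<close> as first factor and \<open>x\<close> as
        second, and its hypothesis that \<open>h h\<close> is not in \<open>p\<close> holds by
        radicality.\<close>
      moreover have "h \<otimes> h \<notin> p" using special_ideal_square[OF p(1) h(1)] p(3) by blast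
      ultimately have "x \<in> p" using colon[of h x] xy h(1) by (simp add: m_comm)
      then show ?thesis ..
    qed
  qed
  then have "p \<in> Spec2 K A" using p(1) by (simp add: Spec2_def)
  then show ?thesis using that p by blast
qed

section \<open>Ideals, special primes and the set \<open>M\<close>\<close>

lemma M_set_disjoint_special:
  assumes I: "special_ideal K A I" and "x \<in> M_set K A" "x \<in> I"
  shows "I = carrier A"
proof -
  from assms(2) obtain n D v where D: "x = alg_eval K A D v" "D \<in> algebraic_signature K n"
    and v: "v \<in> {1..n} \<rightarrow> carrier A"
    unfolding M_set_def by blast
  obtain P where P: "P \<in> homogeneous_signature K n"
    and eq: "\<And>v. v \<in> {1..n} \<rightarrow> carrier A \<Longrightarrow> alg_eval K A P (v(0 := \<one>)) = alg_eval K A D v"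
    by (rule homogenise_signature[OF D(2)]) (rule that)
  have "v(0 := \<one>) \<in> {0..n} \<rightarrow> carrier A" using v by (auto simp: Pi_iff)
  then have "(v(0 := \<one>)) 0 \<in> I"
    using special_ideal_zero_closed[OF I P] eq[OF v] assms(3) D(1) by metis
  then show ?thesis using special_ideal_eq_carrier[OF I] by simp
qed

lemma Spec2_one_notin:
  assumes "p \<in> Spec2 K A"
  shows "\<one> \<notin> p"
  using assms ideal.one_imp_carrier[of p A] primeideal.I_notcarr[of p A]
  by (auto simp: Spec2_def special_ideal_def)

lemma M_set_disjoint_Spec2:
  assumes "p \<in> Spec2 K A" "x \<in> M_set K A"
  shows "x \<notin> p"
  using M_set_disjoint_special[of p x] assms Spec2_one_notin[OF assms(1)]
  by (auto simp: Spec2_def)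

text \<open>Polynomials respect congruence modulo an ideal. Stating it with differences avoids the
  quotient algebra.\<close>

lemma alg_eval_diff_in_ideal:
  assumes I: "ideal I A" and P: "P \<in> polys J"
    and v: "v \<in> J \<rightarrow> carrier A" and w: "w \<in> J \<rightarrow> carrier A"
    and diff: "\<And>j. j \<in> J \<Longrightarrow> v j \<ominus> w j \<in> I"
  shows "alg_eval K A P v \<ominus> alg_eval K A P w \<in> I"
proof -
  interpret I: ideal I A by (rule I)
  show ?thesis
    using P
  proof induction
    case (indexed_const c)
    then show ?case by (simp add: alg_eval_const minus_eq r_neg)
  next
    case (indexed_padd P Q)
    note c = alg_eval_closed[OF indexed_padd.hyps(1) v] alg_eval_closed[OF indexed_padd.hyps(1) w]
      alg_eval_closed[OF indexed_padd.hyps(2) v] alg_eval_closed[OF indexed_padd.hyps(2) w]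
    have "alg_eval K A P v \<oplus> alg_eval K A Q v \<ominus> (alg_eval K A P w \<oplus> alg_eval K A Q w)
        = (alg_eval K A P v \<ominus> alg_eval K A P w) \<oplus> (alg_eval K A Q v \<ominus> alg_eval K A Q w)"
      using c by algebra
    then show ?case
      using I.a_closed[OF indexed_padd.IH]
      by (simp add: alg_eval_padd[OF indexed_padd.hyps v] alg_eval_padd[OF indexed_padd.hyps w])
  next
    case (indexed_pmult P j)
    note c = alg_eval_closed[OF indexed_pmult.hyps(1) v] alg_eval_closed[OF indexed_pmult.hyps(1) w]
      funcset_mem[OF v indexed_pmult.hyps(2)] funcset_mem[OF w indexed_pmult.hyps(2)]
    have "alg_eval K A P v \<otimes> v j \<ominus> alg_eval K A P w \<otimes> w j
        = (alg_eval K A P v \<ominus> alg_eval K A P w) \<otimes> v j \<oplus> alg_eval K A P w \<otimes> (v j \<ominus> w j)"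
      using c by algebra
    then show ?case
      using I.a_closed[OF I.I_r_closed[OF indexed_pmult.IH c(3)]
          I.I_l_closed[OF diff[OF indexed_pmult.hyps(2)] c(2)]]
      by (simp add: alg_eval_pmult[OF indexed_pmult.hyps v] alg_eval_pmult[OF indexed_pmult.hyps w])
  qed
qed

text \<open>The ideal generated by \<open>I\<close> and \<open>x\<close>, with its elements written
  out so that meeting \<open>M\<close> directly gives an element \<open>i + x z\<close> of
  \<open>M\<close>.\<close>

lemma ideal_add_principal:
  assumes "ideal I A" "x \<in> carrier A"
  shows "ideal {i \<oplus> x \<otimes> z | i z. i \<in> I \<and> z \<in> carrier A} A"
proof -
  have "{i \<oplus> x \<otimes> z | i z. i \<in> I \<and> z \<in> carrier A} = I <+> PIdl x"
    using assms(2) by (auto simp: set_add_def' cgenideal_def m_comm) (metis m_comm)+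
  then show ?thesis
    using add_ideals[OF assms(1) cgenideal_ideal[OF assms(2)]] by simp
qed

text \<open>An ideal maximal among those disjoint from \<open>M\<close> is not only prime but special: if
  \<open>P(a, b) \<in> p\<close> and \<open>b \<notin> p\<close>, then \<open>b z \<equiv> \<alpha>\<close> modulo \<open>p\<close> for some \<open>z\<close> and some \<open>\<alpha> \<in> M\<close>, and
  \<open>P(z a, \<alpha>) \<in> M\<close> would be in \<open>p\<close>.\<close>

theorem special_prime_disjoint_M_set:
  assumes J: "ideal J A" "J \<inter> M_set K A = {}"
  obtains p where "p \<in> Spec2 K A" "J \<subseteq> p"
proof -
  let ?\<A> = "{I. ideal I A \<and> J \<subseteq> I \<and> I \<inter> M_set K A = {}}"
  have "\<exists>p \<in> ?\<A>. \<forall>I \<in> ?\<A>. p \<subseteq> I \<longrightarrow> I = p"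
  proof (rule subset_Zorn_nonempty)
    show "?\<A> \<noteq> {}" using J by blast
    show "\<Union>\<C> \<in> ?\<A>" if \<C>: "\<C> \<noteq> {}" "subset.chain ?\<A> \<C>" for \<C>
    proof -
      have "subset.chain {I. ideal I A} \<C>"
        using \<C>(2) by (auto simp: pred_on.chain_def)
      from chain_Union_is_ideal[OF this] show ?thesis
        using \<C> by (auto simp: pred_on.chain_def)
    qed
  qed
  then obtain p where "p \<in> ?\<A>" and max': "\<And>I. I \<in> ?\<A> \<Longrightarrow> p \<subseteq> I \<Longrightarrow> I = p"
    by (elim bexE) auto
  then have p: "ideal p A" "J \<subseteq> p" "p \<inter> M_set K A = {}" by auto
  have max: "I = p" if "ideal I A" "p \<subseteq> I" "I \<inter> M_set K A = {}" for I
    using max'[of I] that p(2) by simp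
  interpret p: ideal p A by (rule p(1))
  \<comment> \<open>Otherwise the ideal generated by \<open>p\<close> and \<open>x\<close> would
    still be disjoint from \<open>M\<close>, against maximality.\<close>
  have reach: "\<exists>i \<in> p. \<exists>z \<in> carrier A. i \<oplus> x \<otimes> z \<in> M_set K A"
    if x: "x \<in> carrier A" "x \<notin> p" for x
  proof (rule ccontr)
    assume "\<not> ?thesis"
    then have "{i \<oplus> x \<otimes> z | i z. i \<in> p \<and> z \<in> carrier A} \<inter> M_set K A = {}" by blast
    moreover have "i \<in> {i \<oplus> x \<otimes> z | i z. i \<in> p \<and> z \<in> carrier A}" if "i \<in> p" for i
    proof -
      have "i = i \<oplus> x \<otimes> \<zero>" using p.a_Hcarr[OF that] x(1) by simp
      then show ?thesis using that by blast
    qed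
    ultimately have "{i \<oplus> x \<otimes> z | i z. i \<in> p \<and> z \<in> carrier A} = p"
      using max[OF ideal_add_principal[OF p(1) x(1)]] by blast
    moreover have "x \<in> {i \<oplus> x \<otimes> z | i z. i \<in> p \<and> z \<in> carrier A}"
    proof -
      have "x = \<zero> \<oplus> x \<otimes> \<one>" using x(1) by simp
      then show ?thesis using p.zero_closed by blast
    qed
    ultimately show False using x(2) by blast
  qed
  have "primeideal p A"
  proof (rule primeidealI[OF p(1) is_cring])
    show "carrier A \<noteq> p" using one_in_M_set p(3) by auto
    fix x y assume xy: "x \<in> carrier A" "y \<in> carrier A" "x \<otimes> y \<in> p"
    show "x \<in> p \<or> y \<in> p"
    proof (rule ccontr)
      assume "\<not> ?thesis"
      then obtain i z j t where iz: "i \<in> p" "z \<in> carrier A" "i \<oplus> x \<otimes> z \<in> M_set K A"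
        and jt: "j \<in> p" "t \<in> carrier A" "j \<oplus> y \<otimes> t \<in> M_set K A"
        using reach xy by metis
      note c = xy(1,2) iz(2) jt(2) p.a_Hcarr[OF iz(1)] p.a_Hcarr[OF jt(1)]
      \<comment> \<open>Every term of the expansion has a factor \<open>i\<close>, \<open>j\<close>
        or \<open>x y\<close>, hence lies in \<open>p\<close>, whereas the left-hand side is a
        product of two elements of \<open>M\<close>.\<close>
      have "(i \<oplus> x \<otimes> z) \<otimes> (j \<oplus> y \<otimes> t) = i \<otimes> (j \<oplus> y \<otimes> t) \<oplus> (x \<otimes> z \<otimes> j \<oplus> x \<otimes> y \<otimes> (z \<otimes> t))"
        using c by algebra
      moreover have "\<dots> \<in> p"
        by (rule p.a_closed[OF p.I_r_closed[OF iz(1)] p.a_closed[OF p.I_l_closed[OF jt(1)]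
                p.I_r_closed[OF xy(3)]]]) (use c in auto)
      ultimately show False using M_set_mult[OF iz(3) jt(3)] p(3) by auto
    qed
  qed
  moreover have "special_ideal K A p"
    unfolding special_ideal_def
  proof (intro conjI allI ballI impI p(1))
    fix n P v assume P: "P \<in> homogeneous_signature K n" and v: "v \<in> {0..n} \<rightarrow> carrier A"
      and Pv: "alg_eval K A P v \<in> p"
    from P obtain d where d: "P \<in> polys {0..n}" "\<And>m. P m \<noteq> \<zero>\<^bsub>K\<^esub> \<Longrightarrow> size m = d"
      and P0: "\<And>v. v \<in> {0..n} \<rightarrow> carrier K \<Longrightarrow> base_eval K P v = \<zero>\<^bsub>K\<^esub> \<Longrightarrow> v 0 = \<zero>\<^bsub>K\<^esub>"
      unfolding homogeneous_signature_def by blast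
    show "v 0 \<in> p"
    proof (rule ccontr)
      have v0: "v 0 \<in> carrier A" using v by auto
      assume "v 0 \<notin> p"
      then obtain i z where iz: "i \<in> p" "z \<in> carrier A" "i \<oplus> v 0 \<otimes> z \<in> M_set K A"
        using reach v0 by blast
      let ?\<alpha> = "i \<oplus> v 0 \<otimes> z"
      let ?w = "\<lambda>i. z \<otimes> v i"
      have w: "?w \<in> {0..n} \<rightarrow> carrier A" using v iz(2) by auto
      have "alg_eval K A P ?w \<in> p"
        using alg_eval_scale_homogeneous[OF d v iz(2)] p.I_l_closed[OF Pv, of "z [^] d"] iz(2)
        by simp
      \<comment> \<open>Replacing the \<open>Y\<close> argument \<open>z v_0\<close> by
        \<open>?\<alpha>\<close> changes it by \<open>i\<close>, an element of \<open>p\<close>, so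
        the two values are congruent modulo \<open>p\<close>. With \<open>?\<alpha>\<close> in place
        of \<open>Y\<close> the value belongs to \<open>M\<close> by \<open>M_set_subst\<close>,
        which is the contradiction.\<close>
      moreover have "alg_eval K A P (?w(0 := ?\<alpha>)) \<ominus> alg_eval K A P ?w \<in> p"
      proof (rule alg_eval_diff_in_ideal[OF p(1) d(1) _ w])
        show "?w(0 := ?\<alpha>) \<in> {0..n} \<rightarrow> carrier A" using w M_set_closed[OF iz(3)] by auto
        show "(?w(0 := ?\<alpha>)) j \<ominus> ?w j \<in> p" if "j \<in> {0..n}" for j
        proof (cases "j = 0")
          case True
          have "i \<oplus> v 0 \<otimes> z \<ominus> z \<otimes> v 0 = i"
            using p.a_Hcarr[OF iz(1)] v0 iz(2) by algebra
          then show ?thesis using True iz(1) by simp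
        next
          case False
          then show ?thesis using funcset_mem[OF w that] by (simp add: minus_eq r_neg)
        qed
      qed
      moreover have "alg_eval K A P (?w(0 := ?\<alpha>)) \<in> M_set K A"
        by (rule M_set_subst[OF poly_fun_eval[OF d(1)]])
          (use P0 w iz(3) M_set_closed[OF iz(3)] in auto)
      moreover have "x \<in> p" if "x \<ominus> y \<in> p" "y \<in> p" "x \<in> carrier A" for x y
      proof -
        have "x = (x \<ominus> y) \<oplus> y" using that p.a_Hcarr[OF that(2)] by algebra
        then show ?thesis using p.a_closed[OF that(1,2)] by simp
      qed
      ultimately show False using p(3) M_set_closed by blast
    qed
  qed
  ultimately have "p \<in> Spec2 K A" by (simp add: Spec2_def)
  then show ?thesis using that p(2) by blast
qed

end

section \<open>Localisation\<close>

text \<open>Covers both localisations in play, at \<open>M_set K A\<close> and at the complement of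
  a special prime. As \<open>S\<close> may contain zero divisors, equality of fractions carries an
  extra factor \<open>u\<close>.\<close>

locale mult_subset = algebra K A
  for K :: "('k, 'l) ring_scheme" and A :: "('k, 'a, 'm) module_scheme" (structure) +
  fixes S :: "'a set"
  assumes S_carrier: "S \<subseteq> carrier A"
    and one_S: "\<one> \<in> S"
    and mult_S: "s \<in> S \<Longrightarrow> t \<in> S \<Longrightarrow> s \<otimes> t \<in> S"
begin

abbreviation frac :: "'a \<Rightarrow> 'a \<Rightarrow> ('a \<times> 'a) set" where
  "frac \<equiv> fraction A S"

abbreviation Loc :: "('k, ('a \<times> 'a) set) module" where
  "Loc \<equiv> localisation A S"

lemma S_closed [simp]: "s \<in> S \<Longrightarrow> s \<in> carrier A"
  using S_carrier by blast

lemma loc_rel_iff: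
  "((a, s), (b, t)) \<in> loc_rel A S \<longleftrightarrow> a \<in> carrier A \<and> s \<in> S \<and> b \<in> carrier A \<and> t \<in> S \<and>
    (\<exists>u \<in> S. u \<otimes> (a \<otimes> t) = u \<otimes> (b \<otimes> s))"
  by (auto simp: loc_rel_def)

lemma equiv_loc_rel: "equiv (carrier A \<times> S) (loc_rel A S)"
proof (rule equivI)
  show "loc_rel A S \<subseteq> (carrier A \<times> S) \<times> (carrier A \<times> S)"
    by (auto simp: loc_rel_def)
  show "refl_on (carrier A \<times> S) (loc_rel A S)"
    using one_S by (auto simp: refl_on_def loc_rel_iff)
  show "sym (loc_rel A S)"
  proof (rule symI, clarify)
    fix a s b t assume "((a, s), (b, t)) \<in> loc_rel A S"
    then show "((b, t), (a, s)) \<in> loc_rel A S"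
      unfolding loc_rel_iff by metis
  qed
  show "trans (loc_rel A S)"
  proof (rule transI, clarify)
    fix a s b t c r
    assume "((a, s), (b, t)) \<in> loc_rel A S" "((b, t), (c, r)) \<in> loc_rel A S"
    then obtain u w where c: "a \<in> carrier A" "s \<in> S" "b \<in> carrier A" "t \<in> S" "c \<in> carrier A" "r \<in> S"
        "u \<in> S" "w \<in> S"
      and eq: "u \<otimes> (a \<otimes> t) = u \<otimes> (b \<otimes> s)" "w \<otimes> (b \<otimes> r) = w \<otimes> (c \<otimes> t)"
      unfolding loc_rel_iff by metis
    note c' = c(1,3,5) c(2,4,6-8)[THEN S_closed]
    \<comment> \<open>The middle denominator \<open>t\<close> cannot be cancelled, so it joins the
      multiplier.\<close>
    have "(u \<otimes> w \<otimes> t) \<otimes> (a \<otimes> r) = (u \<otimes> (a \<otimes> t)) \<otimes> (w \<otimes> r)"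
      using c' by algebra
    also have "\<dots> = (w \<otimes> (b \<otimes> r)) \<otimes> (u \<otimes> s)"
      unfolding eq(1) using c' by algebra
    also have "\<dots> = (u \<otimes> w \<otimes> t) \<otimes> (c \<otimes> s)"
      unfolding eq(2) using c' by algebra
    finally show "((a, s), (c, r)) \<in> loc_rel A S"
      unfolding loc_rel_iff using c mult_S by metis
  qed
qed

lemma frac_eq_iff:
  assumes "a \<in> carrier A" "s \<in> S" "b \<in> carrier A" "t \<in> S"
  shows "frac a s = frac b t \<longleftrightarrow> (\<exists>u \<in> S. u \<otimes> (a \<otimes> t) = u \<otimes> (b \<otimes> s))"
  unfolding fraction_def
  using eq_equiv_class_iff[OF equiv_loc_rel, of "(a, s)" "(b, t)"] assms
  by (simp add: loc_rel_iff)

lemma frac_eqI: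
  assumes "a \<in> carrier A" "s \<in> S" "b \<in> carrier A" "t \<in> S" "a \<otimes> t = b \<otimes> s"
  shows "frac a s = frac b t"
  unfolding frac_eq_iff[OF assms(1-4)] using assms(5) by (intro bexI[OF _ one_S]) simp

lemma mem_frac_iff:
  assumes "a \<in> carrier A" "s \<in> S"
  shows "(b, t) \<in> frac a s \<longleftrightarrow> b \<in> carrier A \<and> t \<in> S \<and> frac b t = frac a s"
proof -
  have "(b, t) \<in> frac a s \<longleftrightarrow> ((a, s), (b, t)) \<in> loc_rel A S"
    by (simp add: fraction_def)
  also have "\<dots> \<longleftrightarrow> b \<in> carrier A \<and> t \<in> S \<and> frac a s = frac b t"
    using assms by (simp add: loc_rel_iff frac_eq_iff cong: conj_cong)
  finally show ?thesis by metis
qed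

lemma frac_closed [intro]: "a \<in> carrier A \<Longrightarrow> s \<in> S \<Longrightarrow> frac a s \<in> carrier Loc"
  by (auto simp: localisation_def fraction_def intro: quotientI)

lemma Loc_cases [elim?]:
  assumes "x \<in> carrier Loc"
  obtains a s where "a \<in> carrier A" "s \<in> S" "x = frac a s"
  using assms by (auto simp: localisation_def fraction_def elim!: quotientE)

text \<open>The operations of a localisation are unions over representatives. If all representatives
  give the same set, the union over the non-empty class is that set, so well-definedness and
  computation are one statement.\<close>

lemma UN_frac:
  assumes as: "a \<in> carrier A" "s \<in> S"
    and resp: "\<And>b t. b \<in> carrier A \<Longrightarrow> t \<in> S \<Longrightarrow> frac b t = frac a s \<Longrightarrow> F b t = F a s"
  shows "(\<Union>(b, t) \<in> frac a s. F b t) = F a s"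
proof (rule UN_constant_eq[of "(a, s)"])
  show "(a, s) \<in> frac a s" using as by (simp add: mem_frac_iff)
  show "\<forall>x \<in> frac a s. (case x of (b, t) \<Rightarrow> F b t) = F a s"
  proof
    fix x assume "x \<in> frac a s"
    moreover
    obtain b t where x: "x = (b, t)" by fastforce
    ultimately have "F b t = F a s"
      by (intro resp) (simp_all add: mem_frac_iff[OF as])
    then show "(case x of (b, t) \<Rightarrow> F b t) = F a s" by (simp add: x)
  qed
qed

lemma UN_frac2:
  assumes "a \<in> carrier A" "s \<in> S" "b \<in> carrier A" "t \<in> S"
    and resp: "\<And>a' s' b' t'. a' \<in> carrier A \<Longrightarrow> s' \<in> S \<Longrightarrow> frac a' s' = frac a s \<Longrightarrow>
      b' \<in> carrier A \<Longrightarrow> t' \<in> S \<Longrightarrow> frac b' t' = frac b t \<Longrightarrow> F a' s' b' t' = F a s b t"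
  shows "(\<Union>(a', s') \<in> frac a s. \<Union>(b', t') \<in> frac b t. F a' s' b' t') = F a s b t"
proof -
  have inner: "(\<Union>(b', t') \<in> frac b t. F a' s' b' t') = F a' s' b t"
    if p: "a' \<in> carrier A" "s' \<in> S" "frac a' s' = frac a s" for a' s'
    by (rule UN_frac[OF assms(3,4)], rule trans[OF resp[OF p] resp[OF p assms(3,4) refl, symmetric]])
  have "(\<Union>(a', s') \<in> frac a s. \<Union>(b', t') \<in> frac b t. F a' s' b' t')
      = (\<Union>(b', t') \<in> frac b t. F a s b' t')"
    by (rule UN_frac[OF assms(1,2)])
      (simp only: inner inner[OF assms(1,2) refl], rule resp, simp_all add: assms(3,4))
  also have "\<dots> = F a s b t"
    by (rule inner[OF assms(1,2) refl])
  finally show ?thesis .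
qed

lemma frac_mult:
  assumes "a \<in> carrier A" "s \<in> S" "b \<in> carrier A" "t \<in> S"
  shows "frac a s \<otimes>\<^bsub>Loc\<^esub> frac b t = frac (a \<otimes> b) (s \<otimes> t)"
proof -
  have "frac (a' \<otimes> b') (s' \<otimes> t') = frac (a \<otimes> b) (s \<otimes> t)"
    if p: "a' \<in> carrier A" "s' \<in> S" "frac a' s' = frac a s"
      "b' \<in> carrier A" "t' \<in> S" "frac b' t' = frac b t" for a' s' b' t'
  proof -
    from p(3,6) obtain u w where u: "u \<in> S" "u \<otimes> (a' \<otimes> s) = u \<otimes> (a \<otimes> s')"
      and w: "w \<in> S" "w \<otimes> (b' \<otimes> t) = w \<otimes> (b \<otimes> t')"
      unfolding frac_eq_iff[OF p(1,2) assms(1,2)] frac_eq_iff[OF p(4,5) assms(3,4)] by blast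
    note c = assms(1,3) p(1,4) assms(2,4)[THEN S_closed] p(2,5)[THEN S_closed]
      u(1)[THEN S_closed] w(1)[THEN S_closed]
    have "(u \<otimes> w) \<otimes> ((a' \<otimes> b') \<otimes> (s \<otimes> t)) = (u \<otimes> (a' \<otimes> s)) \<otimes> (w \<otimes> (b' \<otimes> t))"
      using c by algebra
    also have "\<dots> = (u \<otimes> w) \<otimes> ((a \<otimes> b) \<otimes> (s' \<otimes> t'))"
      unfolding u(2) w(2) using c by algebra
    finally show ?thesis
      by (intro iffD2[OF frac_eq_iff] bexI[OF _ mult_S[OF u(1) w(1)]])
        (use assms p mult_S in auto)
  qed
  then have "(\<Union>(a', s') \<in> frac a s. \<Union>(b', t') \<in> frac b t. frac (a' \<otimes> b') (s' \<otimes> t'))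
      = frac (a \<otimes> b) (s \<otimes> t)"
    by (rule UN_frac2[OF assms])
  then show ?thesis
    unfolding localisation_def by simp
qed

lemma frac_add:
  assumes "a \<in> carrier A" "s \<in> S" "b \<in> carrier A" "t \<in> S"
  shows "frac a s \<oplus>\<^bsub>Loc\<^esub> frac b t = frac (a \<otimes> t \<oplus> b \<otimes> s) (s \<otimes> t)"
proof -
  have "frac (a' \<otimes> t' \<oplus> b' \<otimes> s') (s' \<otimes> t') = frac (a \<otimes> t \<oplus> b \<otimes> s) (s \<otimes> t)"
    if p: "a' \<in> carrier A" "s' \<in> S" "frac a' s' = frac a s"
      "b' \<in> carrier A" "t' \<in> S" "frac b' t' = frac b t" for a' s' b' t'
  proof -
    from p(3,6) obtain u w where u: "u \<in> S" "u \<otimes> (a' \<otimes> s) = u \<otimes> (a \<otimes> s')"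
      and w: "w \<in> S" "w \<otimes> (b' \<otimes> t) = w \<otimes> (b \<otimes> t')"
      unfolding frac_eq_iff[OF p(1,2) assms(1,2)] frac_eq_iff[OF p(4,5) assms(3,4)] by blast
    note c = assms(1,3) p(1,4) assms(2,4)[THEN S_closed] p(2,5)[THEN S_closed]
      u(1)[THEN S_closed] w(1)[THEN S_closed]
    have "(u \<otimes> w) \<otimes> ((a' \<otimes> t' \<oplus> b' \<otimes> s') \<otimes> (s \<otimes> t))
        = (u \<otimes> (a' \<otimes> s)) \<otimes> (w \<otimes> t \<otimes> t') \<oplus> (w \<otimes> (b' \<otimes> t)) \<otimes> (u \<otimes> s \<otimes> s')"
      using c by algebra
    also have "\<dots> = (u \<otimes> w) \<otimes> ((a \<otimes> t \<oplus> b \<otimes> s) \<otimes> (s' \<otimes> t'))"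
      unfolding u(2) w(2) using c by algebra
    finally show ?thesis
      by (intro iffD2[OF frac_eq_iff] bexI[OF _ mult_S[OF u(1) w(1)]])
        (use assms p mult_S in auto)
  qed
  then have "(\<Union>(a', s') \<in> frac a s. \<Union>(b', t') \<in> frac b t. frac (a' \<otimes> t' \<oplus> b' \<otimes> s') (s' \<otimes> t'))
      = frac (a \<otimes> t \<oplus> b \<otimes> s) (s \<otimes> t)"
    by (rule UN_frac2[OF assms])
  then show ?thesis
    unfolding localisation_def by simp
qed

lemma frac_smult:
  assumes "c \<in> carrier K" "a \<in> carrier A" "s \<in> S"
  shows "c \<odot>\<^bsub>Loc\<^esub> frac a s = frac (c \<odot> a) s"
proof -
  have "frac (c \<odot> b) t = frac (c \<odot> a) s"
    if bt: "b \<in> carrier A" "t \<in> S" "frac b t = frac a s" for b t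
  proof -
    from bt(3) obtain u where u: "u \<in> S" "u \<otimes> (b \<otimes> s) = u \<otimes> (a \<otimes> t)"
      unfolding frac_eq_iff[OF bt(1,2) assms(2,3)] by blast
    have pull: "u \<otimes> ((c \<odot> x) \<otimes> y) = c \<odot> (u \<otimes> (x \<otimes> y))"
      if "x \<in> carrier A" "y \<in> carrier A" for x y
    proof -
      have "u \<otimes> ((c \<odot> x) \<otimes> y) = (c \<odot> (x \<otimes> y)) \<otimes> u"
        using that u(1) assms(1) by (simp add: smult_assoc2 m_comm[of u])
      also have "\<dots> = c \<odot> (u \<otimes> (x \<otimes> y))"
        using that u(1) assms(1) by (simp only: smult_assoc2 m_closed S_closed m_comm[of u])
      finally show ?thesis .
    qed
    have "u \<otimes> ((c \<odot> b) \<otimes> s) = u \<otimes> ((c \<odot> a) \<otimes> t)"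
      using u(2) pull[OF bt(1)] pull[OF assms(2)] assms(3) bt(2) by simp
    then show ?thesis
      by (intro iffD2[OF frac_eq_iff] bexI[OF _ u(1)]) (use assms bt in auto)
  qed
  then have "(\<Union>(b, t) \<in> frac a s. frac (c \<odot> b) t) = frac (c \<odot> a) s"
    by (rule UN_frac[OF assms(2,3)])
  then show ?thesis
    unfolding localisation_def by simp
qed

lemma one_Loc: "\<one>\<^bsub>Loc\<^esub> = frac \<one> \<one>" and zero_Loc: "\<zero>\<^bsub>Loc\<^esub> = frac \<zero> \<one>"
  by (simp_all add: localisation_def)

lemma algebra_Loc: "algebra K Loc"
proof (intro algebraI[OF R_cring] cringI abelian_groupI comm_monoidI)
  note [simp] = frac_mult frac_add frac_smult one_Loc zero_Loc one_S mult_S frac_closed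
  show "x \<oplus>\<^bsub>Loc\<^esub> y \<in> carrier Loc" "x \<otimes>\<^bsub>Loc\<^esub> y \<in> carrier Loc"
    if "x \<in> carrier Loc" "y \<in> carrier Loc" for x y
    using that by (auto elim!: Loc_cases)
  show "\<zero>\<^bsub>Loc\<^esub> \<in> carrier Loc" "\<one>\<^bsub>Loc\<^esub> \<in> carrier Loc" by simp_all
  show "c \<odot>\<^bsub>Loc\<^esub> x \<in> carrier Loc" if "c \<in> carrier K" "x \<in> carrier Loc" for c x
    using that by (auto elim!: Loc_cases)
  fix x assume "x \<in> carrier Loc"
  then obtain a s where x: "a \<in> carrier A" "s \<in> S" "x = frac a s" by (rule Loc_cases)
  show "\<zero>\<^bsub>Loc\<^esub> \<oplus>\<^bsub>Loc\<^esub> x = x" "\<one>\<^bsub>Loc\<^esub> \<otimes>\<^bsub>Loc\<^esub> x = x" "\<one>\<^bsub>K\<^esub> \<odot>\<^bsub>Loc\<^esub> x = x"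
    using x by simp_all
  have "frac (\<ominus> a) s \<oplus>\<^bsub>Loc\<^esub> x = \<zero>\<^bsub>Loc\<^esub>"
    using x by simp (rule frac_eqI, simp_all add: l_minus l_neg)
  then show "\<exists>y \<in> carrier Loc. y \<oplus>\<^bsub>Loc\<^esub> x = \<zero>\<^bsub>Loc\<^esub>" by (rule bexI) (use x in simp)
  show "(c \<otimes>\<^bsub>K\<^esub> d) \<odot>\<^bsub>Loc\<^esub> x = c \<odot>\<^bsub>Loc\<^esub> (d \<odot>\<^bsub>Loc\<^esub> x)" if "c \<in> carrier K" "d \<in> carrier K" for c d
    using that x by (simp add: smult_assoc1)
  show "(c \<oplus>\<^bsub>K\<^esub> d) \<odot>\<^bsub>Loc\<^esub> x = c \<odot>\<^bsub>Loc\<^esub> x \<oplus>\<^bsub>Loc\<^esub> d \<odot>\<^bsub>Loc\<^esub> x"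
    if "c \<in> carrier K" "d \<in> carrier K" for c d
    using that x by simp (rule frac_eqI, simp_all add: smult_l_distr l_distr m_assoc)
  fix y assume "y \<in> carrier Loc"
  then obtain b t where y: "b \<in> carrier A" "t \<in> S" "y = frac b t" by (rule Loc_cases)
  show "x \<oplus>\<^bsub>Loc\<^esub> y = y \<oplus>\<^bsub>Loc\<^esub> x" "x \<otimes>\<^bsub>Loc\<^esub> y = y \<otimes>\<^bsub>Loc\<^esub> x"
    using x y by (simp_all add: m_comm a_comm)
  show "(c \<odot>\<^bsub>Loc\<^esub> x) \<otimes>\<^bsub>Loc\<^esub> y = c \<odot>\<^bsub>Loc\<^esub> (x \<otimes>\<^bsub>Loc\<^esub> y)"
    "c \<odot>\<^bsub>Loc\<^esub> (x \<oplus>\<^bsub>Loc\<^esub> y) = c \<odot>\<^bsub>Loc\<^esub> x \<oplus>\<^bsub>Loc\<^esub> c \<odot>\<^bsub>Loc\<^esub> y"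
    if "c \<in> carrier K" for c
    using that x y by (simp_all add: smult_assoc2 smult_r_distr)
  fix z assume "z \<in> carrier Loc"
  then obtain e r where z: "e \<in> carrier A" "r \<in> S" "z = frac e r" by (rule Loc_cases)
  note c = x(1) x(2)[THEN S_closed] y(1) y(2)[THEN S_closed] z(1) z(2)[THEN S_closed]
  show "(x \<otimes>\<^bsub>Loc\<^esub> y) \<otimes>\<^bsub>Loc\<^esub> z = x \<otimes>\<^bsub>Loc\<^esub> (y \<otimes>\<^bsub>Loc\<^esub> z)"
    using x y z by (simp add: m_assoc)
  have "((a \<otimes> t \<oplus> b \<otimes> s) \<otimes> r \<oplus> e \<otimes> (s \<otimes> t)) \<otimes> (s \<otimes> (t \<otimes> r))
      = (a \<otimes> (t \<otimes> r) \<oplus> (b \<otimes> r \<oplus> e \<otimes> t) \<otimes> s) \<otimes> (s \<otimes> t \<otimes> r)"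
    using c by algebra
  then have "frac ((a \<otimes> t \<oplus> b \<otimes> s) \<otimes> r \<oplus> e \<otimes> (s \<otimes> t)) (s \<otimes> t \<otimes> r)
      = frac (a \<otimes> (t \<otimes> r) \<oplus> (b \<otimes> r \<oplus> e \<otimes> t) \<otimes> s) (s \<otimes> (t \<otimes> r))"
    by (rule frac_eqI[rotated -1]) (use x y z in simp_all)
  then show "(x \<oplus>\<^bsub>Loc\<^esub> y) \<oplus>\<^bsub>Loc\<^esub> z = x \<oplus>\<^bsub>Loc\<^esub> (y \<oplus>\<^bsub>Loc\<^esub> z)"
    using x y z by simp
  have "(a \<otimes> t \<oplus> b \<otimes> s) \<otimes> e \<otimes> ((s \<otimes> r) \<otimes> (t \<otimes> r))
      = (a \<otimes> e \<otimes> (t \<otimes> r) \<oplus> b \<otimes> e \<otimes> (s \<otimes> r)) \<otimes> (s \<otimes> t \<otimes> r)"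
    using c by algebra
  then have "frac ((a \<otimes> t \<oplus> b \<otimes> s) \<otimes> e) (s \<otimes> t \<otimes> r)
      = frac (a \<otimes> e \<otimes> (t \<otimes> r) \<oplus> b \<otimes> e \<otimes> (s \<otimes> r)) ((s \<otimes> r) \<otimes> (t \<otimes> r))"
    by (rule frac_eqI[rotated -1]) (use x y z in simp_all)
  then show "(x \<oplus>\<^bsub>Loc\<^esub> y) \<otimes>\<^bsub>Loc\<^esub> z = x \<otimes>\<^bsub>Loc\<^esub> z \<oplus>\<^bsub>Loc\<^esub> y \<otimes>\<^bsub>Loc\<^esub> z"
    using x y z by simp
qed

sublocale Loc: algebra K "localisation A S"
  by (rule algebra_Loc)

section \<open>Units and common denominators in a localisation\<close>

lemma frac_one_hom: "(\<lambda>a. frac a \<one>) \<in> alg_hom K A Loc"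
  unfolding alg_hom_def
  by (simp add: ring_hom_memI frac_closed one_S frac_mult frac_add frac_smult one_Loc)

lemma frac_eq_zero_iff:
  assumes "a \<in> carrier A" "s \<in> S"
  shows "frac a s = \<zero>\<^bsub>Loc\<^esub> \<longleftrightarrow> (\<exists>u \<in> S. u \<otimes> a = \<zero>)"
  using assms one_S by (simp add: zero_Loc frac_eq_iff)

lemma frac_unit:
  assumes "s \<in> S" "t \<in> S"
  shows "frac s t \<in> Units Loc"
proof -
  have "frac s t \<otimes>\<^bsub>Loc\<^esub> frac t s = \<one>\<^bsub>Loc\<^esub>" "frac t s \<otimes>\<^bsub>Loc\<^esub> frac s t = \<one>\<^bsub>Loc\<^esub>"
    by (simp_all add: assms frac_mult one_Loc, (rule frac_eqI, simp_all add: assms one_S mult_S m_comm)+)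
  moreover have "frac s t \<in> carrier Loc" "frac t s \<in> carrier Loc" using assms by auto
  ultimately show ?thesis unfolding Units_def by blast
qed

text \<open>A single \<open>c\<close> for the whole tuple is required, because homogeneity responds
  only to scaling all coordinates by the same element.\<close>

lemma common_denominator:
  assumes "finite I" "v \<in> I \<rightarrow> carrier Loc"
  shows "\<exists>c \<in> S. \<exists>a \<in> I \<rightarrow> carrier A. \<forall>i \<in> I. frac c \<one> \<otimes>\<^bsub>Loc\<^esub> v i = frac (a i) \<one>"
  using assms
proof (induction I rule: finite_induct)
  case empty
  then show ?case using one_S by auto
next
  case (insert i I)
  then obtain c a where c: "c \<in> S" and a: "a \<in> I \<rightarrow> carrier A"
    and eq: "\<And>j. j \<in> I \<Longrightarrow> frac c \<one> \<otimes>\<^bsub>Loc\<^esub> v j = frac (a j) \<one>" by auto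
  have "v i \<in> carrier Loc" using insert.prems by auto
  then obtain b t where b: "b \<in> carrier A" "t \<in> S" "v i = frac b t" by (rule Loc_cases)
  \<comment> \<open>The new coordinate is \<open>b/t\<close> and the new denominator
    \<open>c t\<close>: the old numerators gain the factor \<open>t\<close>, the new one gains
    \<open>c\<close>.\<close>
  let ?a = "\<lambda>j. if j = i then c \<otimes> b else t \<otimes> a j"
  have "frac (c \<otimes> t) \<one> \<otimes>\<^bsub>Loc\<^esub> v j = frac (?a j) \<one>" if j: "j \<in> insert i I" for j
  proof (cases "j = i")
    case True
    then show ?thesis
      using b c one_S mult_S by (simp add: frac_mult) (rule frac_eqI, simp_all add: m_ac)
  next
    case False
    then have j: "j \<in> I" using j by simp
    have "v j \<in> carrier Loc" "a j \<in> carrier A" using insert.prems a j by auto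
    then have "frac (c \<otimes> t) \<one> \<otimes>\<^bsub>Loc\<^esub> v j = frac t \<one> \<otimes>\<^bsub>Loc\<^esub> (frac c \<one> \<otimes>\<^bsub>Loc\<^esub> v j)"
      using b(2) c one_S frac_mult[of t \<one> c \<one>] by (simp add: Loc.m_assoc[symmetric] frac_closed m_comm)
    also have "\<dots> = frac (t \<otimes> a j) \<one>"
      using b(2) one_S \<open>a j \<in> carrier A\<close> by (simp add: eq[OF j] frac_mult)
    finally show ?thesis using False by simp
  qed
  moreover have "?a \<in> insert i I \<rightarrow> carrier A" using a b c by (auto simp: Pi_iff)
  ultimately show ?case
    by (intro bexI[OF _ mult_S[OF c b(2)]] bexI[of _ ?a] ballI)
qed

text \<open>By homogeneity the denominators leave the polynomial as one power of \<open>c\<close>,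
  and what remains is a polynomial value in A itself.\<close>

lemma alg_eval_common_denominator:
  assumes P: "P \<in> ring.indexed_pset K I (carrier K)" and d: "\<And>m. P m \<noteq> \<zero>\<^bsub>K\<^esub> \<Longrightarrow> size m = d"
    and v: "v \<in> I \<rightarrow> carrier Loc" and c: "c \<in> S" and a: "a \<in> I \<rightarrow> carrier A"
    and eq: "\<And>i. i \<in> I \<Longrightarrow> frac c \<one> \<otimes>\<^bsub>Loc\<^esub> v i = frac (a i) \<one>"
  shows "frac c \<one> [^]\<^bsub>Loc\<^esub> d \<otimes>\<^bsub>Loc\<^esub> alg_eval K Loc P v = frac (alg_eval K A P a) \<one>"
proof -
  have c': "frac c \<one> \<in> carrier Loc" using c one_S by auto
  then have cv: "(\<lambda>i. frac c \<one> \<otimes>\<^bsub>Loc\<^esub> v i) \<in> I \<rightarrow> carrier Loc" using v by auto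
  have "frac c \<one> [^]\<^bsub>Loc\<^esub> d \<otimes>\<^bsub>Loc\<^esub> alg_eval K Loc P v
      = alg_eval K Loc P (\<lambda>i. frac c \<one> \<otimes>\<^bsub>Loc\<^esub> v i)"
    by (rule Loc.alg_eval_scale_homogeneous[OF P d v c', symmetric])
  also have "\<dots> = alg_eval K Loc P (\<lambda>i. frac (a i) \<one>)"
    by (rule Loc.alg_eval_cong[OF P cv eq])
  also have "\<dots> = frac (alg_eval K A P a) \<one>"
    by (rule alg_eval_hom[OF _ algebra_Loc frac_one_hom P a, symmetric]) unfold_locales
  finally show ?thesis .
qed

end

section \<open>Stalks and sections\<close>

locale special_field_algebra = field_algebra K A
  for K :: "('k, 'l) ring_scheme" and A :: "('k, 'a, 'm) module_scheme" (structure) +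
  assumes special_zero: "special_ideal K A {\<zero>}"
begin

text \<open>After clearing denominators, \<open>P(v) = 0\<close> says that some \<open>u\<close> in
  \<open>S\<close> annihilates \<open>P(a)\<close>. Scaling by \<open>u\<close> gives an honest zero
  \<open>P(u a)\<close> in A, so \<open>u a_0 = 0\<close>; hence \<open>c v_0 = a_0/1\<close> is
  zero, and \<open>c\<close> is a unit.\<close>

lemma special_localisation:
  assumes "mult_subset K A S"
  shows "special_algebra K (localisation A S)"
proof -
  interpret mult_subset K A S by fact
  interpret L: field_algebra K Loc by unfold_locales
  have "special_ideal K Loc {\<zero>\<^bsub>Loc\<^esub>}"
  proof (rule L.special_idealI[OF Loc.zeroideal])
    fix n P d v assume P: "P \<in> homogeneous_signature K n"
      and d: "\<And>m. P m \<noteq> \<zero>\<^bsub>K\<^esub> \<Longrightarrow> size m = Suc d" and v: "v \<in> {0..n} \<rightarrow> carrier Loc"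
      and Pv: "alg_eval K Loc P v \<in> {\<zero>\<^bsub>Loc\<^esub>}"
    have polys: "P \<in> polys {0..n}" using P by (simp add: homogeneous_signature_def)
    obtain c a where c: "c \<in> S" and a: "a \<in> {0..n} \<rightarrow> carrier A"
      and eq: "\<And>i. i \<in> {0..n} \<Longrightarrow> frac c \<one> \<otimes>\<^bsub>Loc\<^esub> v i = frac (a i) \<one>"
      using common_denominator[OF _ v] by auto
    have c': "frac c \<one> \<in> Units Loc" by (rule frac_unit[OF c one_S])
    have "frac (alg_eval K A P a) \<one> = \<zero>\<^bsub>Loc\<^esub>"
      using alg_eval_common_denominator[OF polys d v c a eq] Pv Loc.Units_closed[OF c'] by simp
    then obtain u where u: "u \<in> S" "u \<otimes> alg_eval K A P a = \<zero>"
      using frac_eq_zero_iff[OF alg_eval_closed[OF polys a] one_S] by auto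
    \<comment> \<open>The degree is \<open>Suc d\<close>, so one factor \<open>u\<close> remains
      next to \<open>P(a)\<close> to annihilate it.\<close>
    have "alg_eval K A P (\<lambda>i. u \<otimes> a i) = u [^] d \<otimes> (u \<otimes> alg_eval K A P a)"
      using alg_eval_scale_homogeneous[OF polys d a, of u] u(1) alg_eval_closed[OF polys a]
      by (simp add: m_assoc)
    then have "alg_eval K A P (\<lambda>i. u \<otimes> a i) \<in> {\<zero>}" using u by simp
    moreover have "(\<lambda>i. u \<otimes> a i) \<in> {0..n} \<rightarrow> carrier A" using a u(1) by (simp add: Pi_iff)
    ultimately have "u \<otimes> a 0 = \<zero>" using special_ideal_zero_closed[OF special_zero P] by blast
    then have "frac (a 0) \<one> = \<zero>\<^bsub>Loc\<^esub>"
      using frac_eq_zero_iff[of "a 0" \<one>] funcset_mem[OF a, of 0] one_S u(1) by auto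
    then have "frac c \<one> \<otimes>\<^bsub>Loc\<^esub> v 0 = frac c \<one> \<otimes>\<^bsub>Loc\<^esub> \<zero>\<^bsub>Loc\<^esub>"
      using eq[of 0] Loc.Units_closed[OF c'] by simp
    then show "v 0 \<in> {\<zero>\<^bsub>Loc\<^esub>}"
      using Loc.Units_l_cancel[OF c', of "v 0" "\<zero>\<^bsub>Loc\<^esub>"] funcset_mem[OF v, of 0] by simp
  qed
  then show ?thesis
    using algebra_Loc by (simp add: special_algebra_def)
qed

section \<open>Arithmetic in the stalks at special primes\<close>

abbreviation "Spec \<equiv> Spec2 K A"
abbreviation "sf \<equiv> stalk_fraction A"

lemma Spec2_prime: "p \<in> Spec \<Longrightarrow> primeideal p A"
  by (simp add: Spec2_def)

lemma Spec2_special: "p \<in> Spec \<Longrightarrow> special_ideal K A p"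
  by (simp add: Spec2_def)

lemma stalk_mult_subset:
  assumes "p \<in> Spec"
  shows "mult_subset K A (carrier A - p)"
proof (unfold_locales)
  show "carrier A - p \<subseteq> carrier A" by blast
  show "\<one> \<in> carrier A - p" using Spec2_one_notin[OF assms] by simp
  show "s \<otimes> t \<in> carrier A - p" if "s \<in> carrier A - p" "t \<in> carrier A - p" for s t
    using primeideal.I_prime[OF Spec2_prime[OF assms], of s t] that by auto
qed

context
  fixes p assumes p: "p \<in> Spec"
begin

interpretation loc: mult_subset K A "carrier A - p"
  by (rule stalk_mult_subset[OF p])

lemma algebra_stalk: "algebra K (stalk A p)"
  unfolding stalk_def by (rule loc.algebra_Loc)

lemma special_stalk: "special_algebra K (stalk A p)"
  unfolding stalk_def by (rule special_localisation[OF stalk_mult_subset[OF p]])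

lemma sf_closed: "a \<in> carrier A \<Longrightarrow> b \<in> carrier A \<Longrightarrow> b \<notin> p \<Longrightarrow> sf p a b \<in> carrier (stalk A p)"
  unfolding stalk_def stalk_fraction_def by (rule loc.frac_closed) auto

lemma stalk_cases:
  assumes "x \<in> carrier (stalk A p)"
  obtains a b where "a \<in> carrier A" "b \<in> carrier A" "b \<notin> p" "x = sf p a b"
proof -
  from assms obtain a s where "a \<in> carrier A" "s \<in> carrier A - p" "x = loc.frac a s"
    unfolding stalk_def by (rule loc.Loc_cases)
  then show thesis using that[of a s] by (simp add: stalk_fraction_def)
qed

lemma sf_eq_iff:
  assumes "a \<in> carrier A" "b \<in> carrier A" "b \<notin> p" "c \<in> carrier A" "d \<in> carrier A" "d \<notin> p"
  shows "sf p a b = sf p c d \<longleftrightarrow> (\<exists>u \<in> carrier A. u \<notin> p \<and> u \<otimes> (a \<otimes> d) = u \<otimes> (c \<otimes> b))"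
  unfolding stalk_fraction_def using loc.frac_eq_iff[of a b c d] assms by auto

lemma sf_eqI:
  assumes "a \<in> carrier A" "b \<in> carrier A" "b \<notin> p" "c \<in> carrier A" "d \<in> carrier A" "d \<notin> p"
    "a \<otimes> d = c \<otimes> b"
  shows "sf p a b = sf p c d"
  unfolding stalk_fraction_def using assms by (intro loc.frac_eqI) auto

lemma sf_mult:
  assumes "a \<in> carrier A" "b \<in> carrier A" "b \<notin> p" "c \<in> carrier A" "d \<in> carrier A" "d \<notin> p"
  shows "sf p a b \<otimes>\<^bsub>stalk A p\<^esub> sf p c d = sf p (a \<otimes> c) (b \<otimes> d)"
  unfolding stalk_def stalk_fraction_def using assms by (intro loc.frac_mult) auto

lemma sf_add:
  assumes "a \<in> carrier A" "b \<in> carrier A" "b \<notin> p" "c \<in> carrier A" "d \<in> carrier A" "d \<notin> p"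
  shows "sf p a b \<oplus>\<^bsub>stalk A p\<^esub> sf p c d = sf p (a \<otimes> d \<oplus> c \<otimes> b) (b \<otimes> d)"
  unfolding stalk_def stalk_fraction_def using assms by (intro loc.frac_add) auto

lemma sf_smult:
  assumes "c \<in> carrier K" "a \<in> carrier A" "b \<in> carrier A" "b \<notin> p"
  shows "c \<odot>\<^bsub>stalk A p\<^esub> sf p a b = sf p (c \<odot> a) b"
  unfolding stalk_def stalk_fraction_def using assms by (intro loc.frac_smult) auto

lemma one_stalk: "\<one>\<^bsub>stalk A p\<^esub> = sf p \<one> \<one>" and zero_stalk: "\<zero>\<^bsub>stalk A p\<^esub> = sf p \<zero> \<one>"
  unfolding stalk_def stalk_fraction_def by (rule loc.one_Loc loc.zero_Loc)+

lemma mult_notin: "a \<in> carrier A \<Longrightarrow> b \<in> carrier A \<Longrightarrow> a \<notin> p \<Longrightarrow> b \<notin> p \<Longrightarrow> a \<otimes> b \<notin> p"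
  using loc.mult_S[of a b] by simp

lemma one_notin: "\<one> \<notin> p"
  by (rule Spec2_one_notin[OF p])

lemma in_prime_mult: "a \<in> p \<Longrightarrow> b \<in> carrier A \<Longrightarrow> b \<otimes> a \<in> p" "a \<in> p \<Longrightarrow> b \<in> carrier A \<Longrightarrow> a \<otimes> b \<in> p"
  using ideal.I_l_closed[OF primeideal.axioms(1)[OF Spec2_prime[OF p]]]
    ideal.I_r_closed[OF primeideal.axioms(1)[OF Spec2_prime[OF p]]] by blast+

text \<open>An inverse \<open>c/d\<close> gives \<open>u a c = u b d\<close> for some
  \<open>u\<close> outside \<open>p\<close>. The right-hand side is outside \<open>p\<close> by
  primality, so \<open>a\<close> must be as well. This direction is what makes pointwise inverses of
  sections locally fractions.\<close>

lemma sf_unit_iff: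
  assumes "a \<in> carrier A" "b \<in> carrier A" "b \<notin> p"
  shows "sf p a b \<in> Units (stalk A p) \<longleftrightarrow> a \<notin> p"
proof
  assume "a \<notin> p"
  then show "sf p a b \<in> Units (stalk A p)"
    unfolding stalk_def stalk_fraction_def using assms by (intro loc.frac_unit) auto
next
  assume "sf p a b \<in> Units (stalk A p)"
  then obtain x where x: "x \<in> carrier (stalk A p)" "sf p a b \<otimes>\<^bsub>stalk A p\<^esub> x = \<one>\<^bsub>stalk A p\<^esub>"
    unfolding Units_def by blast
  obtain c d where cd: "c \<in> carrier A" "d \<in> carrier A" "d \<notin> p" "x = sf p c d"
    using x(1) by (rule stalk_cases)
  have "sf p (a \<otimes> c) (b \<otimes> d) = sf p \<one> \<one>"
    using x(2) cd assms by (simp add: sf_mult one_stalk)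
  then obtain u where u: "u \<in> carrier A" "u \<notin> p" "u \<otimes> (a \<otimes> c \<otimes> \<one>) = u \<otimes> (\<one> \<otimes> (b \<otimes> d))"
    using cd assms mult_notin one_notin sf_eq_iff[of "a \<otimes> c" "b \<otimes> d" \<one> \<one>] by auto
  show "a \<notin> p"
  proof
    assume "a \<in> p"
    then have "u \<otimes> (a \<otimes> c \<otimes> \<one>) \<in> p" using u(1) cd(1) by (intro in_prime_mult) auto
    then have "u \<otimes> (b \<otimes> d) \<in> p" using u(3) assms cd by simp
    then show False using mult_notin[of u "b \<otimes> d"] mult_notin[of b d] u assms cd by simp
  qed
qed

text \<open>With \<open>P\<close> the homogenisation of \<open>D\<close> and a common denominator
  \<open>c\<close>, the element \<open>c^d D(v)\<close> equals \<open>P(a)/1\<close>. Specialness of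
  \<open>p\<close> makes the numerator avoid \<open>p\<close> once \<open>a 0\<close> does, so
  \<open>D(v)\<close> divides a unit.\<close>

lemma star_stalk:
  assumes D: "D \<in> algebraic_signature K n" and v: "v \<in> {1..n} \<rightarrow> carrier (stalk A p)"
  shows "alg_eval K (stalk A p) D v \<in> Units (stalk A p)"
proof -
  interpret L: algebra K "stalk A p" by (rule algebra_stalk)
  interpret L: field_algebra K "stalk A p" by unfold_locales
  obtain P where P: "P \<in> homogeneous_signature K n"
    and PD: "alg_eval K (stalk A p) P (v(0 := \<one>\<^bsub>stalk A p\<^esub>)) = alg_eval K (stalk A p) D v"
    using L.homogenise_signature[OF D] v by metis
  let ?v = "v(0 := \<one>\<^bsub>stalk A p\<^esub>)"
  have v': "?v \<in> {0..n} \<rightarrow> carrier (stalk A p)" using v by (auto simp: Pi_iff)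
  from P obtain d where polys: "P \<in> polys {0..n}" and d: "\<And>m. P m \<noteq> \<zero>\<^bsub>K\<^esub> \<Longrightarrow> size m = d"
    unfolding homogeneous_signature_def by blast
  obtain c a where c: "c \<in> carrier A - p" and a: "a \<in> {0..n} \<rightarrow> carrier A"
    and eq: "\<And>i. i \<in> {0..n} \<Longrightarrow> sf p c \<one> \<otimes>\<^bsub>stalk A p\<^esub> ?v i = sf p (a i) \<one>"
    using loc.common_denominator[of "{0..n}" ?v] v' unfolding stalk_def stalk_fraction_def by blast
  have c': "sf p c \<one> \<in> carrier (stalk A p)" using c one_notin by (intro sf_closed) auto
  have "sf p c \<one> [^]\<^bsub>stalk A p\<^esub> d \<otimes>\<^bsub>stalk A p\<^esub> alg_eval K (stalk A p) P ?v
      = sf p (alg_eval K A P a) \<one>"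
    using loc.alg_eval_common_denominator[OF polys d _ c a, of ?v] v' eq
    unfolding stalk_def stalk_fraction_def by simp
  moreover have "sf p (alg_eval K A P a) \<one> \<in> Units (stalk A p)"
  proof -
    \<comment> \<open>The \<open>Y\<close> coordinate of \<open>?v\<close> is 1, so clearing
      denominators turns it into \<open>c\<close>, at least as a fraction: \<open>a 0\<close> need
      not equal \<open>c\<close>, but both are units in the stalk.\<close>
    have "sf p c \<one> = sf p (a 0) \<one>"
      using eq[of 0] c' by simp
    then have "a 0 \<notin> p"
      using c one_notin sf_unit_iff[of c \<one>] sf_unit_iff[of "a 0" \<one>] funcset_mem[OF a, of 0] by simp
    then have "alg_eval K A P a \<notin> p"
      using special_ideal_zero_closed[OF Spec2_special[OF p] P a] by blast
    then show ?thesis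
      using one_notin alg_eval_closed[OF polys a] by (simp add: sf_unit_iff)
  qed
  ultimately show ?thesis
    using L.prod_unit_r[of "alg_eval K (stalk A p) D v" "sf p c \<one> [^]\<^bsub>stalk A p\<^esub> d"]
      c' L.alg_eval_closed[OF polys v'] PD c one_notin sf_unit_iff[of c \<one>]
      L.Units_pow_closed[of "sf p c \<one>" d]
    by (simp add: L.m_comm)
qed

end

section \<open>Rings of sections\<close>

lemma openin_subset_X: "openin (zariski K A) U \<Longrightarrow> U \<subseteq> Spec"
  using openin_subset topspace_zariski[OF is_cring] by metis

abbreviation "\<O> \<equiv> structure_sheaf K A"

text \<open>That values lie in the stalks follows from the local fractions, so it does not have to
  be checked separately.\<close>

lemma sectionI:
  assumes ext: "s \<in> extensional U" and U: "U \<subseteq> Spec"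
    and loc: "\<And>p. p \<in> U \<Longrightarrow> \<exists>a b U'. a \<in> carrier A \<and> b \<in> carrier A \<and> openin (zariski K A) U' \<and>
      U' \<subseteq> U \<and> p \<in> U' \<and> (\<forall>q \<in> U'. b \<notin> q \<and> s q = sf q a b)"
  shows "s \<in> carrier (\<O> U)"
proof -
  have "s p \<in> carrier (stalk A p)" if "p \<in> U" for p
  proof -
    from loc[OF that] obtain a b where "a \<in> carrier A" "b \<in> carrier A" "b \<notin> p" "s p = sf p a b"
      by metis
    then show ?thesis using that U by (simp add: sf_closed subset_iff)
  qed
  then have "s \<in> (\<Pi>\<^sub>E p \<in> U. carrier (stalk A p))" using ext by (simp add: PiE_def)
  moreover have "\<forall>p \<in> U. \<exists>a \<in> carrier A. \<exists>b \<in> carrier A. \<exists>U'. openin (zariski K A) U' \<and> U' \<subseteq> U \<and> p \<in> U' \<and>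
      (\<forall>q \<in> U'. b \<notin> q \<and> s q = sf q a b)"
    using loc by (metis (no_types, lifting))
  ultimately show ?thesis by (simp add: structure_sheaf_def)
qed

lemma sectionE:
  assumes "s \<in> carrier (\<O> U)" "p \<in> U"
  obtains a b U' where "a \<in> carrier A" "b \<in> carrier A" "openin (zariski K A) U'" "U' \<subseteq> U" "p \<in> U'"
    "\<And>q. q \<in> U' \<Longrightarrow> b \<notin> q" "\<And>q. q \<in> U' \<Longrightarrow> s q = sf q a b"
  using assms by (auto simp: structure_sheaf_def)

lemma section_ext: "s \<in> carrier (\<O> U) \<Longrightarrow> s \<in> extensional U"
  by (auto simp: structure_sheaf_def PiE_def)

lemma section_closed: "s \<in> carrier (\<O> U) \<Longrightarrow> p \<in> U \<Longrightarrow> s p \<in> carrier (stalk A p)"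
  by (auto simp: structure_sheaf_def)

lemma section_eqI:
  assumes "s \<in> carrier (\<O> U)" "t \<in> carrier (\<O> U)" "\<And>p. p \<in> U \<Longrightarrow> s p = t p"
  shows "s = t"
  using extensionalityI[OF section_ext[OF assms(1)] section_ext[OF assms(2)]] assms(3) by blast

lemma section_fraction:
  assumes U: "openin (zariski K A) U" and ab: "a \<in> carrier A" "b \<in> carrier A"
    and b: "\<And>p. p \<in> U \<Longrightarrow> b \<notin> p"
  shows "(\<lambda>p \<in> U. sf p a b) \<in> carrier (\<O> U)"
proof (rule sectionI)
  show "\<exists>a' b' U'. a' \<in> carrier A \<and> b' \<in> carrier A \<and> openin (zariski K A) U' \<and> U' \<subseteq> U \<and> p \<in> U' \<and>
      (\<forall>q \<in> U'. b' \<notin> q \<and> (\<lambda>p \<in> U. sf p a b) q = sf q a' b')" if "p \<in> U" for p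
    using that assms by (intro exI[of _ a] exI[of _ b] exI[of _ U]) auto
qed (use openin_subset_X[OF U] in auto)

text \<open>Sum and product of \<open>a/b\<close> and \<open>c/d\<close> share the denominator
  \<open>b d\<close> and differ only in the numerator \<open>g\<close>. Both are treated at once, on
  the intersection of the two neighbourhoods.\<close>

lemma section_binary:
  assumes s: "s \<in> carrier (\<O> U)" and t: "t \<in> carrier (\<O> U)" and U: "U \<subseteq> Spec"
    and op: "\<And>q a b c d. q \<in> Spec \<Longrightarrow> a \<in> carrier A \<Longrightarrow> b \<in> carrier A \<Longrightarrow> b \<notin> q \<Longrightarrow>
      c \<in> carrier A \<Longrightarrow> d \<in> carrier A \<Longrightarrow> d \<notin> q \<Longrightarrow>
      f q (sf q a b) (sf q c d) = sf q (g a b c d) (b \<otimes> d)"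
    and g: "\<And>a b c d. a \<in> carrier A \<Longrightarrow> b \<in> carrier A \<Longrightarrow> c \<in> carrier A \<Longrightarrow> d \<in> carrier A \<Longrightarrow>
      g a b c d \<in> carrier A"
  shows "(\<lambda>p \<in> U. f p (s p) (t p)) \<in> carrier (\<O> U)"
proof (rule sectionI[OF _ U])
  fix p assume p: "p \<in> U"
  obtain a b V where ab: "a \<in> carrier A" "b \<in> carrier A" "openin (zariski K A) V" "V \<subseteq> U" "p \<in> V"
    "\<And>q. q \<in> V \<Longrightarrow> b \<notin> q" "\<And>q. q \<in> V \<Longrightarrow> s q = sf q a b"
    by (rule sectionE[OF s p]) (rule that)
  obtain c d W where cd: "c \<in> carrier A" "d \<in> carrier A" "openin (zariski K A) W" "W \<subseteq> U" "p \<in> W"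
    "\<And>q. q \<in> W \<Longrightarrow> d \<notin> q" "\<And>q. q \<in> W \<Longrightarrow> t q = sf q c d"
    by (rule sectionE[OF t p]) (rule that)
  have "b \<otimes> d \<notin> q \<and> (\<lambda>p \<in> U. f p (s p) (t p)) q = sf q (g a b c d) (b \<otimes> d)" if "q \<in> V \<inter> W" for q
  proof -
    have q: "q \<in> V" "q \<in> W" "q \<in> U" "q \<in> Spec" using that ab(4) U by auto
    then have "b \<otimes> d \<notin> q" using mult_notin[OF q(4) ab(2) cd(2)] ab(6) cd(6) by blast
    moreover have "f q (s q) (t q) = sf q (g a b c d) (b \<otimes> d)"
      unfolding ab(7)[OF q(1)] cd(7)[OF q(2)]
      by (rule op[OF q(4) ab(1,2) ab(6)[OF q(1)] cd(1,2) cd(6)[OF q(2)]])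
    ultimately show ?thesis using q(3) by simp
  qed
  moreover have "V \<inter> W \<subseteq> U" "p \<in> V \<inter> W" "openin (zariski K A) (V \<inter> W)"
    using ab cd by auto
  ultimately show "\<exists>a b U'. a \<in> carrier A \<and> b \<in> carrier A \<and> openin (zariski K A) U' \<and> U' \<subseteq> U \<and> p \<in> U' \<and>
      (\<forall>q \<in> U'. b \<notin> q \<and> (\<lambda>p \<in> U. f p (s p) (t p)) q = sf q a b)"
    using g[OF ab(1,2) cd(1,2)] ab(2) cd(2)
    by (intro exI[of _ "g a b c d"] exI[of _ "b \<otimes> d"] exI[of _ "V \<inter> W"] conjI ballI) simp_all
qed simp

lemma section_mult_closed:
  assumes "s \<in> carrier (\<O> U)" "t \<in> carrier (\<O> U)" "U \<subseteq> Spec"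
  shows "s \<otimes>\<^bsub>\<O> U\<^esub> t \<in> carrier (\<O> U)"
  using section_binary[OF assms, of "\<lambda>p. (\<otimes>\<^bsub>stalk A p\<^esub>)" "\<lambda>a b c d. a \<otimes> c"]
  by (simp add: sf_mult structure_sheaf_def)

lemma section_add_closed:
  assumes "s \<in> carrier (\<O> U)" "t \<in> carrier (\<O> U)" "U \<subseteq> Spec"
  shows "s \<oplus>\<^bsub>\<O> U\<^esub> t \<in> carrier (\<O> U)"
  using section_binary[OF assms, of "\<lambda>p. (\<oplus>\<^bsub>stalk A p\<^esub>)" "\<lambda>a b c d. a \<otimes> d \<oplus> c \<otimes> b"]
  by (simp add: sf_add structure_sheaf_def)

lemma section_smult_closed:
  assumes "c \<in> carrier K" "s \<in> carrier (\<O> U)" "U \<subseteq> Spec"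
  shows "c \<odot>\<^bsub>\<O> U\<^esub> s \<in> carrier (\<O> U)"
proof -
  have "(\<lambda>p \<in> U. c \<odot>\<^bsub>stalk A p\<^esub> s p) \<in> carrier (\<O> U)"
  proof (rule sectionI[OF _ assms(3)])
    fix p assume "p \<in> U"
    with assms(2) obtain a b V where ab: "a \<in> carrier A" "b \<in> carrier A" "openin (zariski K A) V"
      "V \<subseteq> U" "p \<in> V" "\<And>q. q \<in> V \<Longrightarrow> b \<notin> q" "\<And>q. q \<in> V \<Longrightarrow> s q = sf q a b"
      by (rule sectionE) (rule that)
    have "b \<notin> q \<and> (\<lambda>p \<in> U. c \<odot>\<^bsub>stalk A p\<^esub> s p) q = sf q (c \<odot> a) b" if "q \<in> V" for q
      using ab(4) assms(1,3) that ab(6,7)[OF that] sf_smult[OF _ assms(1) ab(1,2), of q] by auto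
    then show "\<exists>a b U'. a \<in> carrier A \<and> b \<in> carrier A \<and> openin (zariski K A) U' \<and> U' \<subseteq> U \<and> p \<in> U' \<and>
      (\<forall>q \<in> U'. b \<notin> q \<and> (\<lambda>p \<in> U. c \<odot>\<^bsub>stalk A p\<^esub> s p) q = sf q a b)"
      using ab(1-5) assms(1)
      by (intro exI[of _ "c \<odot> a"] exI[of _ b] exI[of _ V] conjI ballI) simp_all
  qed simp
  then show ?thesis by (simp add: structure_sheaf_def)
qed

lemma section_ops:
  assumes "p \<in> U"
  shows "(s \<otimes>\<^bsub>\<O> U\<^esub> t) p = s p \<otimes>\<^bsub>stalk A p\<^esub> t p" "(s \<oplus>\<^bsub>\<O> U\<^esub> t) p = s p \<oplus>\<^bsub>stalk A p\<^esub> t p"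
    "(c \<odot>\<^bsub>\<O> U\<^esub> s) p = c \<odot>\<^bsub>stalk A p\<^esub> s p"
    "\<one>\<^bsub>\<O> U\<^esub> p = \<one>\<^bsub>stalk A p\<^esub>" "\<zero>\<^bsub>\<O> U\<^esub> p = \<zero>\<^bsub>stalk A p\<^esub>"
  using assms by (simp_all add: structure_sheaf_def)

lemma section_one_zero_closed:
  assumes U: "openin (zariski K A) U"
  shows "\<one>\<^bsub>\<O> U\<^esub> \<in> carrier (\<O> U)" "\<zero>\<^bsub>\<O> U\<^esub> \<in> carrier (\<O> U)"
proof -
  have UX: "U \<subseteq> Spec" by (rule openin_subset_X[OF U])
  have "\<one>\<^bsub>\<O> U\<^esub> = (\<lambda>p \<in> U. sf p \<one> \<one>)" "\<zero>\<^bsub>\<O> U\<^esub> = (\<lambda>p \<in> U. sf p \<zero> \<one>)"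
    using UX by (auto simp: structure_sheaf_def one_stalk zero_stalk intro!: restrict_ext)
  then show "\<one>\<^bsub>\<O> U\<^esub> \<in> carrier (\<O> U)" "\<zero>\<^bsub>\<O> U\<^esub> \<in> carrier (\<O> U)"
    using section_fraction[OF U, of \<one> \<one>] section_fraction[OF U, of \<zero> \<one>] one_notin UX by auto
qed

lemma algebra_sections:
  assumes U: "openin (zariski K A) U"
  shows "algebra K (\<O> U)"
proof -
  have UX: "U \<subseteq> Spec" by (rule openin_subset_X[OF U])
  have stalk: "algebra K (stalk A p)" if "p \<in> U" for p
    using algebra_stalk UX that by blast
  note closed = section_mult_closed[OF _ _ UX] section_add_closed[OF _ _ UX]
    section_smult_closed[OF _ _ UX] section_one_zero_closed[OF U]
  note cring = algebra.M_cring[OF stalk]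
  note ring = cring.axioms(1)[OF cring]
  note agrp = ring.is_abelian_group[OF ring]
  note amon = abelian_group.axioms(1)[OF agrp]
  note cmon = cring.axioms(2)[OF cring]
  note mon = comm_monoid.axioms(1)[OF cmon]
  show ?thesis
  proof (intro algebraI[OF K.is_cring] cringI abelian_groupI comm_monoidI closed)
    fix x assume x: "x \<in> carrier (\<O> U)"
    note xp = section_closed[OF x]
    show "\<zero>\<^bsub>\<O> U\<^esub> \<oplus>\<^bsub>\<O> U\<^esub> x = x"
      by (rule section_eqI[OF _ x])
        (simp_all add: closed x section_ops abelian_monoid.l_zero[OF amon] xp)
    show "\<one>\<^bsub>\<O> U\<^esub> \<otimes>\<^bsub>\<O> U\<^esub> x = x"
      by (rule section_eqI[OF _ x])
        (simp_all add: closed x section_ops monoid.l_one[OF mon] xp)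
    show "\<one>\<^bsub>K\<^esub> \<odot>\<^bsub>\<O> U\<^esub> x = x"
      by (rule section_eqI[OF _ x])
        (simp_all add: closed x section_ops module.smult_one[OF algebra.module[OF stalk]] xp)
    \<comment> \<open>Writing the negative as a scalar multiple by -1 reduces closure under negation
      to closure under scalars.\<close>
    have "(\<ominus>\<^bsub>K\<^esub> \<one>\<^bsub>K\<^esub>) \<odot>\<^bsub>\<O> U\<^esub> x \<oplus>\<^bsub>\<O> U\<^esub> x = \<zero>\<^bsub>\<O> U\<^esub>"
    proof (rule section_eqI[of _ U])
      fix p assume p: "p \<in> U"
      interpret L: algebra K "stalk A p" by (rule stalk[OF p])
      show "((\<ominus>\<^bsub>K\<^esub> \<one>\<^bsub>K\<^esub>) \<odot>\<^bsub>\<O> U\<^esub> x \<oplus>\<^bsub>\<O> U\<^esub> x) p = \<zero>\<^bsub>\<O> U\<^esub> p"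
        using p xp[OF p] L.smult_l_minus[of "\<one>\<^bsub>K\<^esub>" "x p"] by (simp add: section_ops L.l_neg)
    qed (simp_all add: closed x)
    then show "\<exists>y \<in> carrier (\<O> U). y \<oplus>\<^bsub>\<O> U\<^esub> x = \<zero>\<^bsub>\<O> U\<^esub>"
      by (rule bexI[of _ "(\<ominus>\<^bsub>K\<^esub> \<one>\<^bsub>K\<^esub>) \<odot>\<^bsub>\<O> U\<^esub> x"]) (simp add: closed x)
    fix y assume y: "y \<in> carrier (\<O> U)"
    note yp = section_closed[OF y]
    show "x \<oplus>\<^bsub>\<O> U\<^esub> y = y \<oplus>\<^bsub>\<O> U\<^esub> x"
      by (rule section_eqI[of _ U])
        (simp_all add: closed x y section_ops abelian_monoid.a_comm[OF amon] xp yp)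
    show "x \<otimes>\<^bsub>\<O> U\<^esub> y = y \<otimes>\<^bsub>\<O> U\<^esub> x"
      by (rule section_eqI[of _ U])
        (simp_all add: closed x y section_ops comm_monoid.m_comm[OF cmon] xp yp)
    show "c \<odot>\<^bsub>\<O> U\<^esub> x \<otimes>\<^bsub>\<O> U\<^esub> y = c \<odot>\<^bsub>\<O> U\<^esub> (x \<otimes>\<^bsub>\<O> U\<^esub> y)" if "c \<in> carrier K" for c
      by (rule section_eqI[of _ U])
        (simp_all add: closed x y that section_ops algebra.smult_assoc2[OF stalk] xp yp)
    show "c \<odot>\<^bsub>\<O> U\<^esub> (x \<oplus>\<^bsub>\<O> U\<^esub> y) = c \<odot>\<^bsub>\<O> U\<^esub> x \<oplus>\<^bsub>\<O> U\<^esub> c \<odot>\<^bsub>\<O> U\<^esub> y" if "c \<in> carrier K" for c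
      by (rule section_eqI[of _ U])
        (simp_all add: closed x y that section_ops
          module.smult_r_distr[OF algebra.module[OF stalk]] xp yp)
    show "(c \<otimes>\<^bsub>K\<^esub> d) \<odot>\<^bsub>\<O> U\<^esub> x = c \<odot>\<^bsub>\<O> U\<^esub> (d \<odot>\<^bsub>\<O> U\<^esub> x)"
      if "c \<in> carrier K" "d \<in> carrier K" for c d
      by (rule section_eqI[of _ U])
        (simp_all add: closed x that section_ops
          module.smult_assoc1[OF algebra.module[OF stalk]] xp)
    show "(c \<oplus>\<^bsub>K\<^esub> d) \<odot>\<^bsub>\<O> U\<^esub> x = c \<odot>\<^bsub>\<O> U\<^esub> x \<oplus>\<^bsub>\<O> U\<^esub> d \<odot>\<^bsub>\<O> U\<^esub> x"
      if "c \<in> carrier K" "d \<in> carrier K" for c d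
      by (rule section_eqI[of _ U])
        (simp_all add: closed x that section_ops
          module.smult_l_distr[OF algebra.module[OF stalk]] xp)
    fix z assume z: "z \<in> carrier (\<O> U)"
    note zp = section_closed[OF z]
    show "x \<oplus>\<^bsub>\<O> U\<^esub> y \<oplus>\<^bsub>\<O> U\<^esub> z = x \<oplus>\<^bsub>\<O> U\<^esub> (y \<oplus>\<^bsub>\<O> U\<^esub> z)"
      by (rule section_eqI[of _ U])
        (simp_all add: closed x y z section_ops abelian_monoid.a_assoc[OF amon] xp yp zp)
    show "x \<otimes>\<^bsub>\<O> U\<^esub> y \<otimes>\<^bsub>\<O> U\<^esub> z = x \<otimes>\<^bsub>\<O> U\<^esub> (y \<otimes>\<^bsub>\<O> U\<^esub> z)"
      by (rule section_eqI[of _ U])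
        (simp_all add: closed x y z section_ops monoid.m_assoc[OF mon] xp yp zp)
    show "(x \<oplus>\<^bsub>\<O> U\<^esub> y) \<otimes>\<^bsub>\<O> U\<^esub> z = x \<otimes>\<^bsub>\<O> U\<^esub> z \<oplus>\<^bsub>\<O> U\<^esub> y \<otimes>\<^bsub>\<O> U\<^esub> z"
      by (rule section_eqI[of _ U])
        (simp_all add: closed x y z section_ops ring.ring_simprules(13)[OF ring] xp yp zp)
  qed
qed

text \<open>Hence polynomial values of sections can be computed stalk by stalk, which transfers
  specialness and invertibility from the stalks.\<close>

lemma evaluation_hom:
  assumes "p \<in> U"
  shows "(\<lambda>s. s p) \<in> alg_hom K (\<O> U) (stalk A p)"
  unfolding alg_hom_def using assms
  by (auto intro!: ring_hom_memI simp: section_ops section_closed)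

lemma special_sections:
  assumes U: "openin (zariski K A) U"
  shows "special_algebra K (\<O> U)"
  unfolding special_algebra_def special_ideal_def
proof (intro conjI allI ballI impI algebra_sections[OF U])
  interpret O: algebra K "\<O> U" by (rule algebra_sections[OF U])
  show "ideal {\<zero>\<^bsub>\<O> U\<^esub>} (\<O> U)" by (rule O.zeroideal)
  fix n P v assume P: "P \<in> homogeneous_signature K n" and v: "v \<in> {0..n} \<rightarrow> carrier (\<O> U)"
    and Pv: "alg_eval K (\<O> U) P v \<in> {\<zero>\<^bsub>\<O> U\<^esub>}"
  have polys: "P \<in> polys {0..n}" using P by (simp add: homogeneous_signature_def)
  have "v 0 = \<zero>\<^bsub>\<O> U\<^esub>"
  proof (rule section_eqI[of _ U])
    fix p assume p: "p \<in> U"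
    then have pX: "p \<in> Spec" using openin_subset_X[OF U] by blast
    have "alg_eval K (stalk A p) P (\<lambda>i. v i p) = alg_eval K (\<O> U) P v p"
      by (rule alg_eval_hom[OF algebra_sections[OF U] algebra_stalk[OF pX] evaluation_hom[OF p]
            polys v, symmetric])
    also have "\<dots> = \<zero>\<^bsub>stalk A p\<^esub>" using Pv p by (simp add: section_ops)
    finally have "alg_eval K (stalk A p) P (\<lambda>i. v i p) \<in> {\<zero>\<^bsub>stalk A p\<^esub>}" by simp
    moreover have "(\<lambda>i. v i p) \<in> {0..n} \<rightarrow> carrier (stalk A p)"
      using funcset_mem[OF v] section_closed[OF _ p] by blast
    ultimately have "v 0 p \<in> {\<zero>\<^bsub>stalk A p\<^esub>}"
      using special_stalk[OF pX] P unfolding special_algebra_def special_ideal_def by blast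
    then show "v 0 p = \<zero>\<^bsub>\<O> U\<^esub> p" using p by (simp add: section_ops)
  qed (use funcset_mem[OF v, of 0] in simp_all)
  then show "v 0 \<in> {\<zero>\<^bsub>\<O> U\<^esub>}" by simp
qed

text \<open>The inverses taken in the stalks fit together: where \<open>s\<close> is
  \<open>a/b\<close>, invertibility at each point keeps \<open>a\<close> out of the prime, so the
  inverse is \<open>b/a\<close> on the same open set.\<close>

lemma section_unit:
  assumes U: "openin (zariski K A) U" and s: "s \<in> carrier (\<O> U)"
    and units: "\<And>p. p \<in> U \<Longrightarrow> s p \<in> Units (stalk A p)"
  shows "s \<in> Units (\<O> U)"
proof -
  have UX: "U \<subseteq> Spec" by (rule openin_subset_X[OF U])
  let ?t = "\<lambda>p \<in> U. inv\<^bsub>stalk A p\<^esub> s p"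
  have mon: "Group.monoid (stalk A p)" if "p \<in> U" for p
    using algebra.M_cring[OF algebra_stalk] UX that cring.axioms(1) ring.is_monoid by blast
  have t: "?t \<in> carrier (\<O> U)"
  proof (rule sectionI[OF _ UX])
    fix p assume "p \<in> U"
    with s obtain a b V where ab: "a \<in> carrier A" "b \<in> carrier A" "openin (zariski K A) V"
      "V \<subseteq> U" "p \<in> V" "\<And>q. q \<in> V \<Longrightarrow> b \<notin> q" "\<And>q. q \<in> V \<Longrightarrow> s q = sf q a b"
      by (rule sectionE) (rule that)
    have "a \<notin> q \<and> ?t q = sf q b a" if q: "q \<in> V" for q
    proof -
      have qU: "q \<in> U" and qX: "q \<in> Spec" using q ab(4) UX by auto
      have b: "b \<notin> q" by (rule ab(6)[OF q])
      have a: "a \<notin> q"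
        using units[OF qU] sf_unit_iff[OF qX ab(1,2) b] by (simp add: ab(7)[OF q])
      have "sf q a b \<otimes>\<^bsub>stalk A q\<^esub> sf q b a = \<one>\<^bsub>stalk A q\<^esub>"
        "sf q b a \<otimes>\<^bsub>stalk A q\<^esub> sf q a b = \<one>\<^bsub>stalk A q\<^esub>"
        unfolding one_stalk[OF qX] sf_mult[OF qX ab(1,2) b ab(2,1) a] sf_mult[OF qX ab(2,1) a ab(1,2) b]
        using ab(1,2) a b mult_notin[OF qX] one_notin[OF qX]
        by (intro sf_eqI[OF qX]; simp add: m_comm)+
      then have "inv\<^bsub>stalk A q\<^esub> s q = sf q b a"
        unfolding ab(7)[OF q]
        using monoid.inv_unique'[OF mon[OF qU]] sf_closed[OF qX] ab(1,2) a b by metis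
      then show ?thesis using a qU by simp
    qed
    then show "\<exists>a b U'. a \<in> carrier A \<and> b \<in> carrier A \<and> openin (zariski K A) U' \<and> U' \<subseteq> U \<and> p \<in> U' \<and>
      (\<forall>q \<in> U'. b \<notin> q \<and> ?t q = sf q a b)"
      using ab(1-5) by (intro exI[of _ b] exI[of _ a] exI[of _ V] conjI ballI) simp_all
  qed simp
  have "s \<otimes>\<^bsub>\<O> U\<^esub> ?t = \<one>\<^bsub>\<O> U\<^esub>" "?t \<otimes>\<^bsub>\<O> U\<^esub> s = \<one>\<^bsub>\<O> U\<^esub>"
    using section_mult_closed[OF _ _ UX] section_one_zero_closed[OF U] s t
    by (auto intro!: section_eqI[of _ U]
        simp: section_ops monoid.Units_r_inv[OF mon units] monoid.Units_l_inv[OF mon units])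
  then show ?thesis
    unfolding Units_def using s t by blast
qed

lemma star_sections:
  assumes U: "openin (zariski K A) U"
  shows "star_algebra K (\<O> U)"
  unfolding star_algebra_def
proof (intro conjI algebra_sections[OF U] subsetI)
  interpret O: algebra K "\<O> U" by (rule algebra_sections[OF U])
  fix x assume "x \<in> M_set K (\<O> U)"
  then obtain n D v where x: "x = alg_eval K (\<O> U) D v" and D: "D \<in> algebraic_signature K n"
    and v: "v \<in> {1..n} \<rightarrow> carrier (\<O> U)"
    unfolding M_set_def by blast
  have polys: "D \<in> polys {1..n}" using D by (simp add: algebraic_signature_def)
  show "x \<in> Units (\<O> U)"
    unfolding x
  proof (rule section_unit[OF U O.alg_eval_closed[OF polys v]])
    fix p assume p: "p \<in> U"
    then have pX: "p \<in> Spec" using openin_subset_X[OF U] by blast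
    have "(\<lambda>i. v i p) \<in> {1..n} \<rightarrow> carrier (stalk A p)"
      using funcset_mem[OF v] section_closed[OF _ p] by blast
    from star_stalk[OF pX D this] show "alg_eval K (\<O> U) D v p \<in> Units (stalk A p)"
      using alg_eval_hom[OF algebra_sections[OF U] algebra_stalk[OF pX] evaluation_hom[OF p] polys v]
      by simp
  qed
qed

section \<open>Restriction, gluing and the sheaf axioms\<close>

lemma section_restrict_closed:
  assumes U: "openin (zariski K A) U" and V: "openin (zariski K A) V" "V \<subseteq> U"
    and s: "s \<in> carrier (\<O> U)"
  shows "restrict s V \<in> carrier (\<O> V)"
proof (rule sectionI)
  fix p assume p: "p \<in> V"
  then have "p \<in> U" using V(2) by blast
  with s obtain a b W where ab: "a \<in> carrier A" "b \<in> carrier A" "openin (zariski K A) W"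
    "W \<subseteq> U" "p \<in> W" "\<And>q. q \<in> W \<Longrightarrow> b \<notin> q" "\<And>q. q \<in> W \<Longrightarrow> s q = sf q a b"
    by (rule sectionE) (rule that)
  show "\<exists>a b U'. a \<in> carrier A \<and> b \<in> carrier A \<and> openin (zariski K A) U' \<and> U' \<subseteq> V \<and> p \<in> U' \<and>
      (\<forall>q \<in> U'. b \<notin> q \<and> restrict s V q = sf q a b)"
    using ab V p
    by (intro exI[of _ a] exI[of _ b] exI[of _ "W \<inter> V"] conjI ballI) auto
qed (use openin_subset_X[OF V(1)] in auto)

text \<open>For the empty family the union is empty, and the function that is
  \<open>undefined\<close> everywhere is the only section over it.\<close>

lemma section_glue:
  assumes op: "\<And>U. U \<in> \<U> \<Longrightarrow> openin (zariski K A) U"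
    and \<tau>: "\<And>U. U \<in> \<U> \<Longrightarrow> \<tau> U \<in> carrier (\<O> U)"
    and compat: "\<And>U V. U \<in> \<U> \<Longrightarrow> V \<in> \<U> \<Longrightarrow> restrict (\<tau> U) (U \<inter> V) = restrict (\<tau> V) (U \<inter> V)"
  shows "\<exists>!t. t \<in> carrier (\<O> (\<Union>\<U>)) \<and> (\<forall>U \<in> \<U>. restrict t U = \<tau> U)"
proof -
  \<comment> \<open>Some member of the cover around \<open>p\<close> is chosen;
    \<open>compat\<close> makes the value independent of the choice.\<close>
  define t where "t = (\<lambda>p \<in> \<Union>\<U>. \<tau> (SOME U. U \<in> \<U> \<and> p \<in> U) p)"
  have t_eq: "t p = \<tau> U p" if U: "U \<in> \<U>" "p \<in> U" for U p
  proof -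
    let ?V = "SOME V. V \<in> \<U> \<and> p \<in> V"
    have V: "?V \<in> \<U> \<and> p \<in> ?V" using U by (metis (mono_tags, lifting) someI)
    have "\<tau> ?V p = restrict (\<tau> ?V) (?V \<inter> U) p" using V U(2) by simp
    also have "\<dots> = restrict (\<tau> U) (?V \<inter> U) p" using compat[of ?V U] V U(1) by simp
    also have "\<dots> = \<tau> U p" using V U(2) by simp
    finally show ?thesis using U by (auto simp: t_def)
  qed
  have t: "t \<in> carrier (\<O> (\<Union>\<U>))"
  proof (rule sectionI)
    show "t \<in> extensional (\<Union>\<U>)" by (simp add: t_def)
    show "\<Union>\<U> \<subseteq> Spec" using op openin_subset_X by blast
    fix p assume "p \<in> \<Union>\<U>"
    then obtain U where U: "U \<in> \<U>" "p \<in> U" by blast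
    obtain a b W where ab: "a \<in> carrier A" "b \<in> carrier A" "openin (zariski K A) W"
      "W \<subseteq> U" "p \<in> W" "\<And>q. q \<in> W \<Longrightarrow> b \<notin> q" "\<And>q. q \<in> W \<Longrightarrow> \<tau> U q = sf q a b"
      by (rule sectionE[OF \<tau>[OF U(1)] U(2)]) (rule that)
    have "b \<notin> q \<and> t q = sf q a b" if "q \<in> W" for q
      using t_eq[OF U(1), of q] ab(4) ab(6,7)[OF that] that by auto
    then show "\<exists>a b U'. a \<in> carrier A \<and> b \<in> carrier A \<and> openin (zariski K A) U' \<and> U' \<subseteq> \<Union>\<U> \<and> p \<in> U' \<and>
      (\<forall>q \<in> U'. b \<notin> q \<and> t q = sf q a b)"
      using ab(1-5) U(1) by (intro exI[of _ a] exI[of _ b] exI[of _ W] conjI ballI) auto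
  qed
  have restr: "restrict t U = \<tau> U" if "U \<in> \<U>" for U
    by (rule extensionalityI[OF _ section_ext[OF \<tau>[OF that]]]) (simp_all add: t_eq[OF that])
  show ?thesis
  proof (rule ex1I[of _ t])
    show "t \<in> carrier (\<O> (\<Union>\<U>)) \<and> (\<forall>U \<in> \<U>. restrict t U = \<tau> U)" using t restr by blast
    fix t' assume t': "t' \<in> carrier (\<O> (\<Union>\<U>)) \<and> (\<forall>U \<in> \<U>. restrict t' U = \<tau> U)"
    show "t' = t"
    proof (rule section_eqI[OF _ t])
      show "t' \<in> carrier (\<O> (\<Union>\<U>))" using t' by blast
      fix p assume "p \<in> \<Union>\<U>"
      then obtain U where U: "U \<in> \<U>" "p \<in> U" by blast
      then have "t' p = restrict t' U p" by simp
      also have "\<dots> = t p" using t' U t_eq[OF U] by simp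
      finally show "t' p = t p" .
    qed
  qed
qed

theorem structure_sheaf_is_sheaf:
  "sheaf_of_special_star_algebras K (zariski K A) \<O> (\<lambda>U V s. restrict s V)"
proof (intro sheaf_of_special_star_algebras.intro sheaf_of_algebras.intro
    sheaf_of_special_star_algebras_axioms.intro)
  fix U V assume UV: "openin (zariski K A) U" "openin (zariski K A) V" "V \<subseteq> U"
  show "(\<lambda>s. restrict s V) \<in> alg_hom K (\<O> U) (\<O> V)"
    unfolding alg_hom_def
  proof (intro CollectI conjI ring_hom_memI ballI)
    show "restrict s V \<in> carrier (\<O> V)" if "s \<in> carrier (\<O> U)" for s
      by (rule section_restrict_closed[OF UV that])
  qed (use UV(3) in \<open>auto simp: structure_sheaf_def fun_eq_iff\<close>)
next
  fix U s assume "openin (zariski K A) U" "s \<in> carrier (\<O> U)"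
  then show "restrict s U = s" by (simp add: section_ext extensional_restrict)
next
  fix U V W s assume "W \<subseteq> V"
  then show "restrict (restrict s V) W = restrict s W" by (auto simp: fun_eq_iff)
next
  fix \<U> \<tau>
  assume "\<And>U. U \<in> \<U> \<Longrightarrow> openin (zariski K A) U" "\<And>U. U \<in> \<U> \<Longrightarrow> \<tau> U \<in> carrier (\<O> U)"
    "\<And>U V. U \<in> \<U> \<Longrightarrow> V \<in> \<U> \<Longrightarrow> restrict (\<tau> U) (U \<inter> V) = restrict (\<tau> V) (U \<inter> V)"
  then show "\<exists>!t. t \<in> carrier (\<O> (\<Union>\<U>)) \<and> (\<forall>U \<in> \<U>. restrict t U = \<tau> U)"
    by (rule section_glue)
qed (simp_all add: algebra_sections special_sections star_sections)

end

section \<open>Global sections\<close>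

context special_field_algebra
begin

lemma openin_Spec: "openin (zariski K A) Spec"
  using openin_topspace[of "zariski K A"] by (simp add: topspace_zariski[OF is_cring])

text \<open>The annihilator of \<open>e\<close> is special, hence an intersection of special primes.\<close>

lemma locally_zero_mult:
  assumes e: "e \<in> carrier A" and h: "h \<in> carrier A"
    and loc: "\<And>q. q \<in> Spec \<Longrightarrow> h \<notin> q \<Longrightarrow> \<exists>u \<in> carrier A. u \<notin> q \<and> u \<otimes> e = \<zero>"
  shows "e \<otimes> h = \<zero>"
proof (rule ccontr)
  let ?I = "{z \<in> carrier A. e \<otimes> z \<in> {\<zero>}}"
  assume "e \<otimes> h \<noteq> \<zero>"
  then have "h \<notin> ?I" by simp
  then obtain p where p: "p \<in> Spec" "?I \<subseteq> p" "h \<notin> p"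
    using special_prime_avoiding[OF special_ideal_colon[OF special_zero e] h] by metis
  from loc[OF p(1,3)] obtain u where u: "u \<in> carrier A" "u \<notin> p" "u \<otimes> e = \<zero>" by blast
  then have "u \<in> ?I" using e by (simp add: m_comm)
  then show False using p(2) u(2) by blast
qed

text \<open>Equality in each stalk gives a multiplier \<open>u\<close> that depends on the point.
  Applied to \<open>a d - c b\<close>, \<open>locally_zero_mult\<close> replaces all of them by the
  one factor \<open>h\<close>.\<close>

lemma fractions_eq_on_basic_open:
  assumes c: "a \<in> carrier A" "b \<in> carrier A" "c \<in> carrier A" "d \<in> carrier A" "h \<in> carrier A"
    and eq: "\<And>q. q \<in> Spec \<Longrightarrow> h \<notin> q \<Longrightarrow> b \<notin> q \<and> d \<notin> q \<and> sf q a b = sf q c d"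
  shows "(a \<otimes> d) \<otimes> h = (c \<otimes> b) \<otimes> h"
proof -
  have "(a \<otimes> d \<ominus> c \<otimes> b) \<otimes> h = \<zero>"
  proof (rule locally_zero_mult)
    fix q assume q: "q \<in> Spec" "h \<notin> q"
    then obtain u where u: "u \<in> carrier A" "u \<notin> q" "u \<otimes> (a \<otimes> d) = u \<otimes> (c \<otimes> b)"
      using eq[OF q] sf_eq_iff[OF q(1) c(1,2) _ c(3,4)] by metis
    have "u \<otimes> (a \<otimes> d \<ominus> c \<otimes> b) = u \<otimes> (a \<otimes> d) \<ominus> u \<otimes> (c \<otimes> b)"
      using c u(1) by algebra
    also have "\<dots> = \<zero>" using u c by (simp add: minus_eq r_neg)
    finally show "\<exists>u \<in> carrier A. u \<notin> q \<and> u \<otimes> (a \<otimes> d \<ominus> c \<otimes> b) = \<zero>" using u by blast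
  qed (use c in auto)
  moreover have "(a \<otimes> d) \<otimes> h = (a \<otimes> d \<ominus> c \<otimes> b) \<otimes> h \<oplus> (c \<otimes> b) \<otimes> h"
    using c by algebra
  ultimately show ?thesis using c by simp
qed

text \<open>The case \<open>h = 1\<close>: over the whole spectrum no multiplier is left. This gives
  injectivity of both maps to global sections.\<close>

lemma fractions_eq:
  assumes c: "a \<in> carrier A" "b \<in> carrier A" "c \<in> carrier A" "d \<in> carrier A"
    and eq: "\<And>q. q \<in> Spec \<Longrightarrow> b \<notin> q \<and> d \<notin> q \<and> sf q a b = sf q c d"
  shows "a \<otimes> d = c \<otimes> b"
  using fractions_eq_on_basic_open[OF c one_closed eq] c by simp

lemma basic_open_base:
  assumes "openin (zariski K A) V" "p \<in> V"
  obtains h where "h \<in> carrier A" "h \<notin> p" "\<And>q. q \<in> Spec \<Longrightarrow> h \<notin> q \<Longrightarrow> q \<in> V"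
proof -
  from assms(1) obtain H where H: "H \<subseteq> carrier A" "V = (\<Union>h \<in> H. basic_open K A h)"
    unfolding openin_zariski_iff[OF is_cring] by (elim exE conjE) (rule that)
  with assms(2) obtain h where "h \<in> H" "p \<in> basic_open K A h" by auto
  then show ?thesis
    using H by (intro that[of h]) (auto simp: basic_open_def)
qed

section \<open>Denominators of a global section\<close>

lemma sf_one_hom:
  assumes "p \<in> Spec"
  shows "(\<lambda>a. sf p a \<one>) \<in> ring_hom A (stalk A p)"
proof -
  interpret loc: mult_subset K A "carrier A - p" by (rule stalk_mult_subset[OF assms])
  show ?thesis
    using loc.frac_one_hom unfolding alg_hom_def stalk_def stalk_fraction_def by blast
qed

text \<open>The numerator \<open>a\<close> must serve all points at once. For a sum of denominators
  the numerators add, for a multiple the numerator is multiplied, so closure is computed in each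
  stalk through the ring homomorphism f \<mapsto> f/1.\<close>

lemma ideal_of_denominators:
  assumes s: "s \<in> carrier (\<O> Spec)"
  shows "ideal {f \<in> carrier A. \<exists>a \<in> carrier A. \<forall>p \<in> Spec. sf p f \<one> \<otimes>\<^bsub>stalk A p\<^esub> s p = sf p a \<one>} A"
    (is "ideal ?J A")
proof -
  note sp = section_closed[OF s]
  have add: "f \<oplus> g \<in> ?J" if "f \<in> ?J" "g \<in> ?J" for f g
  proof -
    from that obtain a b where fg: "f \<in> carrier A" "g \<in> carrier A" "a \<in> carrier A" "b \<in> carrier A"
      "\<And>p. p \<in> Spec \<Longrightarrow> sf p f \<one> \<otimes>\<^bsub>stalk A p\<^esub> s p = sf p a \<one>"
      "\<And>p. p \<in> Spec \<Longrightarrow> sf p g \<one> \<otimes>\<^bsub>stalk A p\<^esub> s p = sf p b \<one>" by auto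
    have "sf p (f \<oplus> g) \<one> \<otimes>\<^bsub>stalk A p\<^esub> s p = sf p (a \<oplus> b) \<one>" if p: "p \<in> Spec" for p
    proof -
      interpret L: algebra K "stalk A p" by (rule algebra_stalk[OF p])
      interpret hom: ring_hom_cring A "stalk A p" "\<lambda>a. sf p a \<one>"
        by unfold_locales (rule sf_one_hom[OF p])
      show ?thesis
        using fg p sp[OF p] hom.hom_closed by (simp add: L.l_distr)
    qed
    then show ?thesis using fg by blast
  qed
  have mult: "x \<otimes> f \<in> ?J" if "f \<in> ?J" "x \<in> carrier A" for f x
  proof -
    from that obtain a where f: "f \<in> carrier A" "a \<in> carrier A"
      "\<And>p. p \<in> Spec \<Longrightarrow> sf p f \<one> \<otimes>\<^bsub>stalk A p\<^esub> s p = sf p a \<one>" by auto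
    have "sf p (x \<otimes> f) \<one> \<otimes>\<^bsub>stalk A p\<^esub> s p = sf p (x \<otimes> a) \<one>" if p: "p \<in> Spec" for p
    proof -
      interpret L: algebra K "stalk A p" by (rule algebra_stalk[OF p])
      interpret hom: ring_hom_cring A "stalk A p" "\<lambda>a. sf p a \<one>"
        by unfold_locales (rule sf_one_hom[OF p])
      show ?thesis
        using f p sp[OF p] hom.hom_closed that \<open>x \<in> carrier A\<close> by (simp add: L.m_assoc)
    qed
    then show ?thesis using f that(2) by blast
  qed
  have zero: "\<zero> \<in> ?J"
  proof -
    have "sf p \<zero> \<one> \<otimes>\<^bsub>stalk A p\<^esub> s p = sf p \<zero> \<one>" if p: "p \<in> Spec" for p
    proof -
      interpret L: algebra K "stalk A p" by (rule algebra_stalk[OF p])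
      show ?thesis using sp[OF p] by (simp add: zero_stalk[OF p, symmetric])
    qed
    then show ?thesis by blast
  qed
  show ?thesis
  proof (rule idealI[OF ring_axioms])
    show "subgroup ?J (add_monoid A)"
    proof (rule add.subgroupI)
      show "?J \<noteq> {}" using zero by blast
      show "\<ominus> f \<in> ?J" if "f \<in> ?J" for f
        using mult[OF that, of "\<ominus> \<one>"] that by (simp add: l_minus)
    qed (use add in auto)
    show "x \<otimes> f \<in> ?J" "f \<otimes> x \<in> ?J" if "f \<in> ?J" "x \<in> carrier A" for f x
      using mult[OF that] that by (auto simp: m_comm)
  qed
qed

text \<open>One element of \<open>M\<close> in the ideal of denominators serves the whole spectrum,
  so no finite subcover has to be extracted.\<close>

theorem global_section_fraction:
  assumes s: "s \<in> carrier (\<O> Spec)"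
  obtains a \<alpha> where "a \<in> carrier A" "\<alpha> \<in> M_set K A" "s = (\<lambda>p \<in> Spec. sf p a \<alpha>)"
proof -
  let ?J = "{f \<in> carrier A. \<exists>a \<in> carrier A. \<forall>p \<in> Spec. sf p f \<one> \<otimes>\<^bsub>stalk A p\<^esub> s p = sf p a \<one>}"
  have "?J \<inter> M_set K A \<noteq> {}"
  proof
    assume "?J \<inter> M_set K A = {}"
    then obtain p where p: "p \<in> Spec" "?J \<subseteq> p"
      by (rule special_prime_disjoint_M_set[OF ideal_of_denominators[OF s]]) (rule that)
    obtain a b V where ab: "a \<in> carrier A" "b \<in> carrier A" "openin (zariski K A) V" "p \<in> V"
      "\<And>q. q \<in> V \<Longrightarrow> b \<notin> q" "\<And>q. q \<in> V \<Longrightarrow> s q = sf q a b"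
      by (rule sectionE[OF s p(1)]) (rule that)
    obtain h where h: "h \<in> carrier A" "h \<notin> p" "\<And>q. q \<in> Spec \<Longrightarrow> h \<notin> q \<Longrightarrow> q \<in> V"
      by (rule basic_open_base[OF ab(3,4)]) (rule that)
    \<comment> \<open>The claim includes points \<open>q\<close> containing \<open>h\<close>, where
      \<open>s\<close> is not known to be \<open>a/b\<close>. Near \<open>q\<close> let
      \<open>s\<close> be \<open>c/d\<close> where \<open>k\<close> does not vanish. The two
      fractions agree where neither \<open>h\<close> nor \<open>k\<close> vanishes, which yields an
      identity in A with factor \<open>h k\<close>; the factor \<open>k\<close> is harmless at
      \<open>q\<close>, and \<open>h\<close> is part of the claim.\<close>
    have "sf q (h \<otimes> b) \<one> \<otimes>\<^bsub>stalk A q\<^esub> s q = sf q (h \<otimes> a) \<one>" if q: "q \<in> Spec" for q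
    proof -
      obtain c d W where cd: "c \<in> carrier A" "d \<in> carrier A" "openin (zariski K A) W" "q \<in> W"
        "\<And>r. r \<in> W \<Longrightarrow> d \<notin> r" "\<And>r. r \<in> W \<Longrightarrow> s r = sf r c d"
        by (rule sectionE[OF s q]) (rule that)
      obtain k where k: "k \<in> carrier A" "k \<notin> q" "\<And>r. r \<in> Spec \<Longrightarrow> k \<notin> r \<Longrightarrow> r \<in> W"
        by (rule basic_open_base[OF cd(3,4)]) (rule that)
      have "(a \<otimes> d) \<otimes> (h \<otimes> k) = (c \<otimes> b) \<otimes> (h \<otimes> k)"
      proof (rule fractions_eq_on_basic_open)
        fix r assume r: "r \<in> Spec" "h \<otimes> k \<notin> r"
        then have "h \<notin> r" "k \<notin> r" using in_prime_mult[OF r(1)] h(1) k(1) by metis+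
        then have rVW: "r \<in> V" "r \<in> W" using h(3) k(3) r(1) by auto
        then show "b \<notin> r \<and> d \<notin> r \<and> sf r a b = sf r c d"
          using ab(5,6)[OF rVW(1)] cd(5,6)[OF rVW(2)] by simp
      qed (use ab cd h k in auto)
      moreover have "k \<otimes> ((h \<otimes> b) \<otimes> c \<otimes> \<one>) = (c \<otimes> b) \<otimes> (h \<otimes> k)"
        "k \<otimes> ((h \<otimes> a) \<otimes> (\<one> \<otimes> d)) = (a \<otimes> d) \<otimes> (h \<otimes> k)"
        using ab(1,2) cd(1,2) h(1) k(1) by algebra+
      ultimately have "k \<otimes> ((h \<otimes> b) \<otimes> c \<otimes> \<one>) = k \<otimes> ((h \<otimes> a) \<otimes> (\<one> \<otimes> d))" by simp
      then have "sf q ((h \<otimes> b) \<otimes> c) (\<one> \<otimes> d) = sf q (h \<otimes> a) \<one>"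
        using ab(1,2) cd(1,2) cd(5)[OF cd(4)] h(1) k(1,2) one_notin[OF q]
        by (intro iffD2[OF sf_eq_iff[OF q]] bexI[OF _ k(1)] conjI) auto
      then show ?thesis
        using ab(1,2) cd(1,2) cd(5)[OF cd(4)] h(1) one_notin[OF q]
        by (simp only: cd(6)[OF cd(4)] sf_mult[OF q] m_closed one_closed not_False_eq_True simp_thms)
    qed
    then have "h \<otimes> b \<in> ?J" using h(1) ab(1,2) by blast
    then have "h \<otimes> b \<in> p" using p(2) by blast
    then show False using mult_notin[OF p(1) h(1) ab(2) h(2) ab(5)[OF ab(4)]] by blast
  qed
  then obtain \<alpha> a where \<alpha>: "\<alpha> \<in> M_set K A" and a: "a \<in> carrier A"
    and eq: "\<And>p. p \<in> Spec \<Longrightarrow> sf p \<alpha> \<one> \<otimes>\<^bsub>stalk A p\<^esub> s p = sf p a \<one>" by auto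
  note \<alpha>c = M_set_closed[OF \<alpha>]
  \<comment> \<open>As \<open>\<alpha>\<close> lies in no special prime, it can be divided out in
    every stalk.\<close>
  have "s p = sf p a \<alpha>" if p: "p \<in> Spec" for p
  proof -
    obtain c d where cd: "c \<in> carrier A" "d \<in> carrier A" "d \<notin> p" "s p = sf p c d"
      by (rule stalk_cases[OF p section_closed[OF s p]]) (rule that)
    have "sf p (\<alpha> \<otimes> c) (\<one> \<otimes> d) = sf p a \<one>"
      using eq[OF p] sf_mult[OF p \<alpha>c one_closed one_notin[OF p] cd(1-3)] cd(4) by simp
    then obtain u where u: "u \<in> carrier A" "u \<notin> p" "u \<otimes> ((\<alpha> \<otimes> c) \<otimes> \<one>) = u \<otimes> (a \<otimes> (\<one> \<otimes> d))"
      using sf_eq_iff[OF p, of "\<alpha> \<otimes> c" "\<one> \<otimes> d" a \<one>] cd a \<alpha>c one_notin[OF p] by auto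
    then have "u \<otimes> (c \<otimes> \<alpha>) = u \<otimes> (a \<otimes> d)" using cd a \<alpha>c by (simp add: m_comm)
    then show ?thesis
      unfolding cd(4) using cd a \<alpha>c u M_set_disjoint_Spec2[OF p \<alpha>]
      by (intro iffD2[OF sf_eq_iff[OF p]] bexI[OF _ u(1)] conjI) auto
  qed
  then have "s = (\<lambda>p \<in> Spec. sf p a \<alpha>)"
    using section_ext[OF s] by (intro extensionalityI[of _ Spec]) auto
  then show ?thesis using that a \<alpha> by blast
qed

section \<open>The natural map from the canonical localisation\<close>

lemma M_mult_subset: "mult_subset K A (M_set K A)"
  by unfold_locales (use M_set_closed one_in_M_set M_set_mult in auto)

text \<open>Elements of the localisation are classes of pairs, so the value at a point is a union
  over representatives, in the style of the operations on fractions.\<close>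

definition global_section :: "('a \<times> 'a) set \<Rightarrow> 'a set \<Rightarrow> ('a \<times> 'a) set" where
  "global_section x = (\<lambda>p \<in> Spec. \<Union>(g, \<alpha>) \<in> x. sf p g \<alpha>)"

interpretation M: mult_subset K A "M_set K A"
  by (rule M_mult_subset)

text \<open>The multiplier witnessing equality of two fractions over \<open>M\<close> is itself in
  \<open>M\<close>, hence outside every special prime, and witnesses equality in every
  stalk.\<close>

lemma global_section_frac:
  assumes g: "g \<in> carrier A" and \<alpha>: "\<alpha> \<in> M_set K A"
  shows "global_section (fraction A (M_set K A) g \<alpha>) = (\<lambda>p \<in> Spec. sf p g \<alpha>)"
  unfolding global_section_def
proof (rule restrict_ext)
  fix p assume p: "p \<in> Spec"
  show "(\<Union>(g, \<alpha>) \<in> fraction A (M_set K A) g \<alpha>. sf p g \<alpha>) = sf p g \<alpha>"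
  proof (rule M.UN_frac[OF g \<alpha>])
    fix f \<beta> assume f: "f \<in> carrier A" "\<beta> \<in> M_set K A" "M.frac f \<beta> = M.frac g \<alpha>"
    from f(3) obtain u where u: "u \<in> M_set K A" "u \<otimes> (f \<otimes> \<alpha>) = u \<otimes> (g \<otimes> \<beta>)"
      unfolding M.frac_eq_iff[OF f(1,2) g \<alpha>] by blast
    show "sf p f \<beta> = sf p g \<alpha>"
      using f(1,2) g \<alpha> u(2) M_set_disjoint_Spec2[OF p] M_set_closed u(1)
      by (intro iffD2[OF sf_eq_iff[OF p]] bexI[OF _ M_set_closed[OF u(1)]] conjI) auto
  qed
qed

lemma fraction_section_closed:
  assumes "g \<in> carrier A" "\<alpha> \<in> M_set K A"
  shows "(\<lambda>p \<in> Spec. sf p g \<alpha>) \<in> carrier (\<O> Spec)"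
  by (rule section_fraction[OF openin_Spec assms(1) M_set_closed[OF assms(2)]
        M_set_disjoint_Spec2[OF _ assms(2)]])

text \<open>The operations agree stalk by stalk; injectivity rests on \<open>fractions_eq\<close>,
  surjectivity on \<open>global_section_fraction\<close>.\<close>

theorem global_section_iso:
  "global_section \<in> alg_iso K (canonical_localisation K A) (\<O> Spec)"
  unfolding alg_iso_def alg_hom_def canonical_localisation_def
proof (intro CollectI conjI ring_hom_memI ballI)
  note notin = M_set_disjoint_Spec2
  show closed: "global_section x \<in> carrier (\<O> Spec)" if "x \<in> carrier M.Loc" for x
    using that by (rule M.Loc_cases) (simp add: global_section_frac fraction_section_closed)
  have mult: "global_section (x \<otimes>\<^bsub>M.Loc\<^esub> y) = global_section x \<otimes>\<^bsub>\<O> Spec\<^esub> global_section y"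
    and add: "global_section (x \<oplus>\<^bsub>M.Loc\<^esub> y) = global_section x \<oplus>\<^bsub>\<O> Spec\<^esub> global_section y"
    if x: "x \<in> carrier M.Loc" and y: "y \<in> carrier M.Loc" for x y
  proof -
    obtain a \<alpha> where a: "a \<in> carrier A" "\<alpha> \<in> M_set K A" "x = M.frac a \<alpha>"
      using x by (rule M.Loc_cases)
    obtain b \<beta> where b: "b \<in> carrier A" "\<beta> \<in> M_set K A" "y = M.frac b \<beta>"
      using y by (rule M.Loc_cases)
    note c = a(1,2) b(1,2) M_set_closed[OF a(2)] M_set_closed[OF b(2)] M_set_mult
    show "global_section (x \<otimes>\<^bsub>M.Loc\<^esub> y) = global_section x \<otimes>\<^bsub>\<O> Spec\<^esub> global_section y"
      using c by (simp add: a(3) b(3) M.frac_mult global_section_frac structure_sheaf_def sf_mult notin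
          cong: restrict_cong)
    show "global_section (x \<oplus>\<^bsub>M.Loc\<^esub> y) = global_section x \<oplus>\<^bsub>\<O> Spec\<^esub> global_section y"
      using c by (simp add: a(3) b(3) M.frac_add global_section_frac structure_sheaf_def sf_add notin
          cong: restrict_cong)
  qed
  show "global_section (x \<otimes>\<^bsub>M.Loc\<^esub> y) = global_section x \<otimes>\<^bsub>\<O> Spec\<^esub> global_section y"
    "global_section (x \<oplus>\<^bsub>M.Loc\<^esub> y) = global_section x \<oplus>\<^bsub>\<O> Spec\<^esub> global_section y"
    if "x \<in> carrier M.Loc" "y \<in> carrier M.Loc" for x y
    using mult[OF that] add[OF that] .
  show "global_section \<one>\<^bsub>M.Loc\<^esub> = \<one>\<^bsub>\<O> Spec\<^esub>"
    by (simp add: M.one_Loc global_section_frac one_in_M_set structure_sheaf_def one_stalk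
        cong: restrict_cong)
  show "global_section (c \<odot>\<^bsub>M.Loc\<^esub> x) = c \<odot>\<^bsub>\<O> Spec\<^esub> global_section x"
    if "c \<in> carrier K" "x \<in> carrier M.Loc" for c x
    using that(2)
  proof (rule M.Loc_cases)
    fix a \<alpha> assume a: "a \<in> carrier A" "\<alpha> \<in> M_set K A" "x = M.frac a \<alpha>"
    show ?thesis
      using a(1,2) that(1) M_set_closed[OF a(2)]
      by (simp add: a(3) M.frac_smult global_section_frac structure_sheaf_def sf_smult notin
          cong: restrict_cong)
  qed
  show "bij_betw global_section (carrier M.Loc) (carrier (\<O> Spec))"
    unfolding bij_betw_def
  proof
    show "inj_on global_section (carrier M.Loc)"
    proof (rule inj_onI)
      fix x y assume x: "x \<in> carrier M.Loc" and y: "y \<in> carrier M.Loc"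
        and eq: "global_section x = global_section y"
      obtain a \<alpha> where a: "a \<in> carrier A" "\<alpha> \<in> M_set K A" "x = M.frac a \<alpha>"
        using x by (rule M.Loc_cases)
      obtain b \<beta> where b: "b \<in> carrier A" "\<beta> \<in> M_set K A" "y = M.frac b \<beta>"
        using y by (rule M.Loc_cases)
      have "sf p a \<alpha> = sf p b \<beta>" if "p \<in> Spec" for p
        using fun_cong[OF eq, of p] that
        by (simp add: a(3) b(3) global_section_frac[OF a(1,2)] global_section_frac[OF b(1,2)])
      then have "a \<otimes> \<beta> = b \<otimes> \<alpha>"
        using a(1,2) b(1,2) notin by (intro fractions_eq) (auto simp: M_set_closed)
      then show "x = y" unfolding a(3) b(3) by (intro M.frac_eqI a(1,2) b(1,2))
    qed
    have "s \<in> global_section ` carrier M.Loc" if s: "s \<in> carrier (\<O> Spec)" for s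
    proof -
      obtain a \<alpha> where a: "a \<in> carrier A" "\<alpha> \<in> M_set K A" "s = (\<lambda>p \<in> Spec. sf p a \<alpha>)"
        by (rule global_section_fraction[OF s]) (rule that)
      then have "s = global_section (M.frac a \<alpha>)" by (simp add: global_section_frac)
      then show ?thesis using M.frac_closed[OF a(1,2)] by (rule image_eqI)
    qed
    then show "global_section ` carrier M.Loc = carrier (\<O> Spec)" using closed by blast
  qed
qed

text \<open>A global section is \<open>a/\<alpha>\<close> with \<open>\<alpha>\<close> in
  \<open>M\<close>, now a unit of A, so it is the image of \<open>a\<close> times the inverse of
  \<open>\<alpha>\<close>. The map from A is treated directly, without passing through the
  localisation.\<close>

theorem star_algebra_iso:
  assumes star: "star_algebra K A"
  shows "(\<lambda>a. \<lambda>p \<in> Spec. sf p a \<one>) \<in> alg_iso K A (\<O> Spec)"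
  unfolding alg_iso_def alg_hom_def
proof (intro CollectI conjI ring_hom_memI ballI)
  show closed: "(\<lambda>p \<in> Spec. sf p a \<one>) \<in> carrier (\<O> Spec)" if "a \<in> carrier A" for a
    by (rule fraction_section_closed[OF that one_in_M_set])
  show "(\<lambda>p \<in> Spec. sf p (a \<otimes> b) \<one>) = (\<lambda>p \<in> Spec. sf p a \<one>) \<otimes>\<^bsub>\<O> Spec\<^esub> (\<lambda>p \<in> Spec. sf p b \<one>)"
    "(\<lambda>p \<in> Spec. sf p (a \<oplus> b) \<one>) = (\<lambda>p \<in> Spec. sf p a \<one>) \<oplus>\<^bsub>\<O> Spec\<^esub> (\<lambda>p \<in> Spec. sf p b \<one>)"
    if "a \<in> carrier A" "b \<in> carrier A" for a b
    using that by (simp_all add: structure_sheaf_def sf_mult sf_add one_notin cong: restrict_cong)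
  show "(\<lambda>p \<in> Spec. sf p \<one> \<one>) = \<one>\<^bsub>\<O> Spec\<^esub>"
    by (simp add: structure_sheaf_def one_stalk cong: restrict_cong)
  show "(\<lambda>p \<in> Spec. sf p (c \<odot> a) \<one>) = c \<odot>\<^bsub>\<O> Spec\<^esub> (\<lambda>p \<in> Spec. sf p a \<one>)"
    if "c \<in> carrier K" "a \<in> carrier A" for c a
    using that by (simp add: structure_sheaf_def sf_smult one_notin cong: restrict_cong)
  show "bij_betw (\<lambda>a. \<lambda>p \<in> Spec. sf p a \<one>) (carrier A) (carrier (\<O> Spec))"
    unfolding bij_betw_def
  proof
    show "inj_on (\<lambda>a. \<lambda>p \<in> Spec. sf p a \<one>) (carrier A)"
    proof (rule inj_onI)
      fix a b assume ab: "a \<in> carrier A" "b \<in> carrier A"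
        and eq: "(\<lambda>p \<in> Spec. sf p a \<one>) = (\<lambda>p \<in> Spec. sf p b \<one>)"
      have "sf p a \<one> = sf p b \<one>" if "p \<in> Spec" for p
        using fun_cong[OF eq, of p] that by simp
      then have "a \<otimes> \<one> = b \<otimes> \<one>"
        using ab one_notin by (intro fractions_eq) auto
      then show "a = b" using ab by simp
    qed
    have "s \<in> (\<lambda>a. \<lambda>p \<in> Spec. sf p a \<one>) ` carrier A" if s: "s \<in> carrier (\<O> Spec)" for s
    proof -
      obtain a \<alpha> where a: "a \<in> carrier A" "\<alpha> \<in> M_set K A" "s = (\<lambda>p \<in> Spec. sf p a \<alpha>)"
        by (rule global_section_fraction[OF s]) (rule that)
      have unit: "\<alpha> \<in> Units A" using star a(2) by (auto simp: star_algebra_def)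
      have "sf p a \<alpha> = sf p (a \<otimes> inv \<alpha>) \<one>" if p: "p \<in> Spec" for p
        by (rule sf_eqI[OF p])
          (use a(1) unit Units_closed[OF unit] M_set_disjoint_Spec2[OF p a(2)] one_notin[OF p]
            in \<open>simp_all add: m_assoc\<close>)
      then have "s = (\<lambda>p \<in> Spec. sf p (a \<otimes> inv \<alpha>) \<one>)"
        unfolding a(3) by (intro restrict_ext)
      then show ?thesis using a(1) unit by (intro image_eqI[of _ _ "a \<otimes> inv \<alpha>"]) auto
    qed
    then show "(\<lambda>a. \<lambda>p \<in> Spec. sf p a \<one>) ` carrier A = carrier (\<O> Spec)" using closed by blast
  qed
qed

end

theorem corollary5p20:
  fixes K :: "('k, 'l) ring_scheme"
    and A :: "('k, 'a, 'm) module_scheme"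
  assumes "field K"
    and "special_algebra K A"
  shows "sheaf_of_special_star_algebras K (zariski K A) (structure_sheaf K A) (\<lambda>U V s. restrict s V)
    \<and> (\<exists>\<phi> \<in> alg_iso K (canonical_localisation K A) (global_sections K A).
         \<forall>g \<in> carrier A. \<forall>\<alpha> \<in> M_set K A.
           \<phi> (fraction A (M_set K A) g \<alpha>) = (\<lambda>p \<in> Spec2 K A. stalk_fraction A p g \<alpha>))
    \<and> (star_algebra K A \<longrightarrow>
         (\<lambda>a. \<lambda>p \<in> Spec2 K A. stalk_fraction A p a \<one>\<^bsub>A\<^esub>) \<in> alg_iso K A (global_sections K A))"
proof -
  interpret field_algebra K A
    using assms by (auto simp: special_algebra_def intro: field_algebra.intro)
  interpret special_field_algebra K A
    using assms(2) by unfold_locales (simp add: special_algebra_def)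
  show ?thesis
    using structure_sheaf_is_sheaf global_section_iso global_section_frac star_algebra_iso by blast
qed

end
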